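(* Let $S$ be a real-analytic function on a neighborhood of the origin in $\mathbb{R}^n$, not identically zero, with $S(0)=0$ and $\nabla S(0)=0$. Let $d$ be its Newton distance, $C(S)$ its central face and $k=\dim C(S)$. There is a neighborhood $U$ of the origin such that for every smooth nonnegative $\phi$ supported in $U$ with $\phi(0)>0$ the following hold (where $C,C'>0$ are constants that may depend on $S$ and $\phi$, and each inequality is asserted for all sufficiently small $\epsilon>0$). (a) $I_{|S|,\phi}(\epsilon) > C\,|\ln\epsilon|^{\,n-k-1}\,\epsilon^{1/d}$. (b) If for each compact face $F$ of $N(S)$ every zero of $S_F(x)$ in $(\mathbb{R}-\{0\})^n$ has order at most $d$, then $I_{|S|,\phi}(\epsilon) < C'\,|\ln\epsilon|^{\,n-k}\,\epsilon^{1/d}$. If, in this situation, there is moreover no compact face $F$ of $N(S)$ with $F\subset C(S)$ such that $S_F(x)$ has a zero of order $d$ somewhere in $(\mathbb{R}-\{0\})^n$, then $I_{|S|,\phi}(\epsilon) < C'\,|\ln\epsilon|^{\,n-k-1}\,\epsilon^{1/d}$. (c) If the maximum order of any zero of any $S_F(x)$ ($F$ a compact face of $N(S)$) on $(\mathbb{R}-\{0\})^n$ is $d'>d$, then $I_{|S|,\phi}(\epsilon) < C'\,\epsilon^{1/d'}$.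
   Context: Write the Taylor expansion of $S$ at the origin as $S(x)=\sum_\alpha s_\alpha x^\alpha$. The Newton polyhedron $N(S)$ is the convex hull of the union, over all $\alpha$ with $s_\alpha\neq 0$, of the octants $Q_\alpha=\{x\in\mathbb{R}^n: x_i\ge\alpha_i \text{ for all } i\}$. Its faces can be of various dimensions, compact or unbounded; a vertex is a compact face of dimension $0$. For a compact face $F$ of $N(S)$, $S_F(x)=\sum_{\alpha\in F}s_\alpha x^\alpha$. The Newton distance of $S$ is $d=\inf\{t:(t,t,\dots,t)\in N(S)\}$. The central face $C(S)$ is the face (compact or not) of $N(S)$ that the line $\{(t,t,\dots,t):t\in\mathbb{R}\}$ intersects in its (relative) interior, i.e. the face whose relative interior contains $(d,\dots,d)$; if the line meets $N(S)$ at a vertex, $C(S)$ is that vertex and $k=0$. The order of a zero $p$ of a function $P$ is the smallest order of a partial derivative of $P$ that is nonzero at $p$. Finally $I_{|S|,\phi}(\epsilon)=\int_{\{x:|S(x)|<\epsilon\}}\phi(x)\,dx$. *)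

theory Defs
  imports "HOL-Analysis.Analysis"
begin

section \<open>Real-analytic functions and Taylor expansions in several variables\<close>

text \<open>A multi-index is a function \<open>'n \<Rightarrow> nat\<close>. The sum over all multi-indices is
  unordered (\<open>has_sum\<close>), i.e. absolutely convergent. Real-analyticity is local representability
  by power series; the coefficients at a point are unique and are the Taylor coefficients there.\<close>

definition has_power_series ::
    "(real^'n \<Rightarrow> real) \<Rightarrow> (('n::finite \<Rightarrow> nat) \<Rightarrow> real) \<Rightarrow> real^'n \<Rightarrow> bool" where
  "has_power_series f a p \<longleftrightarrow>
     (\<exists>r>0. \<forall>x. (\<forall>i. \<bar>x $ i - p $ i\<bar> < r) \<longrightarrow>
        ((\<lambda>\<alpha>. a \<alpha> * (\<Prod>i\<in>UNIV. (x $ i - p $ i) ^ \<alpha> i)) has_sum f x) UNIV)"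

definition real_analytic_on :: "(real^'n::finite \<Rightarrow> real) \<Rightarrow> (real^'n) set \<Rightarrow> bool" where
  "real_analytic_on f W \<longleftrightarrow> (\<forall>p\<in>W. \<exists>a. has_power_series f a p)"


section \<open>Partial derivatives, smoothness, order of a zero\<close>

definition partial_deriv :: "'n::finite \<Rightarrow> (real^'n \<Rightarrow> real) \<Rightarrow> real^'n \<Rightarrow> real" where
  "partial_deriv i f x = deriv (\<lambda>t. f (x + t *\<^sub>R axis i 1)) 0"

primrec partial_derivs :: "'n::finite list \<Rightarrow> (real^'n \<Rightarrow> real) \<Rightarrow> real^'n \<Rightarrow> real" where
  "partial_derivs [] f = f"
| "partial_derivs (j # js) f = partial_deriv j (partial_derivs js f)"

text \<open>Frechet differentiability of every iterated partial derivative is equivalent to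
  \<open>C\<^sup>\<infinity>\<close>: differentiability makes each next partial derivative exist (so that \<open>deriv\<close> is
  meaningful) and each of them continuous.\<close>

definition smooth :: "(real^'n::finite \<Rightarrow> real) \<Rightarrow> bool" where
  "smooth f \<longleftrightarrow> (\<forall>js. partial_derivs js f differentiable_on UNIV)"

text \<open>The order of a partial derivative is the length of its list of directions. The value is
  unspecified if all partial derivatives vanish at \<open>p\<close>; this does not happen for the nonzero
  polynomials \<open>S\<^sub>F\<close> below.\<close>

definition order_at :: "(real^'n::finite \<Rightarrow> real) \<Rightarrow> real^'n \<Rightarrow> nat" where
  "order_at P p = (LEAST m. \<exists>js. length js = m \<and> partial_derivs js P p \<noteq> 0)"

text \<open>Zeros in \<open>(\<real> - {0})\<^sup>n\<close>.\<close>

definition torus_zeros :: "(real^'n::finite \<Rightarrow> real) \<Rightarrow> (real^'n) set" where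
  "torus_zeros P = {p. (\<forall>i. p $ i \<noteq> 0) \<and> P p = 0}"


section \<open>Newton polyhedra\<close>

text \<open>In this section \<open>s\<close> is the family of Taylor coefficients of \<open>S\<close> at the origin.\<close>

definition exponent_point :: "('n::finite \<Rightarrow> nat) \<Rightarrow> real^'n" where
  "exponent_point \<alpha> = (\<chi> i. real (\<alpha> i))"

definition octant :: "('n::finite \<Rightarrow> nat) \<Rightarrow> (real^'n) set" where
  "octant \<alpha> = {x. \<forall>i. x $ i \<ge> real (\<alpha> i)}"

definition newton_polyhedron :: "(('n::finite \<Rightarrow> nat) \<Rightarrow> real) \<Rightarrow> (real^'n) set" where
  "newton_polyhedron s = convex hull (\<Union>\<alpha>\<in>{\<alpha>. s \<alpha> \<noteq> 0}. octant \<alpha>)"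

text \<open>\<open>face_of\<close> also admits the empty set, which is not a face in the intended sense.\<close>

definition compact_faces :: "(('n::finite \<Rightarrow> nat) \<Rightarrow> real) \<Rightarrow> (real^'n) set set" where
  "compact_faces s = {F. F face_of newton_polyhedron s \<and> F \<noteq> {} \<and> compact F}"

text \<open>The index set of this sum is finite whenever \<open>F\<close> is bounded.\<close>

definition face_polynomial ::
    "(('n::finite \<Rightarrow> nat) \<Rightarrow> real) \<Rightarrow> (real^'n) set \<Rightarrow> real^'n \<Rightarrow> real" where
  "face_polynomial s F x =
     (\<Sum>\<alpha>\<in>{\<alpha>. exponent_point \<alpha> \<in> F}. s \<alpha> * (\<Prod>i\<in>UNIV. (x $ i) ^ \<alpha> i))"

definition newton_distance :: "(('n::finite \<Rightarrow> nat) \<Rightarrow> real) \<Rightarrow> real" where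
  "newton_distance s = Inf {t. vec t \<in> newton_polyhedron s}"

text \<open>The relative interiors of the faces of a convex set are pairwise disjoint, so there is at
  most one such face; it exists when \<open>s\<close> is not identically zero.\<close>

definition central_face :: "(('n::finite \<Rightarrow> nat) \<Rightarrow> real) \<Rightarrow> (real^'n) set" where
  "central_face s =
     (THE F. F face_of newton_polyhedron s \<and> vec (newton_distance s) \<in> rel_interior F)"


section \<open>Sublevel set integrals\<close>

definition sublevel_integral ::
    "(real^'n::finite \<Rightarrow> real) \<Rightarrow> (real^'n \<Rightarrow> real) \<Rightarrow> real \<Rightarrow> real" where
  "sublevel_integral S \<phi> \<epsilon> = (LINT x:{x. \<bar>S x\<bar> < \<epsilon>}|lborel. \<phi> x)"

end

(* Cut a neighbourhood of the origin into the dyadic boxes Q_j = {|x_i| ~ 2^(-j_i)}. On Q_j every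
   monomial of S is at most 2^(-m(j)), where m(j) is the minimum of j.x over N(S). After a rescaling
   by a vector at bounded distance from j, the function S / 2^(-m(j)) is a small perturbation of a
   single S_F with F a compact face, on a fixed compact subset of (R - 0)^n. If the zeros of S_F
   have order at most D, some directional derivative of order at most D is bounded below there, so
   |{x in Q_j : |S x| < eps}| <= C 2^(-|j|) (eps 2^(m(j)))^(1/D).

   It remains to sum over j. With p = (d,...,d), the quantity h(j) = p.j - m(j) is nonnegative and
   dominates |w.j| for every direction w of the central face, because p is a relative interior
   point of it. For D = d the j-th term is eps^(1/d) 2^(-h(j)/d), so only the directions normal to
   C(S) are not damped, and these number n - k. One logarithm is saved if in addition D < d for the
   faces inside C(S), since then the terms also decay in |m(j) - log(1/eps)|, or if j is close to
   the normal cone of a face not contained in C(S).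

   For the lower bound, the normal cone of C(S) spans a space of dimension n - k (duality for
   polyhedral cones) and so contains about (log(1/eps))^(n-k-1) lattice points j on the level
   m(j) = log(1/eps) = d|j|; on the corresponding boxes |S| < eps. *)

theory Submission
  imports Defs
begin

text \<open>The estimate on Q_j must have a constant independent of j. Hence closeness of the
  rescaled S to S_F is measured by the absolute sum of the Taylor coefficients of the difference,
  and derivatives along a line are replaced by divided differences: these act termwise on a power
  series and are bounded on monomials whatever the spacing of the nodes, while m + 1 well spaced
  nodes fit into every set of large measure.

  A lattice point j may lie close to several normal cones at once, and how far the exponents off a
  face must be from minimal depends on how flat j is on the face. There are only finitely many
  minimal exponents, so these thresholds can be chosen one after the other. Large entries of j keep
  the moved weight strictly positive, and such weights expose compact faces only; this is why
  hypotheses on compact faces suffice even if C(S) is unbounded.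

  Saving a logarithm requires a damped linear functional that is independent of the directions of
  C(S). It is p itself, since the diagonal leaves N(S) below p, or \<alpha> - p for a minimal
  exponent \<alpha> off C(S).\<close>

section \<open>Divided differences and one-dimensional sublevel sets\<close>

text \<open>The divided difference with node set \<open>T\<close> in Lagrange form. Being indexed by
  a set, it is symmetric in the nodes, and no enumeration of them is needed.\<close>

definition divdiff :: "real set \<Rightarrow> (real \<Rightarrow> real) \<Rightarrow> real" where
  "divdiff T q = (\<Sum>t\<in>T. q t / (\<Prod>u\<in>T - {t}. t - u))"

lemma divdiff_diff: "divdiff T (\<lambda>t. f t - g t) = divdiff T f - divdiff T g"
  by (simp add: divdiff_def diff_divide_distrib sum_subtractf)

lemma divdiff_cmult: "divdiff T (\<lambda>t. c * f t) = c * divdiff T f"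
  by (simp add: divdiff_def sum_distrib_left)

lemma divdiff_sum: "divdiff T (\<lambda>t. \<Sum>i\<in>I. f i t) = (\<Sum>i\<in>I. divdiff T (f i))"
  unfolding divdiff_def by (subst sum.swap) (simp add: sum_divide_distrib)

text \<open>The Leibniz rule for a linear factor: t - a annihilates the node \<open>a\<close> and
  cancels the factor that \<open>a\<close> contributes to every other denominator.\<close>

lemma divdiff_times_id:
  assumes "finite T" "a \<in> T"
  shows "divdiff T (\<lambda>t. t * q t) = a * divdiff T q + divdiff (T - {a}) q"
proof -
  have "divdiff T (\<lambda>t. t * q t) - a * divdiff T q = divdiff T (\<lambda>t. (t - a) * q t)"
    by (simp add: divdiff_diff divdiff_cmult left_diff_distrib)
  also have "\<dots> = (\<Sum>t\<in>T - {a}. (t - a) * q t / (\<Prod>u\<in>T - {t}. t - u))"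
    unfolding divdiff_def using assms by (simp add: sum.remove[of T a])
  also have "\<dots> = divdiff (T - {a}) q"
    unfolding divdiff_def
  proof (rule sum.cong)
    fix t assume t: "t \<in> T - {a}"
    have "(\<Prod>u\<in>T - {t}. t - u) = (t - a) * (\<Prod>u\<in>T - {t} - {a}. t - u)"
      using t assms by (intro prod.remove) auto
    moreover have "T - {t} - {a} = T - {a} - {t}" by auto
    ultimately show "(t - a) * q t / (\<Prod>u\<in>T - {t}. t - u) = q t / (\<Prod>u\<in>T - {a} - {t}. t - u)"
      using t by simp
  qed simp
  finally show ?thesis by simp
qed

text \<open>Applying \<open>divdiff_times_id\<close> at two nodes a and b and subtracting expresses
  (a - b) times the value through the two sets with one node less. Their values vanish by induction,
  or are both 1 when only two nodes are present.\<close>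

lemma divdiff_one:
  assumes "finite T" "card T \<ge> 2"
  shows "divdiff T (\<lambda>_. 1) = 0"
  using assms
proof (induction "card T" arbitrary: T rule: less_induct)
  case less
  obtain a b where ab: "a \<in> T" "b \<in> T" "a \<noteq> b"
    using less.prems by (metis One_nat_def card_le_Suc0_iff_eq not_less_eq_eq numeral_2_eq_2)
  have rec: "(a - b) * divdiff T (\<lambda>_. 1) = divdiff (T - {b}) (\<lambda>_. 1) - divdiff (T - {a}) (\<lambda>_. 1)"
    using divdiff_times_id[OF less.prems(1) ab(1), of "\<lambda>_. 1"]
      divdiff_times_id[OF less.prems(1) ab(2), of "\<lambda>_. 1"] by (simp add: left_diff_distrib)
  show ?case
  proof (cases "card T = 2")
    case True
    then have "T = {a, b}"
      using ab by (metis card_2_iff doubleton_eq_iff insert_iff singletonD)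
    then have "T - {b} = {a}" "T - {a} = {b}" using ab by auto
    then show ?thesis using rec ab by (simp add: divdiff_def)
  next
    case False
    then have "divdiff (T - {b}) (\<lambda>_. 1) = 0" "divdiff (T - {a}) (\<lambda>_. 1) = 0"
      using less.prems ab by (auto intro!: less.hyps psubset_card_mono simp: card_Diff_singleton)
    then show ?thesis using rec ab by simp
  qed
qed

lemma divdiff_power:
  assumes "finite T" "card T = Suc m"
  shows "l < m \<Longrightarrow> divdiff T (\<lambda>t. t ^ l) = 0" "divdiff T (\<lambda>t. t ^ m) = 1"
proof -
  have main: "divdiff T (\<lambda>t. t ^ l) = (if l = m then 1 else 0)" if "l \<le> m" for l
    using that assms
  proof (induction l arbitrary: m T)
    case 0
    show ?case
    proof (cases "m = 0")
      case True
      then obtain a where "T = {a}" using 0 by (auto simp: card_1_singleton_iff)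
      then show ?thesis using True by (simp add: divdiff_def)
    next
      case False
      then show ?thesis using 0 divdiff_one[of T] by simp
    qed
  next
    case (Suc l)
    then obtain a where a: "a \<in> T" by (metis card_0_eq ex_in_conv nat.distinct(1))
    obtain m' where m': "m = Suc m'" using Suc.prems by (cases m) auto
    have "divdiff T (\<lambda>t. t ^ Suc l) = a * divdiff T (\<lambda>t. t ^ l) + divdiff (T - {a}) (\<lambda>t. t ^ l)"
      using divdiff_times_id[OF \<open>finite T\<close> a] by simp
    also have "\<dots> = (if Suc l = m then 1 else 0)"
      using Suc.IH[of m T] Suc.IH[of m' "T - {a}"] Suc.prems m' a by simp
    finally show ?case .
  qed
  show "l < m \<Longrightarrow> divdiff T (\<lambda>t. t ^ l) = 0" "divdiff T (\<lambda>t. t ^ m) = 1"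
    using main[of l] main[of m] by auto
qed

text \<open>The value is the complete homogeneous symmetric polynomial of degree l - m in the nodes,
  which has at most 2^l monomials. The bound does not involve the distances of the nodes, which is
  what makes perturbations harmless later. In the induction each of the two Leibniz terms takes half
  of the factor 2.\<close>

lemma divdiff_power_bound:
  assumes "finite T" "card T = Suc m" "T \<subseteq> {0..\<rho>}" "\<rho> > 0"
  shows "\<bar>divdiff T (\<lambda>t. t ^ l)\<bar> * \<rho> ^ m \<le> (2 * \<rho>) ^ l"
  using assms
proof (induction l arbitrary: m T)
  case 0
  show ?case
    using divdiff_power(2)[OF 0(1,2)] divdiff_one[OF 0(1)] 0(2) by (cases "m = 0") auto
next
  case (Suc l)
  then obtain a where a: "a \<in> T" by (metis card_0_eq ex_in_conv nat.distinct(1))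
  have a': "0 \<le> a" "a \<le> \<rho>" using a Suc.prems by auto
  have eq: "divdiff T (\<lambda>t. t ^ Suc l) = a * divdiff T (\<lambda>t. t ^ l) + divdiff (T - {a}) (\<lambda>t. t ^ l)"
    using divdiff_times_id[OF \<open>finite T\<close> a] by simp
  have 1: "\<bar>a * divdiff T (\<lambda>t. t ^ l)\<bar> * \<rho> ^ m \<le> \<rho> * (2 * \<rho>) ^ l"
    using mult_mono[OF a'(2) Suc.IH[OF Suc.prems]] a' Suc.prems by (simp add: abs_mult mult.assoc)
  have 2: "\<bar>divdiff (T - {a}) (\<lambda>t. t ^ l)\<bar> * \<rho> ^ m \<le> \<rho> * (2 * \<rho>) ^ l"
  proof (cases m)
    case 0
    then have "T = {a}" using a Suc.prems by (auto simp: card_1_singleton_iff)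
    then show ?thesis using Suc.prems by (simp add: divdiff_def)
  next
    case (Suc m')
    have "\<bar>divdiff (T - {a}) (\<lambda>t. t ^ l)\<bar> * \<rho> ^ m' \<le> (2 * \<rho>) ^ l"
      by (rule Suc.IH) (use Suc Suc.prems a in auto)
    then show ?thesis using Suc \<open>\<rho> > 0\<close> by (simp add: mult.left_commute)
  qed
  have "\<bar>divdiff T (\<lambda>t. t ^ Suc l)\<bar> * \<rho> ^ m
      \<le> (\<bar>a * divdiff T (\<lambda>t. t ^ l)\<bar> + \<bar>divdiff (T - {a}) (\<lambda>t. t ^ l)\<bar>) * \<rho> ^ m"
    unfolding eq using \<open>\<rho> > 0\<close> by (intro mult_right_mono abs_triangle_ineq) auto
  also have "\<dots> \<le> (2 * \<rho>) ^ Suc l" using 1 2 by (simp add: distrib_right)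
  finally show ?case .
qed

section \<open>Large sets contain well spaced points, hence sublevel sets on a line are
  small\<close>

lemma divdiff_bound_spaced:
  assumes "finite T" "card T = Suc m" "h > 0"
    and sp: "\<And>t u. t \<in> T \<Longrightarrow> u \<in> T \<Longrightarrow> t \<noteq> u \<Longrightarrow> h \<le> \<bar>t - u\<bar>"
    and q: "\<And>t. t \<in> T \<Longrightarrow> \<bar>q t\<bar> \<le> e"
  shows "\<bar>divdiff T q\<bar> \<le> real (Suc m) * e / h ^ m"
proof -
  have "\<bar>divdiff T q\<bar> \<le> (\<Sum>t\<in>T. \<bar>q t / (\<Prod>u\<in>T - {t}. t - u)\<bar>)"
    unfolding divdiff_def by (rule sum_abs)
  also have "\<dots> \<le> (\<Sum>t\<in>T. e / h ^ m)"
  proof (rule sum_mono)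
    fix t assume t: "t \<in> T"
    have "h ^ m = (\<Prod>u\<in>T - {t}. h)" using t assms by simp
    also have "\<dots> \<le> (\<Prod>u\<in>T - {t}. \<bar>t - u\<bar>)"
      using sp t assms(3) by (intro prod_mono) auto
    finally have "h ^ m \<le> \<bar>\<Prod>u\<in>T - {t}. t - u\<bar>" by (simp add: abs_prod)
    then show "\<bar>q t / (\<Prod>u\<in>T - {t}. t - u)\<bar> \<le> e / h ^ m"
      unfolding abs_divide using q[OF t] assms(3) by (intro frac_le) auto
  qed
  also have "\<dots> = real (Suc m) * e / h ^ m" using assms by simp
  finally show ?thesis .
qed

text \<open>Greedy choice from the left: pick a point near the infimum, discard everything within
  distance \<open>h\<close> to its right, and continue with what remains.\<close>

lemma spaced_points_in_large_set:
  fixes E :: "real set"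
  assumes "E \<in> lmeasurable" "bounded E" "measure lebesgue E > real m * h" "h > 0"
  shows "\<exists>T\<subseteq>E. finite T \<and> card T = Suc m \<and> (\<forall>t\<in>T. \<forall>u\<in>T. t \<noteq> u \<longrightarrow> h \<le> \<bar>t - u\<bar>)"
  using assms
proof (induction m arbitrary: E)
  case 0
  then obtain t where "t \<in> E" by fastforce
  then show ?case by (intro exI[of _ "{t}"]) auto
next
  case (Suc m)
  \<comment> \<open>Half of the surplus of measure. The infimum need not belong to \<open>E\<close>,
    so the chosen point may overshoot it by \<eta>; the other half keeps the inequality strict for
    \<open>E'\<close>.\<close>
  define \<eta> where "\<eta> = (measure lebesgue E - real (Suc m) * h) / 2"
  have \<eta>: "\<eta> > 0" using Suc.prems by (simp add: \<eta>_def)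
  have ne: "E \<noteq> {}"
  proof
    assume "E = {}"
    moreover have "0 \<le> real (Suc m) * h" using \<open>h > 0\<close> by simp
    ultimately show False using Suc.prems(3) by simp
  qed
  have bdd: "bdd_below E" using Suc.prems(2) by (rule bounded_imp_bdd_below)
  obtain t where t: "t \<in> E" "t < Inf E + \<eta>"
    using cInf_lessD[of E "Inf E + \<eta>"] ne \<eta> by auto
  define E' where "E' = E \<inter> {t + h..}"
  have E'm: "E' \<in> lmeasurable"
    unfolding E'_def using Suc.prems(1) by (intro fmeasurable_Int_fmeasurable) auto
  have sub: "E \<subseteq> E' \<union> {Inf E..t + h}"
    unfolding E'_def using cInf_lower[OF _ bdd] by auto
  have "measure lebesgue E \<le> measure lebesgue (E' \<union> {Inf E..t + h})"
    using sub E'm Suc.prems(1) by (intro measure_mono_fmeasurable) auto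
  also have "\<dots> \<le> measure lebesgue E' + measure lebesgue {Inf E..t + h}"
    using E'm by (intro measure_Un_le) auto
  also have "measure lebesgue {Inf E..t + h} \<le> h + \<eta>"
    using t \<open>h > 0\<close> cInf_lower[OF t(1) bdd] by simp
  finally have "measure lebesgue E' > real m * h"
    using \<eta> by (simp add: \<eta>_def field_simps)
  then obtain T where T: "T \<subseteq> E'" "finite T" "card T = Suc m"
      "\<forall>t\<in>T. \<forall>u\<in>T. t \<noteq> u \<longrightarrow> h \<le> \<bar>t - u\<bar>"
    using Suc.IH[OF E'm] Suc.prems by (metis E'_def bounded_Int)
  have "t \<notin> T" using T(1) \<open>h > 0\<close> by (auto simp: E'_def)
  then show ?case using T t(1)
    by (intro exI[of _ "insert t T"]) (fastforce simp: E'_def)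
qed

text \<open>A van der Corput estimate with the divided differences of order \<open>m\<close> in place of the
  \<open>m\<close>-th derivative.\<close>

lemma sublevel_measure_divdiff:
  fixes E :: "real set" and m :: nat
  assumes E: "E \<in> lmeasurable" "E \<subseteq> {0..\<rho>}" and e: "e > 0" and c: "c > 0" and m: "m > 0"
    and f: "\<And>t. t \<in> E \<Longrightarrow> \<bar>f t\<bar> \<le> e"
    and D: "\<And>T. finite T \<Longrightarrow> card T = Suc m \<Longrightarrow> T \<subseteq> E \<Longrightarrow> \<bar>divdiff T f\<bar> \<ge> c"
  shows "measure lebesgue E \<le> real m * (real (Suc m) * e / c) powr (1 / real m)"
proof (rule ccontr)
  assume not: "\<not> ?thesis"
  define h0 where "h0 = (real (Suc m) * e / c) powr (1 / real m)"
  have h0: "h0 > 0" "h0 ^ m = real (Suc m) * e / c"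
    unfolding h0_def using e c m by (auto simp: powr_power)
  \<comment> \<open>The midpoint between \<open>h0\<close> and measure / m. It leaves room for m + 1
    points with spacing \<open>h\<close> and still exceeds \<open>h0\<close>, so that the two bounds
    on the divided difference contradict each other.\<close>
  define h where "h = (h0 + measure lebesgue E / m) / 2"
  have h: "h > h0" "measure lebesgue E > m * h"
    using not m unfolding h_def h0_def[symmetric] by (auto simp: field_simps)
  obtain T where T: "T \<subseteq> E" "finite T" "card T = Suc m"
      "\<forall>t\<in>T. \<forall>u\<in>T. t \<noteq> u \<longrightarrow> h \<le> \<bar>t - u\<bar>"
    using spaced_points_in_large_set[OF E(1) _ h(2)] E(2) h h0
    by (meson bounded_closed_interval bounded_subset less_trans)
  have "c \<le> \<bar>divdiff T f\<bar>" using D T by auto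
  also have "\<dots> \<le> real (Suc m) * e / h ^ m"
    using T h h0 f by (intro divdiff_bound_spaced) auto
  also have "\<dots> < real (Suc m) * e / h0 ^ m"
    using h h0 e m by (intro divide_strict_left_mono mult_pos_pos zero_less_power power_strict_mono) auto
  also have "\<dots> = c" using h0 e c by simp
  finally show False by simp
qed

section \<open>Monomials and directional divided differences\<close>

definition mpow :: "real^'n::finite \<Rightarrow> ('n \<Rightarrow> nat) \<Rightarrow> real" where
  "mpow x \<alpha> = (\<Prod>i\<in>UNIV. (x $ i) ^ \<alpha> i)"

definition mdeg :: "('n::finite \<Rightarrow> nat) \<Rightarrow> nat" where
  "mdeg \<alpha> = (\<Sum>i\<in>UNIV. \<alpha> i)"

lemma mpow_const: "mpow (\<chi> i. c) \<alpha> = c ^ mdeg \<alpha>"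
  by (simp add: mpow_def mdeg_def power_sum)

lemma mpow_scaleR: "mpow (c *\<^sub>R x) \<alpha> = c ^ mdeg \<alpha> * mpow x \<alpha>"
  by (simp add: mpow_def mdeg_def power_sum power_mult_distrib prod.distrib)

lemma abs_mpow: "\<bar>mpow x \<alpha>\<bar> = mpow (\<chi> i. \<bar>x $ i\<bar>) \<alpha>"
  by (simp add: mpow_def abs_prod power_abs)

lemma mpow_mono:
  assumes "\<And>i. 0 \<le> x $ i" "\<And>i. x $ i \<le> y $ i"
  shows "mpow x \<alpha> \<le> mpow y \<alpha>"
  unfolding mpow_def using assms by (intro prod_mono) (auto intro: power_mono)

lemma mpow_nonneg: "(\<And>i. 0 \<le> x $ i) \<Longrightarrow> 0 \<le> mpow x \<alpha>"
  unfolding mpow_def by (intro prod_nonneg) auto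

lemma abs_mpow_le:
  assumes "\<And>i. \<bar>x $ i\<bar> \<le> R"
  shows "\<bar>mpow x \<alpha>\<bar> \<le> R ^ mdeg \<alpha>"
  unfolding abs_mpow mpow_const[symmetric] using assms by (intro mpow_mono) auto

lemma continuous_on_mpow [continuous_intros]:
  "continuous_on X f \<Longrightarrow> continuous_on X (\<lambda>x. mpow (f x) \<alpha>)"
  unfolding mpow_def by (intro continuous_intros)

text \<open>It serves twice: as the common range of summation for polynomial expansions, and later
  as the finite set of lattice points that index the dyadic boxes.\<close>

definition mbox :: "nat \<Rightarrow> ('n::finite \<Rightarrow> nat) set" where
  "mbox N = (UNIV \<rightarrow>\<^sub>E {..N})"

lemma finite_mbox: "finite (mbox N)"
  unfolding mbox_def by (intro finite_PiE) auto

definition mbinom :: "('n::finite \<Rightarrow> nat) \<Rightarrow> ('n \<Rightarrow> nat) \<Rightarrow> real" where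
  "mbinom \<alpha> \<beta> = (\<Prod>i\<in>UNIV. real (\<alpha> i choose \<beta> i))"

lemma mbinom_nonneg: "0 \<le> mbinom \<alpha> \<beta>"
  unfolding mbinom_def by (intro prod_nonneg) auto

text \<open>The binomial theorem over a range independent of \<alpha>, so that sums over \<alpha>
  and \<beta> can be interchanged. Indices not below \<alpha> contribute nothing, because one of
  their binomial coefficients is 0; this also makes the truncated subtraction harmless.\<close>

lemma mpow_add:
  fixes x y :: "real^'n::finite"
  assumes "\<And>i. \<alpha> i \<le> N"
  shows "mpow (x + y) \<alpha> = (\<Sum>\<beta>\<in>mbox N. mbinom \<alpha> \<beta> * mpow x (\<lambda>i. \<alpha> i - \<beta> i) * mpow y \<beta>)"
proof -
  have "(x $ i + y $ i) ^ \<alpha> i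
      = (\<Sum>k\<le>N. real (\<alpha> i choose k) * (x $ i) ^ (\<alpha> i - k) * (y $ i) ^ k)" for i
  proof -
    have "(x $ i + y $ i) ^ \<alpha> i = (\<Sum>k\<le>\<alpha> i. real (\<alpha> i choose k) * (x $ i) ^ (\<alpha> i - k) * (y $ i) ^ k)"
      by (subst add.commute, subst binomial_ring) (simp add: mult_ac)
    also have "\<dots> = (\<Sum>k\<le>N. real (\<alpha> i choose k) * (x $ i) ^ (\<alpha> i - k) * (y $ i) ^ k)"
      using assms by (intro sum.mono_neutral_left) (auto simp: not_le)
    finally show ?thesis .
  qed
  then have "mpow (x + y) \<alpha>
      = (\<Prod>i\<in>UNIV. \<Sum>k\<le>N. real (\<alpha> i choose k) * (x $ i) ^ (\<alpha> i - k) * (y $ i) ^ k)"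
    by (simp add: mpow_def)
  also have "\<dots> = (\<Sum>\<beta>\<in>mbox N. \<Prod>i\<in>UNIV. real (\<alpha> i choose \<beta> i) * (x $ i) ^ (\<alpha> i - \<beta> i) * (y $ i) ^ \<beta> i)"
    unfolding mbox_def by (rule prod_sum_PiE) auto
  finally show ?thesis by (simp add: mpow_def mbinom_def prod.distrib)
qed

lemma mindex_bounded:
  fixes A :: "('n::finite \<Rightarrow> nat) set"
  assumes "finite A"
  shows "\<exists>N. \<forall>\<alpha>\<in>A. \<forall>i. \<alpha> i \<le> N"
proof -
  have "\<alpha> i \<le> (\<Sum>\<alpha>\<in>A. mdeg \<alpha>)" if "\<alpha> \<in> A" for \<alpha> and i
  proof -
    have "\<alpha> i \<le> mdeg \<alpha>" unfolding mdeg_def by (rule member_le_sum) auto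
    also have "\<dots> \<le> (\<Sum>\<alpha>\<in>A. mdeg \<alpha>)" using that assms by (intro member_le_sum) auto
    finally show ?thesis .
  qed
  then show ?thesis by blast
qed

lemma polynomial_shift:
  fixes p :: "real^'n::finite"
  assumes "finite A"
  obtains B b where "finite B"
    "\<And>x. (\<Sum>\<alpha>\<in>A. c \<alpha> * mpow x \<alpha>) = (\<Sum>\<beta>\<in>B. b \<beta> * mpow (x - p) \<beta>)"
proof -
  obtain N where N: "\<And>\<alpha> i. \<alpha> \<in> A \<Longrightarrow> \<alpha> i \<le> N" using mindex_bounded[OF assms] by blast
  let ?b = "\<lambda>\<beta>. \<Sum>\<alpha>\<in>A. c \<alpha> * (mbinom \<alpha> \<beta> * mpow p (\<lambda>i. \<alpha> i - \<beta> i))"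
  have "(\<Sum>\<alpha>\<in>A. c \<alpha> * mpow x \<alpha>) = (\<Sum>\<beta>\<in>mbox N. ?b \<beta> * mpow (x - p) \<beta>)" for x
  proof -
    have "(\<Sum>\<alpha>\<in>A. c \<alpha> * mpow x \<alpha>) = (\<Sum>\<alpha>\<in>A. c \<alpha> * mpow (p + (x - p)) \<alpha>)" by simp
    also have "\<dots> = (\<Sum>\<alpha>\<in>A. c \<alpha> * (\<Sum>\<beta>\<in>mbox N. mbinom \<alpha> \<beta> * mpow p (\<lambda>i. \<alpha> i - \<beta> i) * mpow (x - p) \<beta>))"
      by (intro sum.cong refl arg_cong2[of _ _ _ _ "(*)"] mpow_add) (use N in auto)
    also have "\<dots> = (\<Sum>\<alpha>\<in>A. \<Sum>\<beta>\<in>mbox N.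
        c \<alpha> * (mbinom \<alpha> \<beta> * mpow p (\<lambda>i. \<alpha> i - \<beta> i)) * mpow (x - p) \<beta>)"
      by (simp only: sum_distrib_left mult.assoc)
    also have "\<dots> = (\<Sum>\<beta>\<in>mbox N. ?b \<beta> * mpow (x - p) \<beta>)"
      by (subst sum.swap) (simp only: sum_distrib_right)
    finally show ?thesis .
  qed
  then show ?thesis by (rule that[OF finite_mbox])
qed

section \<open>Partial derivatives of polynomials and their Taylor coefficients\<close>

lemma has_field_derivative_mpow_axis:
  fixes x :: "real^'n::finite"
  shows "((\<lambda>t. mpow (x + t *\<^sub>R axis i 1) \<beta>) has_field_derivative
           real (\<beta> i) * mpow x (\<beta>(i := \<beta> i - 1))) (at 0)"
proof -
  have eq: "mpow (x + t *\<^sub>R axis i 1) \<beta> = (x $ i + t) ^ \<beta> i * (\<Prod>j\<in>UNIV - {i}. (x $ j) ^ \<beta> j)" for t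
    unfolding mpow_def by (subst prod.remove[of UNIV i]) (auto simp: axis_def intro!: prod.cong)
  have eq': "mpow x (\<beta>(i := \<beta> i - 1)) = (x $ i) ^ (\<beta> i - 1) * (\<Prod>j\<in>UNIV - {i}. (x $ j) ^ \<beta> j)"
    unfolding mpow_def by (subst prod.remove[of UNIV i]) (auto intro!: prod.cong)
  show ?thesis unfolding eq eq'
    by (auto intro!: derivative_eq_intros)
qed

lemma partial_deriv_sum_mpow:
  assumes "finite I"
  shows "partial_deriv i (\<lambda>x. \<Sum>k\<in>I. c k * mpow (x - p) (e k))
    = (\<lambda>x. \<Sum>k\<in>I. (c k * real (e k i)) * mpow (x - p) ((e k)(i := e k i - 1)))"
proof
  fix x
  have "((\<lambda>t. \<Sum>k\<in>I. c k * mpow (x - p + t *\<^sub>R axis i 1) (e k)) has_field_derivative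
      (\<Sum>k\<in>I. c k * (real (e k i) * mpow (x - p) ((e k)(i := e k i - 1))))) (at 0)"
    by (intro DERIV_sum DERIV_cmult has_field_derivative_mpow_axis)
  then show "partial_deriv i (\<lambda>x. \<Sum>k\<in>I. c k * mpow (x - p) (e k)) x
      = (\<Sum>k\<in>I. (c k * real (e k i)) * mpow (x - p) ((e k)(i := e k i - 1)))"
    unfolding partial_deriv_def by (intro DERIV_imp_deriv) (simp add: algebra_simps)
qed

text \<open>The product of falling factorials that the derivatives along \<open>js\<close> bring
  down from the monomial with exponent \<beta>. Truncated subtraction makes it 0 as soon as one
  variable is differentiated more often than its exponent allows.\<close>

fun deriv_coeff :: "'n list \<Rightarrow> ('n \<Rightarrow> nat) \<Rightarrow> nat" where
  "deriv_coeff [] \<beta> = 1"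
| "deriv_coeff (j # js) \<beta> = deriv_coeff js \<beta> * (\<beta> j - count_list js j)"

lemma deriv_coeff_eq_0_iff: "deriv_coeff js \<beta> = 0 \<longleftrightarrow> \<not> (\<forall>i. count_list js i \<le> \<beta> i)"
proof (induction js)
  case (Cons j js)
  have "deriv_coeff (j # js) \<beta> = 0
      \<longleftrightarrow> (\<exists>i. \<beta> i < count_list js i) \<or> \<beta> j < Suc (count_list js j)"
    using Cons by (auto simp: not_le less_Suc_eq_le)
  also have "\<dots> \<longleftrightarrow> (\<exists>i. \<beta> i < count_list (j # js) i)"
    by (auto intro: less_SucI)
  finally show ?case by (simp add: not_le)
qed auto

lemma partial_derivs_sum_mpow:
  assumes "finite B"
  shows "partial_derivs js (\<lambda>x. \<Sum>\<beta>\<in>B. b \<beta> * mpow (x - p) \<beta>)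
    = (\<lambda>x. \<Sum>\<beta>\<in>B. (b \<beta> * real (deriv_coeff js \<beta>)) * mpow (x - p) (\<lambda>i. \<beta> i - count_list js i))"
proof (induction js)
  case (Cons j js)
  have "(\<lambda>i. \<beta> i - count_list js i)(j := \<beta> j - count_list js j - 1)
      = (\<lambda>i. \<beta> i - count_list (j # js) i)" for \<beta> :: "'a \<Rightarrow> nat"
    by auto
  then show ?case
    by (simp only: partial_derivs.simps Cons partial_deriv_sum_mpow[OF assms])
      (simp add: mult.assoc)
qed simp

text \<open>At the centre only one monomial survives: where some exponent is too small the
  coefficient is 0, and where some exponent is too large a factor x - p is left over.\<close>

lemma partial_derivs_sum_mpow_at:
  assumes "finite B"
  shows "partial_derivs js (\<lambda>x. \<Sum>\<beta>\<in>B. b \<beta> * mpow (x - p) \<beta>) p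
    = (if count_list js \<in> B then b (count_list js) * real (deriv_coeff js (count_list js)) else 0)"
proof -
  have "real (deriv_coeff js \<beta>) * mpow 0 (\<lambda>i. \<beta> i - count_list js i)
      = (if \<beta> = count_list js then real (deriv_coeff js (count_list js)) else 0)" for \<beta> :: "'a \<Rightarrow> nat"
  proof (cases "\<forall>i. count_list js i \<le> \<beta> i")
    case True
    show ?thesis
    proof (cases "\<beta> = count_list js")
      case False
      then obtain i where "\<beta> i \<noteq> count_list js i" by blast
      then have "\<beta> i - count_list js i > 0" using True by (metis le_neq_implies_less zero_less_diff)
      then have "mpow (0::real^'a) (\<lambda>i. \<beta> i - count_list js i) = 0"
        unfolding mpow_def by (intro prod_zero) (auto intro!: exI[of _ i])
      then show ?thesis using False by simp
    qed (simp add: mpow_def)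
  next
    case False
    then have "\<beta> \<noteq> count_list js" "deriv_coeff js \<beta> = 0" by (auto simp: deriv_coeff_eq_0_iff)
    then show ?thesis by simp
  qed
  then show ?thesis
    using assms unfolding partial_derivs_sum_mpow[OF assms] diff_self mult.assoc
    by (simp only: if_distrib[of "(*) _"] mult_zero_right) simp
qed

lemma ex_count_list: "\<exists>js. count_list js = (\<alpha> :: 'n::finite \<Rightarrow> nat)"
proof (induction "mdeg \<alpha>" arbitrary: \<alpha>)
  case 0
  then show ?case by (intro exI[of _ "[]"]) (auto simp: mdeg_def)
next
  case (Suc m)
  then obtain i where i: "\<alpha> i > 0" unfolding mdeg_def by (metis gr0I nat.distinct(1) sum.neutral)
  have "mdeg \<alpha> = \<alpha> i + (\<Sum>j\<in>UNIV - {i}. \<alpha> j)"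
    "mdeg (\<alpha>(i := \<alpha> i - 1)) = \<alpha> i - 1 + (\<Sum>j\<in>UNIV - {i}. \<alpha> j)"
    unfolding mdeg_def by (subst sum.remove[of UNIV i], auto)+
  then have "m = mdeg (\<alpha>(i := \<alpha> i - 1))" using Suc.hyps(2) i by simp
  then obtain js where "count_list js = \<alpha>(i := \<alpha> i - 1)" using Suc.hyps(1) by blast
  then have "count_list (i # js) = \<alpha>" using i by (auto simp: fun_eq_iff)
  then show ?case by blast
qed

lemma mdeg_count_list: "mdeg (count_list js) = length js"
  unfolding mdeg_def by (rule sum_count_set) auto

text \<open>Up to a nonzero integer every coefficient is a partial derivative at 0, since every
  multi-index is the count of some list of directions.\<close>

lemma polynomial_coeffs_zero:
  fixes b :: "('n::finite \<Rightarrow> nat) \<Rightarrow> real"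
  assumes "finite B" "\<And>v. (\<Sum>\<beta>\<in>B. b \<beta> * mpow v \<beta>) = 0" "\<beta> \<in> B"
  shows "b \<beta> = 0"
proof -
  obtain js where js: "count_list js = \<beta>" using ex_count_list by blast
  have "(\<lambda>x. \<Sum>\<beta>\<in>B. b \<beta> * mpow (x - 0) \<beta>) = (\<lambda>x. \<Sum>\<beta>\<in>{}. b \<beta> * mpow (x - 0) \<beta>)"
    using assms(2) by simp
  then have "partial_derivs js (\<lambda>x. \<Sum>\<beta>\<in>B. b \<beta> * mpow (x - 0) \<beta>) 0
      = partial_derivs js (\<lambda>x. \<Sum>\<beta>\<in>{}. b \<beta> * mpow (x - 0) \<beta>) 0" by simp
  then have "b \<beta> * real (deriv_coeff js \<beta>) = 0"
    using assms(1,3) js by (subst (asm) (1 2) partial_derivs_sum_mpow_at) auto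
  moreover have "deriv_coeff js \<beta> \<noteq> 0" using js by (auto simp: deriv_coeff_eq_0_iff)
  ultimately show ?thesis by simp
qed

text \<open>This guarantees that the \<open>LEAST\<close> in \<open>order_at\<close> is attained. If
  all derivatives vanished at \<open>p\<close>, the expansion around \<open>p\<close> would have
  zero coefficients and the polynomial would vanish identically.\<close>

lemma ex_nonzero_partial_deriv:
  fixes c :: "('n::finite \<Rightarrow> nat) \<Rightarrow> real"
  assumes "finite A" "\<alpha> \<in> A" "c \<alpha> \<noteq> 0"
  shows "\<exists>js. partial_derivs js (\<lambda>x. \<Sum>\<alpha>\<in>A. c \<alpha> * mpow x \<alpha>) p \<noteq> 0"
proof (rule ccontr)
  assume *: "\<not> ?thesis"
  obtain B b where B: "finite B"
    "\<And>x. (\<Sum>\<alpha>\<in>A. c \<alpha> * mpow x \<alpha>) = (\<Sum>\<beta>\<in>B. b \<beta> * mpow (x - p) \<beta>)"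
    using polynomial_shift[OF assms(1)] by blast
  have "b \<beta> = 0" if "\<beta> \<in> B" for \<beta>
  proof -
    obtain js where js: "count_list js = \<beta>" using ex_count_list by blast
    have "partial_derivs js (\<lambda>x. \<Sum>\<beta>\<in>B. b \<beta> * mpow (x - p) \<beta>) p = 0"
      using * unfolding B(2) by blast
    moreover have "deriv_coeff js \<beta> \<noteq> 0" using js by (auto simp: deriv_coeff_eq_0_iff)
    ultimately show ?thesis
      using that js by (simp add: partial_derivs_sum_mpow_at[OF B(1)])
  qed
  then have "(\<Sum>\<alpha>\<in>A. c \<alpha> * mpow x \<alpha>) = 0" for x unfolding B(2) by simp
  then show False using polynomial_coeffs_zero[OF assms(1) _ assms(2)] assms(3) by blast
qed

text \<open>The sum is the coefficient of t^m, with m the length of \<open>js\<close>, in the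
  polynomial along p + t v. A mixed derivative is not itself a derivative along one line, but it
  shows that the homogeneous part of degree m is a nonzero polynomial, which therefore does not
  vanish in some direction.\<close>

lemma ex_direction:
  fixes b :: "('n::finite \<Rightarrow> nat) \<Rightarrow> real"
  assumes "finite B" "partial_derivs js (\<lambda>x. \<Sum>\<beta>\<in>B. b \<beta> * mpow (x - p) \<beta>) p \<noteq> 0"
  shows "\<exists>v. (\<Sum>\<beta>\<in>{\<beta>\<in>B. mdeg \<beta> = length js}. b \<beta> * mpow v \<beta>) \<noteq> 0"
proof (rule ccontr)
  assume *: "\<not> ?thesis"
  have mem: "count_list js \<in> {\<beta>\<in>B. mdeg \<beta> = length js}" and nz: "b (count_list js) \<noteq> 0"
    using assms by (auto simp: partial_derivs_sum_mpow_at mdeg_count_list split: if_splits)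
  have "b (count_list js) = 0"
    by (rule polynomial_coeffs_zero[OF _ _ mem]) (use * assms(1) in auto)
  with nz show False by simp
qed

section \<open>Divided differences of monomials along a line\<close>

lemma divdiff_mpow_line:
  fixes x v :: "real^'n::finite"
  assumes "\<And>i. \<beta> i \<le> N"
  shows "divdiff T (\<lambda>t. mpow (x + t *\<^sub>R v) \<beta>)
    = (\<Sum>\<gamma>\<in>mbox N. mbinom \<beta> \<gamma> * mpow x (\<lambda>i. \<beta> i - \<gamma> i) * mpow v \<gamma> * divdiff T (\<lambda>t. t ^ mdeg \<gamma>))"
proof -
  have "mpow (x + t *\<^sub>R v) \<beta> = (\<Sum>\<gamma>\<in>mbox N.
      (mbinom \<beta> \<gamma> * mpow x (\<lambda>i. \<beta> i - \<gamma> i) * mpow v \<gamma>) * t ^ mdeg \<gamma>)" for t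
    unfolding mpow_add[of \<beta>, OF assms] by (simp add: mpow_scaleR mult_ac)
  then show ?thesis by (simp only: divdiff_sum divdiff_cmult)
qed

text \<open>By \<open>divdiff_power_bound\<close> a power of t may be replaced by the same power of
  2 \<rho>. After this the binomial expansion can be folded back, and the majorant is again the
  monomial, at a slightly larger point. Such majorants can be summed over all exponents of a power
  series.\<close>

lemma divdiff_mpow_line_bound:
  fixes x v :: "real^'n::finite"
  assumes "finite T" "card T = Suc m" "T \<subseteq> {0..\<rho>}" "\<rho> > 0"
  shows "\<bar>divdiff T (\<lambda>t. mpow (x + t *\<^sub>R v) \<beta>)\<bar> * \<rho> ^ m \<le> mpow (\<chi> i. \<bar>x $ i\<bar> + 2 * \<rho> * \<bar>v $ i\<bar>) \<beta>"
    and "\<bar>divdiff T (\<lambda>t. mpow (x + t *\<^sub>R v) \<beta>) - divdiff T (\<lambda>t. mpow (t *\<^sub>R v) \<beta>)\<bar> * \<rho> ^ m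
      \<le> mpow (\<chi> i. \<bar>x $ i\<bar> + 2 * \<rho> * \<bar>v $ i\<bar>) \<beta> - mpow (\<chi> i. 2 * \<rho> * \<bar>v $ i\<bar>) \<beta>"
proof -
  obtain N where N: "\<And>i. \<beta> i \<le> N" using mindex_bounded[of "{\<beta>}"] by auto
  let ?X = "\<chi> i. \<bar>x $ i\<bar>" and ?V = "\<chi> i. \<bar>v $ i\<bar>"
  let ?W = "(2 * \<rho>) *\<^sub>R ?V"
  have XW: "(\<chi> i. \<bar>x $ i\<bar> + 2 * \<rho> * \<bar>v $ i\<bar>) = ?X + ?W" "(\<chi> i. 2 * \<rho> * \<bar>v $ i\<bar>) = ?W"
    by (auto simp: vec_eq_iff)
  let ?D = "\<lambda>\<gamma>. divdiff T (\<lambda>t. t ^ mdeg \<gamma>)"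
  have tm: "\<bar>mbinom \<beta> \<gamma> * k * mpow v \<gamma> * ?D \<gamma>\<bar> * \<rho> ^ m
      \<le> mbinom \<beta> \<gamma> * \<bar>k\<bar> * mpow ?W \<gamma>" for k \<gamma>
  proof -
    have "\<bar>mbinom \<beta> \<gamma> * k * mpow v \<gamma> * ?D \<gamma>\<bar> * \<rho> ^ m
        = (mbinom \<beta> \<gamma> * \<bar>k\<bar> * mpow ?V \<gamma>) * (\<bar>?D \<gamma>\<bar> * \<rho> ^ m)"
      using mbinom_nonneg[of \<beta> \<gamma>] by (simp add: abs_mult abs_mpow mult.assoc)
    also have "\<dots> \<le> (mbinom \<beta> \<gamma> * \<bar>k\<bar> * mpow ?V \<gamma>) * (2 * \<rho>) ^ mdeg \<gamma>"
      using divdiff_power_bound[OF assms] mbinom_nonneg[of \<beta> \<gamma>]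
      by (intro mult_left_mono mult_nonneg_nonneg mpow_nonneg) auto
    also have "\<dots> = mbinom \<beta> \<gamma> * \<bar>k\<bar> * mpow ?W \<gamma>" by (simp add: mpow_scaleR mult_ac)
    finally show ?thesis .
  qed
  have "\<bar>divdiff T (\<lambda>t. mpow (x + t *\<^sub>R v) \<beta>)\<bar> * \<rho> ^ m
      \<le> (\<Sum>\<gamma>\<in>mbox N. \<bar>mbinom \<beta> \<gamma> * mpow x (\<lambda>i. \<beta> i - \<gamma> i) * mpow v \<gamma> * ?D \<gamma>\<bar>) * \<rho> ^ m"
    unfolding divdiff_mpow_line[OF N] using assms(4) by (intro mult_right_mono sum_abs) auto
  also have "\<dots> \<le> (\<Sum>\<gamma>\<in>mbox N. mbinom \<beta> \<gamma> * \<bar>mpow x (\<lambda>i. \<beta> i - \<gamma> i)\<bar> * mpow ?W \<gamma>)"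
    unfolding sum_distrib_right by (intro sum_mono tm)
  also have "\<dots> = mpow (?X + ?W) \<beta>" unfolding abs_mpow by (rule mpow_add[symmetric, OF N])
  finally show "\<bar>divdiff T (\<lambda>t. mpow (x + t *\<^sub>R v) \<beta>)\<bar> * \<rho> ^ m \<le> mpow (\<chi> i. \<bar>x $ i\<bar> + 2 * \<rho> * \<bar>v $ i\<bar>) \<beta>"
    unfolding XW .
  let ?k = "\<lambda>\<gamma>. mpow x (\<lambda>i. \<beta> i - \<gamma> i) - mpow 0 (\<lambda>i. \<beta> i - \<gamma> i)"
  \<comment> \<open>The value at 0 is 1 for the constant monomial and 0 otherwise, so subtracting it
    commutes with taking absolute values.\<close>
  have k: "\<bar>?k \<gamma>\<bar> = mpow ?X (\<lambda>i. \<beta> i - \<gamma> i) - mpow 0 (\<lambda>i. \<beta> i - \<gamma> i)" for \<gamma>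
  proof (cases "(\<lambda>i. \<beta> i - \<gamma> i) = (\<lambda>_. 0)")
    case True
    then show ?thesis by (simp add: mpow_def)
  next
    case False
    then obtain i where i: "\<beta> i - \<gamma> i \<noteq> 0" by blast
    then have "mpow (0::real^'n) (\<lambda>i. \<beta> i - \<gamma> i) = 0"
      unfolding mpow_def by (intro prod_zero) (auto intro!: exI[of _ i])
    then show ?thesis by (simp add: abs_mpow)
  qed
  have "divdiff T (\<lambda>t. mpow (x + t *\<^sub>R v) \<beta>) - divdiff T (\<lambda>t. mpow (t *\<^sub>R v) \<beta>)
      = (\<Sum>\<gamma>\<in>mbox N. mbinom \<beta> \<gamma> * ?k \<gamma> * mpow v \<gamma> * ?D \<gamma>)"
    using divdiff_mpow_line[OF N, of T x v] divdiff_mpow_line[OF N, of T 0 v]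
    by (simp add: sum_subtractf[symmetric] algebra_simps)
  then have "\<bar>divdiff T (\<lambda>t. mpow (x + t *\<^sub>R v) \<beta>) - divdiff T (\<lambda>t. mpow (t *\<^sub>R v) \<beta>)\<bar> * \<rho> ^ m
      \<le> (\<Sum>\<gamma>\<in>mbox N. \<bar>mbinom \<beta> \<gamma> * ?k \<gamma> * mpow v \<gamma> * ?D \<gamma>\<bar>) * \<rho> ^ m"
    using assms(4) by (intro mult_right_mono) auto
  also have "\<dots> \<le> (\<Sum>\<gamma>\<in>mbox N. mbinom \<beta> \<gamma> * \<bar>?k \<gamma>\<bar> * mpow ?W \<gamma>)"
    unfolding sum_distrib_right by (intro sum_mono tm)
  also have "\<dots> = mpow (?X + ?W) \<beta> - mpow (0 + ?W) \<beta>"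
    unfolding mpow_add[of \<beta>, OF N] k by (simp add: sum_subtractf[symmetric] algebra_simps)
  finally show "\<bar>divdiff T (\<lambda>t. mpow (x + t *\<^sub>R v) \<beta>) - divdiff T (\<lambda>t. mpow (t *\<^sub>R v) \<beta>)\<bar> * \<rho> ^ m
      \<le> mpow (\<chi> i. \<bar>x $ i\<bar> + 2 * \<rho> * \<bar>v $ i\<bar>) \<beta> - mpow (\<chi> i. 2 * \<rho> * \<bar>v $ i\<bar>) \<beta>"
    unfolding XW by simp
qed

section \<open>Uniform sublevel estimates for perturbed polynomials\<close>

text \<open>Fubini for the indicator of x + t v in \<open>E\<close>: integrating first over x gives
  the measure of \<open>E\<close> for each t, integrating first over t gives at most
  \<open>b\<close>, and 0 outside the enlarged ball. No change of coordinates is involved, and v may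
  have any length.\<close>

lemma measure_le_by_averaging:
  fixes E :: "(real^'n::finite) set"
  assumes E: "E \<in> sets borel" "E \<subseteq> ball p r" and \<rho>: "\<rho> > 0" and b: "b \<ge> 0"
    and sec: "\<And>x. x \<in> ball p (r + \<rho> * norm v) \<Longrightarrow>
      measure lebesgue {t\<in>{0..\<rho>}. x + t *\<^sub>R v \<in> E} \<le> b"
  shows "\<rho> * measure lebesgue E \<le> measure lebesgue (ball p (r + \<rho> * norm v)) * b"
proof -
  let ?B = "ball p (r + \<rho> * norm v)"
  define g :: "real \<Rightarrow> real^'n \<Rightarrow> ennreal"
    where "g = (\<lambda>t x. indicator {0..\<rho>} t * indicator E (x + t *\<^sub>R v))"
  have [measurable]: "E \<in> sets borel" by fact
  have gm: "case_prod g \<in> borel_measurable (lborel \<Otimes>\<^sub>M lborel)"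
    unfolding g_def by measurable
  have Ef: "emeasure lborel E < \<infinity>"
    using emeasure_bounded_finite[of E] E(2) bounded_subset by (metis bounded_ball)
  have 1: "(\<integral>\<^sup>+x. g t x \<partial>lborel) = indicator {0..\<rho>} t * emeasure lborel E" for t
  proof -
    have "(\<integral>\<^sup>+x. indicator E (x + t *\<^sub>R v) \<partial>lborel)
        = (\<integral>\<^sup>+x. indicator E x \<partial>distr lborel borel ((+) (t *\<^sub>R v)))"
      by (subst nn_integral_distr) (auto simp: add.commute)
    also have "\<dots> = emeasure lborel E" by (simp add: lborel_distr_plus)
    finally show ?thesis unfolding g_def by (subst nn_integral_cmult) auto
  qed
  have 2: "(\<integral>\<^sup>+t. g t x \<partial>lborel) \<le> ennreal b * indicator ?B x" for x
  proof -
    let ?S = "{t\<in>{0..\<rho>}. x + t *\<^sub>R v \<in> E}"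
    have Sm: "?S \<in> sets borel"
    proof -
      have "(\<lambda>t. x + t *\<^sub>R v) -` E \<inter> space borel \<in> sets borel"
        by (rule measurable_sets[OF _ E(1)]) auto
      then have "{0..\<rho>} \<inter> ((\<lambda>t. x + t *\<^sub>R v) -` E \<inter> space borel) \<in> sets borel" by auto
      moreover have "?S = {0..\<rho>} \<inter> ((\<lambda>t. x + t *\<^sub>R v) -` E \<inter> space borel)" by auto
      ultimately show ?thesis by simp
    qed
    have "g t x = indicator ?S t" for t unfolding g_def by (auto split: split_indicator)
    then have eq: "(\<integral>\<^sup>+t. g t x \<partial>lborel) = emeasure lborel ?S" using Sm by simp
    show ?thesis
    proof (cases "x \<in> ?B")
      case True
      have "emeasure lborel ?S = ennreal (measure lebesgue ?S)"
      proof -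
        have "bounded ?S" by (rule bounded_subset[OF bounded_closed_interval[of 0 \<rho>]]) auto
        then have "emeasure lborel ?S < \<infinity>" by (rule emeasure_bounded_finite)
        then show ?thesis using Sm by (simp add: emeasure_eq_ennreal_measure)
      qed
      then show ?thesis using eq True sec[OF True] b by (auto intro: ennreal_leI)
    next
      case False
      have "?S = {}"
      proof (rule ccontr)
        assume "?S \<noteq> {}"
        then obtain t where t: "0 \<le> t" "t \<le> \<rho>" "x + t *\<^sub>R v \<in> ball p r" using E(2) by auto
        have "dist p x \<le> dist p (x + t *\<^sub>R v) + dist (x + t *\<^sub>R v) x" by (rule dist_triangle)
        also have "\<dots> < r + \<rho> * norm v"
          using t mult_right_mono[OF t(2), of "norm v"] by (simp add: dist_norm)
        finally show False using False by simp
      qed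
      then show ?thesis unfolding eq by (simp only: emeasure_empty) simp
    qed
  qed
  have "ennreal \<rho> * emeasure lborel E = (\<integral>\<^sup>+t. (\<integral>\<^sup>+x. g t x \<partial>lborel) \<partial>lborel)"
    unfolding 1 using \<rho> by (subst nn_integral_multc) auto
  also have "\<dots> = (\<integral>\<^sup>+x. (\<integral>\<^sup>+t. g t x \<partial>lborel) \<partial>lborel)"
    by (rule lborel_pair.Fubini'[symmetric]) (rule gm)
  also have "\<dots> \<le> (\<integral>\<^sup>+x. ennreal b * indicator ?B x \<partial>lborel)" by (intro nn_integral_mono 2)
  also have "\<dots> = ennreal b * emeasure lborel ?B" by (subst nn_integral_cmult) (auto intro!: borel_measurable_indicator)
  finally have "ennreal \<rho> * emeasure lborel E \<le> ennreal b * emeasure lborel ?B" .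
  moreover have "emeasure lborel E = ennreal (measure lebesgue E)"
    using Ef E(1) by (simp add: emeasure_eq_ennreal_measure)
  moreover have "emeasure lborel ?B = ennreal (measure lebesgue ?B)"
  proof -
    have "emeasure lborel ?B < \<infinity>" by (rule emeasure_lborel_ball_finite)
    moreover have "?B \<in> sets borel" by simp
    ultimately show ?thesis by (simp add: emeasure_eq_ennreal_measure)
  qed
  ultimately have "ennreal (\<rho> * measure lebesgue E) \<le> ennreal (b * measure lebesgue ?B)"
    using \<rho> b by (simp add: ennreal_mult)
  then show ?thesis using b by (simp add: mult.commute)
qed

definition cube :: "real \<Rightarrow> (real^'n::finite) set" where
  "cube R = {x. \<forall>i. \<bar>x $ i\<bar> \<le> R}"

text \<open>The difference of \<open>f\<close> and \<open>P\<close> is a power series with small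
  absolute sum on the polydisc of radius \<open>R\<close>. This norm controls all divided
  differences of the difference at once. Continuity is recorded for the measurability of sublevel
  sets.\<close>

definition near_poly :: "real \<Rightarrow> (real^'n::finite \<Rightarrow> real) \<Rightarrow> real \<Rightarrow> (real^'n \<Rightarrow> real) \<Rightarrow> bool" where
  "near_poly R P \<eta> f \<longleftrightarrow> continuous_on (cube R) f \<and>
     (\<exists>e \<sigma>. \<sigma> \<le> \<eta> \<and> ((\<lambda>\<alpha>. \<bar>e \<alpha>\<bar> * R ^ mdeg \<alpha>) has_sum \<sigma>) UNIV \<and>
        (\<forall>x\<in>cube R. ((\<lambda>\<alpha>. e \<alpha> * mpow x \<alpha>) has_sum (f x - P x)) UNIV))"

lemma near_poly_mono: "near_poly R P \<eta> f \<Longrightarrow> \<eta> \<le> \<eta>' \<Longrightarrow> near_poly R P \<eta>' f"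
  unfolding near_poly_def by (meson order_trans)

lemma has_sum_sum:
  fixes F :: "'a \<Rightarrow> 'b \<Rightarrow> real"
  assumes "\<And>t. t \<in> T \<Longrightarrow> ((\<lambda>\<alpha>. F \<alpha> t) has_sum G t) X"
  shows "((\<lambda>\<alpha>. \<Sum>t\<in>T. F \<alpha> t) has_sum (\<Sum>t\<in>T. G t)) X"
  using assms by (induction T rule: infinite_finite_induct) (auto intro!: has_sum_add)

lemma has_sum_divdiff:
  assumes "\<And>t. t \<in> T \<Longrightarrow> ((\<lambda>\<alpha>. F \<alpha> t) has_sum G t) X"
  shows "((\<lambda>\<alpha>. divdiff T (F \<alpha>)) has_sum divdiff T G) X"
  unfolding divdiff_def divide_inverse
  by (intro has_sum_sum has_sum_cmult_left assms)

lemma powr_le_powr_sublevel: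
  fixes t :: real
  assumes "0 < t" "t \<le> 1" "0 < m" "m \<le> D"
  shows "t powr (1 / m) \<le> t powr (1 / D)"
  using assms by (intro powr_mono') (auto simp: frac_le)

text \<open>Let H be the coefficient of t^m of P along p + t v. The divided difference differs from
  H by three errors of at most |H| / 4 each: the terms of higher degree in t (small \<rho>), the
  move of the base point from p to x (small r), and the perturbation (small \<eta>).\<close>

lemma divdiff_near_poly:
  fixes b :: "('n::finite \<Rightarrow> nat) \<Rightarrow> real" and B :: "('n \<Rightarrow> nat) set" and p v :: "real^'n"
  defines "P \<equiv> \<lambda>x. \<Sum>\<beta>\<in>B. b \<beta> * mpow (x - p) \<beta>"
  assumes B: "finite B" and H: "(\<Sum>\<beta>\<in>{\<beta>\<in>B. mdeg \<beta> = m}. b \<beta> * mpow v \<beta>) \<noteq> 0"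
    and p: "\<And>i. \<bar>p $ i\<bar> \<le> R - 1"
  shows "\<exists>c>0. \<exists>\<rho>>0. \<exists>r>0. \<exists>\<eta>>0. \<forall>f x T. near_poly R P \<eta> f \<and> x \<in> ball p r \<and>
    finite T \<and> card T = Suc m \<and> T \<subseteq> {0..\<rho>} \<longrightarrow> c \<le> \<bar>divdiff T (\<lambda>t. f (x + t *\<^sub>R v))\<bar>"
proof -
  define H where "H = (\<Sum>\<beta>\<in>{\<beta>\<in>B. mdeg \<beta> = m}. b \<beta> * mpow v \<beta>)"
  define K where "K = (\<Sum>\<beta>\<in>B. \<bar>b \<beta>\<bar> * \<bar>mpow v \<beta>\<bar> * 2 ^ mdeg \<beta>)"
  have K: "K \<ge> 0" unfolding K_def by (intro sum_nonneg) auto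
  have H0: "\<bar>H\<bar> > 0" using H by (simp add: H_def)
  \<comment> \<open>The second bound keeps the points in \<open>cube R\<close>, even with 2 \<rho>
    in place of t; the third makes the terms of degree above m contribute at most |H| / 4.\<close>
  define \<rho> where "\<rho> = min 1 (min (1 / (4 * (norm v + 1))) (\<bar>H\<bar> / (4 * (K + 1))))"
  have \<rho>: "0 < \<rho>" "\<rho> \<le> 1" unfolding \<rho>_def using H0 K by (auto simp: add_nonneg_pos)
  have "\<rho> \<le> 1 / (4 * (norm v + 1))" unfolding \<rho>_def by simp
  then have "\<rho> * (4 * (norm v + 1)) \<le> 1" by (simp add: pos_le_divide_eq add_nonneg_pos)
  then have \<rho>v: "2 * \<rho> * norm v \<le> 1 / 2" using \<rho> by (simp add: algebra_simps)
  have "\<rho> \<le> \<bar>H\<bar> / (4 * (K + 1))" unfolding \<rho>_def by simp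
  then have "\<rho> * (4 * (K + 1)) \<le> \<bar>H\<bar>" using K by (simp add: pos_le_divide_eq)
  then have \<rho>K: "\<rho> * K \<le> \<bar>H\<bar> / 4" using \<rho> by (simp add: algebra_simps)
  \<comment> \<open>A majorant for the effect of moving the base point by z. It is continuous and
    vanishes at z = 0, which yields the radius.\<close>
  define \<Phi> where "\<Phi> = (\<lambda>z::real^'n. \<Sum>\<beta>\<in>B. \<bar>b \<beta>\<bar> *
      (mpow (\<chi> i. \<bar>z $ i\<bar> + 2 * \<rho> * \<bar>v $ i\<bar>) \<beta> - mpow (\<chi> i. 2 * \<rho> * \<bar>v $ i\<bar>) \<beta>))"
  have "continuous_on UNIV \<Phi>" unfolding \<Phi>_def by (intro continuous_intros)
  then have "\<Phi> \<midarrow>0\<rightarrow> \<Phi> 0" by (simp add: continuous_on_eq_continuous_at isContD)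
  moreover have "\<Phi> 0 = 0" by (simp add: \<Phi>_def)
  moreover have "\<rho> ^ m * \<bar>H\<bar> / 4 > 0" using \<rho> H0 by simp
  ultimately obtain r0 where r0: "r0 > 0" "\<And>z. norm z < r0 \<Longrightarrow> \<bar>\<Phi> z\<bar> < \<rho> ^ m * \<bar>H\<bar> / 4"
    unfolding LIM_def dist_norm using \<open>\<Phi> 0 = 0\<close> by (metis diff_zero norm_zero real_norm_def)
  define r where "r = min r0 (1 / 2)"
  \<comment> \<open>The factor \<rho> ^ m in the admissible perturbation offsets the division by
    \<rho> ^ m in the bounds for divided differences of order m.\<close>
  have main: "\<bar>H\<bar> / 4 \<le> \<bar>divdiff T (\<lambda>t. f (x + t *\<^sub>R v))\<bar>"
    if f: "near_poly R P (\<rho> ^ m * \<bar>H\<bar> / 4) f" and x: "x \<in> ball p r"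
      and T: "finite T" "card T = Suc m" "T \<subseteq> {0..\<rho>}" for f x T
  proof -
    define z where "z = x - p"
    have z: "norm z < r0" "norm z < 1 / 2"
      using x by (auto simp: z_def r_def dist_norm norm_minus_commute)
    have xR: "\<bar>x $ i\<bar> + 2 * \<rho> * \<bar>v $ i\<bar> \<le> R" for i
    proof -
      have "\<bar>x $ i\<bar> \<le> \<bar>p $ i\<bar> + \<bar>z $ i\<bar>" unfolding z_def by simp
      moreover have "\<bar>z $ i\<bar> \<le> 1 / 2" using component_le_norm_cart[of z i] z by simp
      moreover have "2 * \<rho> * \<bar>v $ i\<bar> \<le> 2 * \<rho> * norm v"
        using component_le_norm_cart[of v i] \<rho> by (intro mult_left_mono) auto
      ultimately show ?thesis using p[of i] \<rho>v by linarith
    qed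
    have cube: "x + t *\<^sub>R v \<in> cube R" if "t \<in> T" for t
    proof -
      have "\<bar>(x + t *\<^sub>R v) $ i\<bar> \<le> R" for i
      proof -
        have "\<bar>(x + t *\<^sub>R v) $ i\<bar> \<le> \<bar>x $ i\<bar> + \<bar>t\<bar> * \<bar>v $ i\<bar>"
          by (simp add: abs_mult[symmetric])
        also have "\<bar>t\<bar> * \<bar>v $ i\<bar> \<le> (2 * \<rho>) * \<bar>v $ i\<bar>"
          using that T(3) by (intro mult_right_mono) auto
        finally show ?thesis using xR[of i] by simp
      qed
      then show ?thesis by (simp add: cube_def)
    qed
    let ?D = "\<lambda>\<beta>::'n \<Rightarrow> nat. divdiff T (\<lambda>t. t ^ mdeg \<beta>)"
    have D0: "divdiff T (\<lambda>t. P (p + t *\<^sub>R v)) = (\<Sum>\<beta>\<in>B. b \<beta> * mpow v \<beta> * ?D \<beta>)"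
    proof -
      have "P (p + t *\<^sub>R v) = (\<Sum>\<beta>\<in>B. (b \<beta> * mpow v \<beta>) * t ^ mdeg \<beta>)" for t
        unfolding P_def by (simp add: mpow_scaleR mult_ac)
      then show ?thesis by (simp only: divdiff_sum divdiff_cmult)
    qed
    have HS: "H = (\<Sum>\<beta>\<in>B. b \<beta> * mpow v \<beta> * (if mdeg \<beta> = m then 1 else 0))"
      unfolding H_def using B by (simp add: sum.If_cases if_distrib Int_def cong: if_cong)
    have "\<bar>divdiff T (\<lambda>t. P (p + t *\<^sub>R v)) - H\<bar>
        \<le> (\<Sum>\<beta>\<in>B. \<bar>b \<beta> * mpow v \<beta> * (?D \<beta> - (if mdeg \<beta> = m then 1 else 0))\<bar>)"
      unfolding D0 HS sum_subtractf[symmetric] right_diff_distrib[symmetric] by (rule sum_abs)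
    also have "\<dots> \<le> (\<Sum>\<beta>\<in>B. \<rho> * (\<bar>b \<beta>\<bar> * \<bar>mpow v \<beta>\<bar> * 2 ^ mdeg \<beta>))"
    proof (rule sum_mono)
      fix \<beta>
      have "\<bar>?D \<beta> - (if mdeg \<beta> = m then 1 else 0)\<bar> \<le> \<rho> * 2 ^ mdeg \<beta>"
      proof -
        consider "mdeg \<beta> < m" | "mdeg \<beta> = m" | "mdeg \<beta> > m" by linarith
        then show ?thesis
        proof cases
          case 3
          then obtain l where l: "mdeg \<beta> = m + Suc l" by (metis less_iff_Suc_add add_Suc_right)
          have "\<bar>?D \<beta>\<bar> * \<rho> ^ m \<le> (2 * \<rho>) ^ mdeg \<beta>"
            by (rule divdiff_power_bound[OF T \<rho>(1)])
          also have "\<dots> = (2 ^ mdeg \<beta> * \<rho> ^ Suc l) * \<rho> ^ m"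
            unfolding l by (simp add: power_mult_distrib power_add)
          finally have "\<bar>?D \<beta>\<bar> \<le> 2 ^ mdeg \<beta> * \<rho> ^ Suc l" using \<rho> by simp
          also have "\<dots> \<le> 2 ^ mdeg \<beta> * \<rho>"
            using \<rho> by (intro mult_left_mono) (auto simp: mult_left_le power_le_one)
          finally show ?thesis using 3 by (simp add: mult.commute)
        qed (use divdiff_power[OF T(1,2)] \<rho> in auto)
      qed
      then have "(\<bar>b \<beta>\<bar> * \<bar>mpow v \<beta>\<bar>) * \<bar>?D \<beta> - (if mdeg \<beta> = m then 1 else 0)\<bar>
          \<le> (\<bar>b \<beta>\<bar> * \<bar>mpow v \<beta>\<bar>) * (\<rho> * 2 ^ mdeg \<beta>)" by (intro mult_left_mono) auto
      then show "\<bar>b \<beta> * mpow v \<beta> * (?D \<beta> - (if mdeg \<beta> = m then 1 else 0))\<bar>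
          \<le> \<rho> * (\<bar>b \<beta>\<bar> * \<bar>mpow v \<beta>\<bar> * 2 ^ mdeg \<beta>)"
        by (simp only: abs_mult mult_ac)
    qed
    also have "\<dots> = \<rho> * K" unfolding K_def by (rule sum_distrib_left[symmetric])
    finally have d1: "\<bar>divdiff T (\<lambda>t. P (p + t *\<^sub>R v)) - H\<bar> \<le> \<bar>H\<bar> / 4" using \<rho>K by simp
    have "\<bar>divdiff T (\<lambda>t. P (x + t *\<^sub>R v)) - divdiff T (\<lambda>t. P (p + t *\<^sub>R v))\<bar> * \<rho> ^ m
        = \<bar>\<Sum>\<beta>\<in>B. b \<beta> * (divdiff T (\<lambda>t. mpow (z + t *\<^sub>R v) \<beta>) - divdiff T (\<lambda>t. mpow (t *\<^sub>R v) \<beta>))\<bar> * \<rho> ^ m"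
      unfolding P_def z_def divdiff_sum divdiff_cmult sum_subtractf[symmetric] right_diff_distrib[symmetric]
      by (simp add: algebra_simps)
    also have "\<dots> \<le> (\<Sum>\<beta>\<in>B. \<bar>b \<beta> * (divdiff T (\<lambda>t. mpow (z + t *\<^sub>R v) \<beta>) - divdiff T (\<lambda>t. mpow (t *\<^sub>R v) \<beta>))\<bar>) * \<rho> ^ m"
      using \<rho> by (intro mult_right_mono) auto
    also have "\<dots> \<le> \<Phi> z"
      unfolding \<Phi>_def sum_distrib_right abs_mult mult.assoc
      by (intro sum_mono mult_left_mono divdiff_mpow_line_bound(2)[OF T \<rho>(1), unfolded mult.assoc]) auto
    also have "\<dots> \<le> \<bar>H\<bar> / 4 * \<rho> ^ m" using r0(2)[OF z(1)] by (simp add: mult.commute)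
    finally have d2: "\<bar>divdiff T (\<lambda>t. P (x + t *\<^sub>R v)) - divdiff T (\<lambda>t. P (p + t *\<^sub>R v))\<bar> \<le> \<bar>H\<bar> / 4"
      using \<rho> by simp
    obtain e \<sigma> where e: "\<sigma> \<le> \<rho> ^ m * \<bar>H\<bar> / 4" "((\<lambda>\<alpha>. \<bar>e \<alpha>\<bar> * R ^ mdeg \<alpha>) has_sum \<sigma>) UNIV"
      "\<And>x. x \<in> cube R \<Longrightarrow> ((\<lambda>\<alpha>. e \<alpha> * mpow x \<alpha>) has_sum (f x - P x)) UNIV"
      using f unfolding near_poly_def by blast
    have hs: "((\<lambda>\<alpha>. e \<alpha> * divdiff T (\<lambda>t. mpow (x + t *\<^sub>R v) \<alpha>)) has_sum
        divdiff T (\<lambda>t. f (x + t *\<^sub>R v) - P (x + t *\<^sub>R v))) UNIV"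
      unfolding divdiff_cmult[symmetric] by (intro has_sum_divdiff e(3) cube T)
    have te: "\<bar>e \<alpha> * divdiff T (\<lambda>t. mpow (x + t *\<^sub>R v) \<alpha>)\<bar> * \<rho> ^ m \<le> \<bar>e \<alpha>\<bar> * R ^ mdeg \<alpha>" for \<alpha>
    proof -
      have "\<bar>divdiff T (\<lambda>t. mpow (x + t *\<^sub>R v) \<alpha>)\<bar> * \<rho> ^ m
          \<le> mpow (\<chi> i. \<bar>x $ i\<bar> + 2 * \<rho> * \<bar>v $ i\<bar>) \<alpha>"
        by (rule divdiff_mpow_line_bound(1)[OF T \<rho>(1)])
      also have "\<dots> \<le> R ^ mdeg \<alpha>"
        unfolding mpow_const[symmetric] using xR \<rho> by (intro mpow_mono) auto
      finally show ?thesis unfolding abs_mult mult.assoc by (intro mult_left_mono) auto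
    qed
    have te': "\<bar>e \<alpha> * divdiff T (\<lambda>t. mpow (x + t *\<^sub>R v) \<alpha>) * \<rho> ^ m\<bar> \<le> \<bar>e \<alpha>\<bar> * R ^ mdeg \<alpha>" for \<alpha>
      using te[of \<alpha>] \<rho>(1) by (simp add: abs_mult)
    have "divdiff T (\<lambda>t. f (x + t *\<^sub>R v) - P (x + t *\<^sub>R v)) * \<rho> ^ m \<le> \<sigma>"
      by (rule has_sum_mono[OF has_sum_cmult_left[OF hs] e(2)]) (rule abs_le_D1[OF te'])
    moreover have "- (divdiff T (\<lambda>t. f (x + t *\<^sub>R v) - P (x + t *\<^sub>R v)) * \<rho> ^ m) \<le> \<sigma>"
      by (rule has_sum_mono[OF has_sum_uminusI[OF has_sum_cmult_left[OF hs]] e(2)]) (rule abs_le_D2[OF te'])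
    ultimately have "\<bar>divdiff T (\<lambda>t. f (x + t *\<^sub>R v) - P (x + t *\<^sub>R v)) * \<rho> ^ m\<bar> \<le> \<sigma>"
      by linarith
    then have "\<bar>divdiff T (\<lambda>t. f (x + t *\<^sub>R v) - P (x + t *\<^sub>R v))\<bar> * \<rho> ^ m \<le> \<bar>H\<bar> / 4 * \<rho> ^ m"
      using e(1) zero_less_power[OF \<rho>(1), of m]
      by (simp only: abs_mult abs_of_pos mult.commute[of _ "\<rho> ^ m"] times_divide_eq_right)
    then have d3: "\<bar>divdiff T (\<lambda>t. f (x + t *\<^sub>R v)) - divdiff T (\<lambda>t. P (x + t *\<^sub>R v))\<bar> \<le> \<bar>H\<bar> / 4"
      using \<rho> by (simp add: divdiff_diff)
    show ?thesis using d1 d2 d3 by linarith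
  qed
  have pos: "\<bar>H\<bar> / 4 > 0" "r > 0" "\<rho> ^ m * \<bar>H\<bar> / 4 > 0" using H0 \<rho> r0(1) by (auto simp: r_def)
  show ?thesis
    by (rule exI[of _ "\<bar>H\<bar> / 4"], rule conjI[OF pos(1)], rule exI[of _ \<rho>], rule conjI[OF \<rho>(1)],
        rule exI[of _ r], rule conjI[OF pos(2)], rule exI[of _ "\<rho> ^ m * \<bar>H\<bar> / 4"], rule conjI[OF pos(3)])
      (intro allI impI, elim conjE, rule main)
qed

text \<open>On each segment in the direction v the one-dimensional estimate applies to
  \<open>f\<close> itself, with constants that depend on P alone; averaging over the base points
  gives the measure of the sublevel set in the ball.\<close>

lemma local_sublevel_estimate:
  fixes c :: "('n::finite \<Rightarrow> nat) \<Rightarrow> real" and A :: "('n \<Rightarrow> nat) set" and p :: "real^'n"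
  defines "P \<equiv> \<lambda>x. \<Sum>\<alpha>\<in>A. c \<alpha> * mpow x \<alpha>"
  assumes A: "finite A" and js: "partial_derivs js P p \<noteq> 0" "real (length js) \<le> D" "D > 0"
    and p: "\<And>i. \<bar>p $ i\<bar> < R - 1"
  shows "\<exists>r>0. ball p r \<subseteq> cube R \<and> (\<exists>\<eta>>0. \<exists>C. \<forall>f t. near_poly R P \<eta> f \<and> t > 0 \<longrightarrow>
    measure lebesgue {x\<in>ball p r. \<bar>f x\<bar> < t} \<le> C * t powr (1 / D))"
proof -
  define m where "m = length js"
  obtain B b where B: "finite B" "P = (\<lambda>x. \<Sum>\<beta>\<in>B. b \<beta> * mpow (x - p) \<beta>)"
    using polynomial_shift[OF A, of c p] unfolding P_def by metis
  obtain v where v: "(\<Sum>\<beta>\<in>{\<beta>\<in>B. mdeg \<beta> = m}. b \<beta> * mpow v \<beta>) \<noteq> 0"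
    using ex_direction[OF B(1) js(1)[unfolded B(2)]] unfolding m_def by blast
  have p': "\<bar>p $ i\<bar> \<le> R - 1" for i using p[of i] by simp
  obtain c \<rho> r' \<eta> where c: "c > 0" and \<rho>: "\<rho> > 0" and r': "r' > 0" and \<eta>: "\<eta> > 0"
    and key: "\<And>f x T. near_poly R P \<eta> f \<Longrightarrow> x \<in> ball p r' \<Longrightarrow> finite T \<Longrightarrow> card T = Suc m \<Longrightarrow>
      T \<subseteq> {0..\<rho>} \<Longrightarrow> c \<le> \<bar>divdiff T (\<lambda>t. f (x + t *\<^sub>R v))\<bar>"
    using divdiff_near_poly[OF B(1) v p'] unfolding B(2)[symmetric] by metis
  define r where "r = min (r' / 2) 1"
  \<comment> \<open>Segments start in a ball enlarged by \<rho>' |v|; this choice keeps that ball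
    inside the one where divided differences are bounded below.\<close>
  define \<rho>' where "\<rho>' = min \<rho> (r' / (2 * (norm v + 1)))"
  have r: "r > 0" "r \<le> r' / 2" "r \<le> 1" using r' by (auto simp: r_def)
  have \<rho>': "0 < \<rho>'" "\<rho>' \<le> \<rho>" using \<rho> r' by (auto simp: \<rho>'_def add_nonneg_pos)
  have "\<rho>' \<le> r' / (2 * (norm v + 1))" by (simp add: \<rho>'_def)
  then have "\<rho>' * (2 * (norm v + 1)) \<le> r'" by (simp add: pos_le_divide_eq add_nonneg_pos)
  then have \<rho>v: "r + \<rho>' * norm v \<le> r'" using r \<rho>' by (simp add: algebra_simps)
  \<comment> \<open>The three entries serve the cases of an empty section or t > 1, of order 0, and
    of positive order with t at most 1.\<close>
  define K where "K = max \<rho>' (max (\<rho>' * c powr (- 1 / D)) (real m * (real (Suc m) / c) powr (1 / m)))"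
  have K: "\<rho>' \<le> K" "\<rho>' * c powr (- 1 / D) \<le> K" "real m * (real (Suc m) / c) powr (1 / m) \<le> K"
    unfolding K_def by (auto simp: max_def)
  have sub: "ball p r \<subseteq> cube R"
  proof
    fix x assume x: "x \<in> ball p r"
    have "\<bar>x $ i\<bar> \<le> R" for i
      using component_le_norm_cart[of "x - p" i] x p'[of i] r(3)
      by (simp add: dist_norm norm_minus_commute)
    then show "x \<in> cube R" by (simp add: cube_def)
  qed
  have "measure lebesgue {x\<in>ball p r. \<bar>f x\<bar> < t}
      \<le> measure lebesgue (ball p (r + \<rho>' * norm v)) * K / \<rho>' * t powr (1 / D)"
    if f: "near_poly R P \<eta> f" and t: "t > 0" for f t
  proof -
    let ?E = "{x\<in>ball p r. \<bar>f x\<bar> < t}"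
    have cont: "continuous_on (ball p r) f"
      using f sub unfolding near_poly_def by (meson continuous_on_subset)
    have op: "open ?E"
    proof -
      have "open (ball p r \<inter> (\<lambda>x. \<bar>f x\<bar>) -` {..<t})"
        by (rule continuous_open_preimage) (intro continuous_intros cont, auto)
      moreover have "ball p r \<inter> (\<lambda>x. \<bar>f x\<bar>) -` {..<t} = ?E" by auto
      ultimately show ?thesis by simp
    qed
    have sec: "measure lebesgue {s\<in>{0..\<rho>'}. x + s *\<^sub>R v \<in> ?E} \<le> K * t powr (1 / D)"
      if x: "x \<in> ball p (r + \<rho>' * norm v)" for x
    proof -
      define Sx where "Sx = {s\<in>{0..\<rho>'}. x + s *\<^sub>R v \<in> ?E}"
      have Sx: "Sx \<subseteq> {0..\<rho>'}" "\<And>s. s \<in> Sx \<Longrightarrow> \<bar>f (x + s *\<^sub>R v)\<bar> < t" unfolding Sx_def by blast+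
      have x': "x \<in> ball p r'" using x \<rho>v by auto
      have "open ((\<lambda>s. x + s *\<^sub>R v) -` ?E)"
        by (rule open_vimage[OF op]) (intro continuous_intros)
      then have "{0..\<rho>'} \<inter> ((\<lambda>s. x + s *\<^sub>R v) -` ?E) \<in> lmeasurable"
        by (intro fmeasurable_Int_fmeasurable) auto
      moreover have "{0..\<rho>'} \<inter> ((\<lambda>s. x + s *\<^sub>R v) -` ?E) = Sx" unfolding Sx_def by blast
      ultimately have Sm: "Sx \<in> lmeasurable" by metis
      have S\<rho>: "measure lebesgue Sx \<le> \<rho>'"
      proof -
        have "measure lebesgue Sx \<le> measure lebesgue {0..\<rho>'}"
          by (rule measure_mono_fmeasurable[OF Sx(1) fmeasurableD[OF Sm]]) simp
        then show ?thesis using \<rho>' by simp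
      qed
      have D: "c \<le> \<bar>divdiff T (\<lambda>s. f (x + s *\<^sub>R v))\<bar>"
        if "finite T" "card T = Suc m" "T \<subseteq> Sx" for T
        by (rule key[OF f x' that(1,2)]) (use that(3) Sx(1) \<rho>'(2) in force)
      have "measure lebesgue Sx \<le> K * t powr (1 / D)"
      proof (cases "m = 0")
        \<comment> \<open>A divided difference with a single node is a value, so |f| is at least c,
          and the section is empty unless t > c.\<close>
        case True
        show ?thesis
        proof (cases "Sx = {}")
          case False
          then obtain s where s: "s \<in> Sx" by blast
          have "c \<le> \<bar>f (x + s *\<^sub>R v)\<bar>" using D[of "{s}"] s True by (simp add: divdiff_def)
          also have "\<dots> < t" using Sx(2)[OF s] .
          finally have "1 \<le> (t / c) powr (1 / D)" using c js(3) by (intro ge_one_powr_ge_zero) auto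
          then have "\<rho>' * 1 \<le> \<rho>' * (t / c) powr (1 / D)" using \<rho>' by (intro mult_left_mono) auto
          also have "\<dots> = (\<rho>' * c powr (- 1 / D)) * t powr (1 / D)"
            using c t by (simp add: powr_divide powr_minus_divide)
          also have "\<dots> \<le> K * t powr (1 / D)" using K(2) by (intro mult_right_mono) auto
          finally show ?thesis using S\<rho> by linarith
        next
          case True
          then show ?thesis using K(1) \<rho>' by simp
        qed
      next
        case False
        \<comment> \<open>For t at most 1 passing from m to the larger number D only weakens the
          bound; for t > 1 the length of the whole segment suffices.\<close>
        show ?thesis
        proof (cases "t \<le> 1")
          case True
          have "measure lebesgue Sx \<le> real m * (real (Suc m) * t / c) powr (1 / real m)"
            using False Sx(2)
            by (intro sublevel_measure_divdiff[OF Sm Sx(1) t c _ _ D]) (auto intro: less_imp_le)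
          also have "\<dots> = (real m * (real (Suc m) / c) powr (1 / m)) * t powr (1 / m)"
            using c t by (simp add: powr_mult powr_divide)
          also have "\<dots> \<le> K * t powr (1 / D)"
            using K(1,3) \<rho>' t True False js(2) m_def
            by (intro mult_mono powr_le_powr_sublevel) auto
          finally show ?thesis .
        next
          case False
          then have "\<rho>' * 1 \<le> K * t powr (1 / D)"
            using K(1) \<rho>' js(3) by (intro mult_mono ge_one_powr_ge_zero) auto
          then show ?thesis using S\<rho> by linarith
        qed
      qed
      then show ?thesis unfolding Sx_def .
    qed
    have "\<rho>' * measure lebesgue ?E
        \<le> measure lebesgue (ball p (r + \<rho>' * norm v)) * (K * t powr (1 / D))"
    proof (rule measure_le_by_averaging[OF _ Collect_restrict \<rho>'(1) _ sec])
      show "?E \<in> sets borel" by (rule borel_open[OF op])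
      show "0 \<le> K * t powr (1 / D)" using K(1) \<rho>'(1) by (intro mult_nonneg_nonneg) auto
    qed
    then have "measure lebesgue ?E
        \<le> measure lebesgue (ball p (r + \<rho>' * norm v)) * (K * t powr (1 / D)) / \<rho>'"
      by (subst pos_le_divide_eq[OF \<rho>'(1)]) (simp only: mult.commute)
    also have "\<dots> = measure lebesgue (ball p (r + \<rho>' * norm v)) * K / \<rho>' * t powr (1 / D)"
      by simp
    finally show ?thesis .
  qed
  then show ?thesis using r(1) \<eta> sub by blast
qed

lemma sublevel_lmeasurable:
  fixes f :: "real^'n::finite \<Rightarrow> real"
  assumes "continuous_on X f" "Q \<in> lmeasurable" "Q \<subseteq> X"
  shows "{x\<in>Q. \<bar>f x\<bar> < t} \<in> lmeasurable"
proof -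
  have "openin (top_of_set X) (X \<inter> (\<lambda>x. \<bar>f x\<bar>) -` {..<t})"
    by (rule continuous_openin_preimage_gen) (intro continuous_intros assms(1), auto)
  then obtain T where T: "open T" "X \<inter> (\<lambda>x. \<bar>f x\<bar>) -` {..<t} = X \<inter> T"
    by (auto simp: openin_open)
  have "{x\<in>Q. \<bar>f x\<bar> < t} = Q \<inter> T" using T(2) assms(3) by auto
  then show ?thesis using assms(2) T(1) by (auto intro!: fmeasurable_Int_fmeasurable)
qed

lemma compact_cube: "compact (cube R :: (real^'n::finite) set)"
proof -
  have "cube R = cbox (\<chi> i::'n. - R) (\<chi> i::'n. R)"
    by (simp add: set_eq_iff cube_def mem_box_cart abs_le_iff minus_le_iff conj_commute)
  then show ?thesis by simp
qed

lemma compact_sublevel_estimate: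
  fixes c :: "('n::finite \<Rightarrow> nat) \<Rightarrow> real" and A :: "('n \<Rightarrow> nat) set" and Q :: "(real^'n) set"
  defines "P \<equiv> \<lambda>x. \<Sum>\<alpha>\<in>A. c \<alpha> * mpow x \<alpha>"
  assumes A: "finite A" and D: "D > 0" and Q: "compact Q"
    and QR: "\<And>p i. p \<in> Q \<Longrightarrow> \<bar>p $ i\<bar> < R - 1"
    and js: "\<And>p. p \<in> Q \<Longrightarrow> \<exists>js. partial_derivs js P p \<noteq> 0 \<and> real (length js) \<le> D"
  shows "\<exists>\<eta>>0. \<exists>C. \<forall>f t. near_poly R P \<eta> f \<and> t > 0 \<longrightarrow>
    measure lebesgue {x\<in>Q. \<bar>f x\<bar> < t} \<le> C * t powr (1 / D)"
proof -
  define good where "good p r \<eta> C \<longleftrightarrow> r > 0 \<and> ball p r \<subseteq> cube R \<and> \<eta> > 0 \<and>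
      (\<forall>f t. near_poly R P \<eta> f \<and> t > 0 \<longrightarrow>
        measure lebesgue {x\<in>ball p r. \<bar>f x\<bar> < t} \<le> C * t powr (1 / D))" for p r \<eta> C
  have "\<forall>p\<in>Q. \<exists>r \<eta> C. good p r \<eta> C"
  proof
    fix p assume p: "p \<in> Q"
    obtain js where "partial_derivs js P p \<noteq> 0" "real (length js) \<le> D" using js[OF p] by blast
    from local_sublevel_estimate[OF A this(1)[unfolded P_def] this(2) D QR[OF p]]
    show "\<exists>r \<eta> C. good p r \<eta> C" unfolding P_def good_def by blast
  qed
  then obtain r \<eta> C where "\<forall>p\<in>Q. good p (r p) (\<eta> p) (C p)" by metis
  then have loc: "\<And>p. p \<in> Q \<Longrightarrow> r p > 0 \<and> ball p (r p) \<subseteq> cube R \<and> \<eta> p > 0 \<and>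
      (\<forall>f t. near_poly R P (\<eta> p) f \<and> t > 0 \<longrightarrow>
        measure lebesgue {x\<in>ball p (r p). \<bar>f x\<bar> < t} \<le> C p * t powr (1 / D))"
    unfolding good_def by blast
  obtain Q' where Q': "Q' \<subseteq> Q" "finite Q'" "Q \<subseteq> (\<Union>p\<in>Q'. ball p (r p))"
  proof (rule compactE_image[OF Q, of Q "\<lambda>p. ball p (r p)"])
    show "Q \<subseteq> (\<Union>p\<in>Q. ball p (r p))" using loc by force
  qed (auto simp: that)
  \<comment> \<open>The inserted 1 keeps the minimum defined if the finite subcover is
    empty.\<close>
  define \<eta>0 where "\<eta>0 = Min (insert 1 (\<eta> ` Q'))"
  have \<eta>0: "\<eta>0 > 0" "\<And>p. p \<in> Q' \<Longrightarrow> \<eta>0 \<le> \<eta> p"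
    unfolding \<eta>0_def using Q' loc by (auto simp: subset_iff)
  have "measure lebesgue {x\<in>Q. \<bar>f x\<bar> < t} \<le> (\<Sum>p\<in>Q'. C p) * t powr (1 / D)"
    if f: "near_poly R P \<eta>0 f" and t: "t > 0" for f t
  proof -
    let ?E = "\<lambda>p. {x\<in>cube R \<inter> ball p (r p). \<bar>f x\<bar> < t}"
    have cont: "continuous_on (cube R) f" using f by (simp add: near_poly_def)
    have EM: "?E p \<in> lmeasurable" for p
      by (rule sublevel_lmeasurable[OF cont]) (auto intro!: fmeasurable.Int lmeasurable_compact[OF compact_cube])
    have Qm: "{x\<in>Q. \<bar>f x\<bar> < t} \<in> lmeasurable"
    proof (rule sublevel_lmeasurable[OF cont])
      have "\<bar>x $ i\<bar> \<le> R" if "x \<in> Q" for x i using QR[OF that, of i] by linarith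
      then show "Q \<subseteq> cube R" by (auto simp: cube_def)
    qed (simp add: Q lmeasurable_compact)
    have "measure lebesgue {x\<in>Q. \<bar>f x\<bar> < t} \<le> measure lebesgue (\<Union>p\<in>Q'. ?E p)"
    proof (rule measure_mono_fmeasurable)
      show "{x \<in> Q. \<bar>f x\<bar> < t} \<subseteq> (\<Union>p\<in>Q'. ?E p)"
      proof
        fix x assume x: "x \<in> {x \<in> Q. \<bar>f x\<bar> < t}"
        then obtain p where "p \<in> Q'" "x \<in> ball p (r p)" using Q'(3) by blast
        moreover have "\<bar>x $ i\<bar> \<le> R" for i using x QR[of x i] by simp
        then have "x \<in> cube R" by (simp add: cube_def)
        ultimately show "x \<in> (\<Union>p\<in>Q'. ?E p)" using x by blast
      qed
    qed (use EM Q'(2) Qm in \<open>auto intro!: fmeasurable.finite_UN\<close>)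
    also have "\<dots> \<le> (\<Sum>p\<in>Q'. measure lebesgue (?E p))"
      by (rule measure_UNION_le) (use Q'(2) EM in auto)
    also have "\<dots> \<le> (\<Sum>p\<in>Q'. C p * t powr (1 / D))"
    proof (rule sum_mono)
      fix p assume p: "p \<in> Q'"
      have "ball p (r p) \<subseteq> cube R" using loc p Q'(1) by blast
      then have "?E p = {x\<in>ball p (r p). \<bar>f x\<bar> < t}" by blast
      moreover have "measure lebesgue {x\<in>ball p (r p). \<bar>f x\<bar> < t} \<le> C p * t powr (1 / D)"
        using loc[of p] p Q'(1) near_poly_mono[OF f \<eta>0(2)[OF p]] t by blast
      ultimately show "measure lebesgue (?E p) \<le> C p * t powr (1 / D)" by simp
    qed
    finally show ?thesis by (simp add: sum_distrib_right)
  qed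
  then show ?thesis using \<eta>0(1) by blast
qed

section \<open>Geometry of the Newton polyhedron\<close>

lemma nat_seq_mono_subseq:
  fixes g :: "nat \<Rightarrow> nat"
  shows "\<exists>r::nat \<Rightarrow> nat. strict_mono r \<and> mono (g \<circ> r)"
proof -
  obtain f :: "nat \<Rightarrow> nat" where f: "strict_mono f" "monoseq (\<lambda>n. g (f n))"
    using seq_monosub[of g] by auto
  from f(2) consider "mono (g \<circ> f)" | "\<And>m n. m \<le> n \<Longrightarrow> g (f n) \<le> g (f m)"
    unfolding monoseq_def mono_def by auto
  then show ?thesis
  proof cases
    case 1
    then show ?thesis using f(1) by blast
  next
    case 2
    \<comment> \<open>A decreasing sequence of natural numbers is constant from the place of its
      minimum on, and a constant sequence is monotone.\<close>
    obtain K where K: "\<And>k. g (f K) \<le> g (f k)"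
      using ex_has_least_nat[of "\<lambda>_. True" 0 "\<lambda>k. g (f k)"] by auto
    have "g (f (k + K)) = g (f K)" for k using 2[of K "k + K"] K[of "k + K"] by simp
    then have "mono (g \<circ> (\<lambda>k. f (k + K)))" by (simp add: mono_def)
    moreover have "strict_mono (\<lambda>k. f (k + K))" using f(1) by (simp add: strict_mono_def)
    ultimately show ?thesis by blast
  qed
qed

lemma Dickson_subseq:
  fixes f :: "nat \<Rightarrow> ('n::finite \<Rightarrow> nat)"
  assumes "finite I"
  shows "\<exists>r::nat \<Rightarrow> nat. strict_mono r \<and> (\<forall>i\<in>I. mono (\<lambda>k. f (r k) i))"
  using assms
proof induction
  case empty
  then show ?case by (intro exI[of _ id]) (auto simp: strict_mono_def)
next
  case (insert i I)
  then obtain r :: "nat \<Rightarrow> nat" where r: "strict_mono r" "\<forall>i\<in>I. mono (\<lambda>k. f (r k) i)" by blast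
  obtain r' :: "nat \<Rightarrow> nat" where r': "strict_mono r'" "mono ((\<lambda>k. f (r k) i) \<circ> r')"
    using nat_seq_mono_subseq by blast
  have "mono (\<lambda>k. f ((r \<circ> r') k) j)" if "j \<in> insert i I" for j
    using that r(2) r' by (auto simp: mono_def comp_def strict_mono_less_eq[OF r'(1)])
  then show ?case using strict_mono_o[OF r(1) r'(1)] by blast
qed

text \<open>A sequence of distinct elements would have a subsequence that is nondecreasing in every
  coordinate, and its first two terms would be comparable.\<close>

lemma Dickson:
  fixes A :: "('n::finite \<Rightarrow> nat) set"
  assumes anti: "\<And>\<alpha> \<beta>. \<alpha> \<in> A \<Longrightarrow> \<beta> \<in> A \<Longrightarrow> \<alpha> \<le> \<beta> \<Longrightarrow> \<alpha> = \<beta>"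
  shows "finite A"
proof (rule ccontr)
  assume "infinite A"
  then obtain f :: "nat \<Rightarrow> ('n \<Rightarrow> nat)" where f: "inj f" "range f \<subseteq> A"
    using infinite_countable_subset by blast
  obtain r :: "nat \<Rightarrow> nat" where r: "strict_mono r" "\<forall>i\<in>UNIV. mono (\<lambda>k. f (r k) i)"
    using Dickson_subseq[of UNIV f] by auto
  have "f (r 0) \<le> f (r 1)" using r(2) by (auto simp: le_fun_def mono_def)
  then have "f (r 0) = f (r 1)" using anti f(2) by blast
  then have "r 0 = r 1" using f(1) by (simp add: inj_eq)
  moreover have "r 0 < r 1" using r(1) by (simp add: strict_mono_def)
  ultimately show False by simp
qed

lemma mdeg_strict_mono: 
  assumes "\<alpha> \<le> \<beta>" "\<alpha> \<noteq> \<beta>"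
  shows "mdeg \<alpha> < mdeg \<beta>"
proof -
  obtain i where "\<alpha> i \<noteq> \<beta> i" using assms(2) by blast
  then have "\<alpha> i < \<beta> i" using assms(1) by (simp add: le_fun_def le_neq_implies_less)
  then show ?thesis unfolding mdeg_def using assms(1)
    by (intro sum_strict_mono_ex1) (auto simp: le_fun_def)
qed

definition msupp :: "(('n::finite \<Rightarrow> nat) \<Rightarrow> real) \<Rightarrow> ('n \<Rightarrow> nat) set" where
  "msupp s = {\<alpha>. s \<alpha> \<noteq> 0}"

text \<open>A finite set that replaces the possibly infinite Taylor support: the polyhedron is its
  convex hull plus the orthant, so minima of nonnegative functionals can be taken over it.\<close>

definition minimal_exponents :: "(('n::finite \<Rightarrow> nat) \<Rightarrow> real) \<Rightarrow> ('n \<Rightarrow> nat) set" where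
  "minimal_exponents s = {\<alpha>\<in>msupp s. \<forall>\<beta>\<in>msupp s. \<beta> \<le> \<alpha> \<longrightarrow> \<beta> = \<alpha>}"

lemma finite_minimal_exponents: "finite (minimal_exponents s)"
  by (rule Dickson) (auto simp: minimal_exponents_def)

lemma minimal_exponents_subset: "minimal_exponents s \<subseteq> msupp s"
  by (auto simp: minimal_exponents_def)

lemma ex_minimal_exponent_le:
  assumes "\<alpha> \<in> msupp s"
  shows "\<exists>g\<in>minimal_exponents s. g \<le> \<alpha>"
  using assms
proof (induction "mdeg \<alpha>" arbitrary: \<alpha> rule: less_induct)
  case less
  show ?case
  proof (cases "\<alpha> \<in> minimal_exponents s")
    case False
    then obtain \<beta> where "\<beta> \<in> msupp s" "\<beta> \<le> \<alpha>" "\<beta> \<noteq> \<alpha>"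
      using less.prems by (auto simp: minimal_exponents_def)
    then show ?thesis using less.hyps[OF mdeg_strict_mono] by (meson order_trans)
  qed auto
qed

section \<open>The Newton polyhedron as polytope plus orthant\<close>

abbreviation nonneg_vec :: "real^'n::finite \<Rightarrow> bool" where
  "nonneg_vec x \<equiv> (\<forall>i. 0 \<le> x $ i)"

lemma inner_vec_real: "(x::real^'n::finite) \<bullet> y = (\<Sum>i\<in>UNIV. x $ i * y $ i)"
  by (simp add: inner_vec_def)

lemma inner_nonneg_mono:
  fixes j :: "real^'n::finite"
  assumes "nonneg_vec j" "\<And>i. x $ i \<le> y $ i"
  shows "j \<bullet> x \<le> j \<bullet> y"
  unfolding inner_vec_real using assms by (intro sum_mono mult_left_mono) auto

locale newton =
  fixes s :: "('n::finite \<Rightarrow> nat) \<Rightarrow> real"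
  assumes s_nonzero: "\<exists>\<alpha>. s \<alpha> \<noteq> 0" and s_0: "s (\<lambda>_. 0) = 0"
begin

abbreviation "G \<equiv> minimal_exponents s"
abbreviation "N \<equiv> newton_polyhedron s"
abbreviation "pt \<equiv> (exponent_point :: ('n \<Rightarrow> nat) \<Rightarrow> real^'n)"

lemma G_finite: "finite G" by (rule finite_minimal_exponents)

lemma G_nonempty: "G \<noteq> {}"
  using s_nonzero ex_minimal_exponent_le[of _ s] by (auto simp: msupp_def)

lemma G_nonzero: "g \<in> G \<Longrightarrow> g \<noteq> (\<lambda>_. 0)"
  using s_0 minimal_exponents_subset[of s] by (auto simp: msupp_def)

lemma G_mdeg: "g \<in> G \<Longrightarrow> mdeg g \<ge> 1"
  using mdeg_strict_mono[of "\<lambda>_. 0" g] G_nonzero[of g] by (auto simp: le_fun_def)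

text \<open>The m(j) of the overview, taken over the finite set \<open>G\<close> so that it is
  attained for every real vector; for nonnegative \<open>j\<close> it bounds the functional from
  below on all of N, by \<open>mval_le_N\<close>.\<close>

definition mval :: "real^'n \<Rightarrow> real" where
  "mval j = Min ((\<lambda>g. j \<bullet> pt g) ` G)"

lemma mval_attained: "\<exists>g\<in>G. mval j = j \<bullet> pt g"
proof -
  have "mval j \<in> (\<lambda>g. j \<bullet> pt g) ` G"
    unfolding mval_def using G_finite G_nonempty by (intro Min_in) auto
  then show ?thesis by blast
qed

lemma mval_le_G: "g \<in> G \<Longrightarrow> mval j \<le> j \<bullet> pt g"
  unfolding mval_def using G_finite by auto

lemma pt_mono: "\<alpha> \<le> \<beta> \<Longrightarrow> pt \<alpha> $ i \<le> pt \<beta> $ i"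
  by (simp add: exponent_point_def le_fun_def)

lemma mval_le_supp:
  assumes "nonneg_vec j" "\<alpha> \<in> msupp s"
  shows "mval j \<le> j \<bullet> pt \<alpha>"
proof -
  obtain g where g: "g \<in> G" "g \<le> \<alpha>" using ex_minimal_exponent_le[OF assms(2)] by blast
  have "mval j \<le> j \<bullet> pt g" by (rule mval_le_G[OF g(1)])
  also have "\<dots> \<le> j \<bullet> pt \<alpha>" by (rule inner_nonneg_mono[OF assms(1) pt_mono[OF g(2)]])
  finally show ?thesis .
qed

lemma octant_eq: "octant \<alpha> = {x. nonneg_vec (x - pt \<alpha>)}"
  by (simp add: octant_def exponent_point_def)

lemma N_minimal:
  assumes "convex X" "\<And>\<alpha> x. \<alpha> \<in> msupp s \<Longrightarrow> nonneg_vec (x - pt \<alpha>) \<Longrightarrow> x \<in> X"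
  shows "N \<subseteq> X"
  unfolding newton_polyhedron_def
  by (rule hull_minimal) (use assms in \<open>auto simp: octant_eq msupp_def\<close>)

lemma mval_le_N:
  assumes "nonneg_vec j" "x \<in> N"
  shows "mval j \<le> j \<bullet> x"
proof -
  have "N \<subseteq> {x. j \<bullet> x \<ge> mval j}"
  proof (rule N_minimal)
    fix \<alpha> x assume a: "\<alpha> \<in> msupp s" "nonneg_vec (x - pt \<alpha>)"
    have "mval j \<le> j \<bullet> pt \<alpha>" by (rule mval_le_supp[OF assms(1) a(1)])
    also have "\<dots> \<le> j \<bullet> x" by (rule inner_nonneg_mono[OF assms(1)]) (use a(2) in auto)
    finally show "x \<in> {x. j \<bullet> x \<ge> mval j}" by simp
  qed (rule convex_halfspace_ge)
  then show ?thesis using assms(2) by blast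
qed

lemma convex_N: "convex N" by (simp add: newton_polyhedron_def)

lemma supp_in_N: "\<alpha> \<in> msupp s \<Longrightarrow> nonneg_vec (x - pt \<alpha>) \<Longrightarrow> x \<in> N"
  unfolding newton_polyhedron_def by (rule hull_inc) (auto simp: octant_eq msupp_def)

lemma pt_in_N: "\<alpha> \<in> msupp s \<Longrightarrow> pt \<alpha> \<in> N"
  by (rule supp_in_N) auto

lemma convex_orthant: "convex {x::real^'n. nonneg_vec x}"
  by (auto simp: convex_def)

text \<open>The octant of any exponent lies in the octant of a minimal exponent below it. The sum of
  a closed set and a compact one is closed, and adding a nonnegative vector stays inside.\<close>

lemma N_eq_sum: "N = (\<Union>x\<in>{x. nonneg_vec x}. \<Union>y\<in>convex hull (pt ` G). {x + y})" (is "_ = ?R")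
proof
  show "N \<subseteq> ?R"
  proof (rule N_minimal)
    show "convex ?R" by (intro convex_sums convex_orthant convex_convex_hull)
    fix \<alpha> x assume a: "\<alpha> \<in> msupp s" "nonneg_vec (x - pt \<alpha>)"
    obtain g where g: "g \<in> G" "g \<le> \<alpha>" using ex_minimal_exponent_le[OF a(1)] by blast
    have "nonneg_vec (x - pt g)" using a(2) pt_mono[OF g(2)] by (auto intro: order_trans)
    moreover have "pt g \<in> convex hull (pt ` G)" using g by (auto intro: hull_inc)
    ultimately show "x \<in> ?R" by (intro UN_I[of "x - pt g"] UN_I[of "pt g"]) auto
  qed
  have shift: "convex hull (pt ` G) \<subseteq> {y. x + y \<in> N}" if "nonneg_vec x" for x
  proof (rule hull_minimal)
    show "pt ` G \<subseteq> {y. x + y \<in> N}"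
      using that supp_in_N minimal_exponents_subset[of s] by auto
    have "{y. x + y \<in> N} = (+) (- x) ` N" by (auto simp: image_iff algebra_simps)
    then show "convex {y. x + y \<in> N}" using convex_translation[OF convex_N] by metis
  qed
  then show "?R \<subseteq> N" by auto
qed

lemma closed_N: "closed N"
  unfolding N_eq_sum
proof (rule closed_compact_sums)
  have "{x::real^'n. nonneg_vec x} = (\<Inter>i. {x. 0 \<le> x $ i})" by auto
  moreover have "closed {x::real^'n. 0 \<le> x $ i}" for i by (intro closed_Collect_le continuous_intros)
  ultimately show "closed {x::real^'n. nonneg_vec x}" by (metis closed_INT)
  show "compact (convex hull (pt ` G))"
    using G_finite by (intro finite_imp_compact_convex_hull) auto
qed

lemma N_up: 
  assumes "x \<in> N" "nonneg_vec o'"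
  shows "x + o' \<in> N"
proof -
  obtain a y where "nonneg_vec a" "y \<in> convex hull (pt ` G)" "x = a + y"
    using assms(1) unfolding N_eq_sum by auto
  then show ?thesis unfolding N_eq_sum using assms(2)
    by (intro UN_I[of "a + o'"] UN_I[of y]) auto
qed

lemma inner_one_pt: "(vec 1 :: real^'n) \<bullet> pt \<alpha> = mdeg \<alpha>"
  by (simp add: inner_vec_real exponent_point_def mdeg_def)

section \<open>Newton distance, central face and the defect h\<close>

definition d :: real where "d = newton_distance s"
definition p :: "real^'n" where "p = vec d"

lemma inner_p: "p \<bullet> x = d * (\<Sum>i\<in>UNIV. x $ i)"
  by (simp add: p_def inner_vec_real sum_distrib_left)

text \<open>As 0 is not an exponent, all minimal exponents have degree at least 1, so the coordinate
  sum is at least 1 on N; this bounds t away from 0. N is closed, so the infimum is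
  attained.\<close>

lemma
  shows p_in_N: "p \<in> N" and d_pos: "d > 0" and d_le: "\<And>t. vec t \<in> N \<Longrightarrow> d \<le> t"
proof -
  let ?D = "{t::real. vec t \<in> N}"
  have lower: "1 / real CARD('n) \<le> t" if "t \<in> ?D" for t
  proof -
    obtain g where g: "g \<in> G" "mval (vec 1) = (vec 1 :: real^'n) \<bullet> pt g" using mval_attained by blast
    have "1 \<le> mval (vec 1)" using G_mdeg[OF g(1)] g(2) inner_one_pt by simp
    also have "\<dots> \<le> vec 1 \<bullet> (vec t :: real^'n)" by (rule mval_le_N) (use that in auto)
    also have "\<dots> = real CARD('n) * t" by (simp add: inner_vec_real)
    finally show ?thesis by (simp add: divide_le_eq mult.commute)
  qed
  have ne: "?D \<noteq> {}"
  proof -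
    obtain g where g: "g \<in> G" using G_nonempty by blast
    have "g i \<le> mdeg g" for i unfolding mdeg_def by (rule member_le_sum) auto
    then have "vec (real (mdeg g)) \<in> N"
      using g minimal_exponents_subset[of s] by (intro supp_in_N[of g]) (auto simp: exponent_point_def)
    then show ?thesis by blast
  qed
  have bdd: "bdd_below ?D" using lower by (intro bdd_belowI) 
  have "closed ?D"
  proof -
    have "continuous_on UNIV (vec :: real \<Rightarrow> real^'n)"
      unfolding vec_def by (intro continuous_intros)
    from closed_vimage[OF closed_N this] show ?thesis by (simp add: vimage_def)
  qed
  then have "d \<in> ?D" unfolding d_def newton_distance_def by (intro closed_contains_Inf ne bdd)
  then show "p \<in> N" by (simp add: p_def)
  show "d > 0" using lower[OF \<open>d \<in> ?D\<close>] by (simp add: less_le_trans[of 0 "1 / real CARD('n)"])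
  show "d \<le> t" if "vec t \<in> N" for t
    unfolding d_def newton_distance_def using that bdd by (intro cInf_lower) auto
qed

abbreviation "C \<equiv> central_face s"

text \<open>The intersection of all faces through p is the smallest such face. If p were on its
  relative boundary, a supporting hyperplane at p would cut out a smaller one. Uniqueness holds
  because faces whose relative interiors meet coincide.\<close>

lemma central_face: "C face_of N" "p \<in> rel_interior C"
proof -
  let ?A = "{F. F face_of N \<and> p \<in> F}"
  define F where "F = \<Inter> ?A"
  have A: "N \<in> ?A" using p_in_N convex_N by (simp add: face_of_refl)
  have F: "F face_of N" unfolding F_def using A by (intro face_of_Inter) auto
  have pF: "p \<in> F" by (auto simp: F_def)
  have cF: "convex F" using F by (rule face_of_imp_convex)
  have "p \<in> rel_interior F"
  proof (rule ccontr)
    assume n: "p \<notin> rel_interior F"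
    obtain a where a: "a \<noteq> 0" "\<And>y. y \<in> F \<Longrightarrow> a \<bullet> p \<le> a \<bullet> y" "\<And>y. y \<in> rel_interior F \<Longrightarrow> a \<bullet> p < a \<bullet> y"
      using supporting_hyperplane_rel_boundary[OF cF pF n] by metis
    have "(F \<inter> {y. a \<bullet> y = a \<bullet> p}) face_of F"
      by (rule face_of_Int_supporting_hyperplane_ge[OF cF a(2)])
    then have "(F \<inter> {y. a \<bullet> y = a \<bullet> p}) face_of N" using F by (rule face_of_trans)
    then have "F \<subseteq> F \<inter> {y. a \<bullet> y = a \<bullet> p}" using pF unfolding F_def by (intro Inter_lower) auto
    moreover obtain y where "y \<in> rel_interior F" using rel_interior_eq_empty[OF cF] pF by auto
    ultimately show False using a(3)[of y] rel_interior_subset[of F] by auto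
  qed
  then have ex: "F face_of N \<and> vec (newton_distance s) \<in> rel_interior F"
    using F by (simp add: p_def d_def)
  have "C face_of N \<and> vec (newton_distance s) \<in> rel_interior C"
    unfolding central_face_def
    by (rule theI[where a = F], rule ex) (use ex face_of_eq[of _ N F] in blast)
  then show "C face_of N" "p \<in> rel_interior C" by (auto simp: p_def d_def)
qed

lemma C_sub: "C \<subseteq> N" and p_in_C: "p \<in> C" and convex_C: "convex C"
  using face_of_imp_subset[OF central_face(1)] subsetD[OF rel_interior_subset central_face(2)]
    face_of_imp_convex[OF central_face(1)] .

definition dirs :: "(real^'n) set" where "dirs = (\<lambda>x. x - p) ` C"

lemma affine_hull_C: "affine hull C = {x. x - p \<in> span dirs}"
proof -
  have "affine hull C = (+) p ` span ((\<lambda>x. - p + x) ` C)"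
    by (rule affine_hull_span_gen) (rule hull_inc[OF p_in_C])
  also have "(\<lambda>x. - p + x) ` C = dirs" by (auto simp: dirs_def)
  also have "(+) p ` span dirs = {x. x - p \<in> span dirs}"
    by (auto intro!: image_eqI[of _ _ "_ - p"])
  finally show ?thesis .
qed

lemma dim_dirs: "aff_dim C = int (dim dirs)"
  unfolding dirs_def by (rule aff_dim_eq_dim_subtract) (rule hull_inc[OF p_in_C])

text \<open>Otherwise the diagonal would lie in the affine hull of C, and as p is a relative
  interior point one could move from p towards the origin inside N, against the minimality of
  d.\<close>

lemma p_notin_span_dirs: "p \<notin> span dirs"
proof
  assume a: "p \<in> span dirs"
  have "p + p \<in> affine hull C" using a by (simp add: affine_hull_C)
  then obtain e where e: "e > 1" "(1 - e) *\<^sub>R (p + p) + e *\<^sub>R p \<in> C"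
    using convex_rel_interior_if2[OF convex_C central_face(2)] by blast
  have "(1 - e) *\<^sub>R (p + p) + e *\<^sub>R p = vec ((2 - e) * d)"
    by (simp add: p_def vec_eq_iff algebra_simps)
  then have "d \<le> (2 - e) * d" using e(2) C_sub d_le by auto
  then show False using e(1) d_pos by (simp add: mult_le_cancel_right)
qed

text \<open>A face of a convex set is the intersection of the set with the affine hull of the
  face.\<close>

lemma pt_notin_span_dirs:
  assumes "\<alpha> \<in> msupp s" "pt \<alpha> \<notin> C"
  shows "pt \<alpha> - p \<notin> span dirs"
  using face_of_imp_eq_affine_Int[OF convex_N central_face(1)] pt_in_N[OF assms(1)] assms(2)
  by (auto simp: affine_hull_C)

definition h :: "real^'n \<Rightarrow> real" where "h j = p \<bullet> j - mval j"

lemma h_nonneg: "nonneg_vec j \<Longrightarrow> 0 \<le> h j"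
  using mval_le_N[OF _ p_in_N] by (simp add: h_def inner_commute)

text \<open>For x in C the inequality m(j) <= j.x bounds w.j from below. Since p is relatively
  interior, the segment from x to p extends a little beyond p inside C, and its end bounds w.j from
  above.\<close>

lemma dirs_le_h:
  assumes "w \<in> dirs"
  shows "\<exists>K>0. \<forall>j. nonneg_vec j \<longrightarrow> \<bar>w \<bullet> j\<bar> \<le> K * h j"
proof -
  obtain x where x: "x \<in> C" "w = x - p" using assms by (auto simp: dirs_def)
  have "x \<in> affine hull C" using x(1) by (rule hull_inc)
  then obtain e where e: "e > 1" "(1 - e) *\<^sub>R x + e *\<^sub>R p \<in> C"
    using convex_rel_interior_if2[OF convex_C central_face(2)] by blast
  have eq: "(1 - e) *\<^sub>R x + e *\<^sub>R p = p - (e - 1) *\<^sub>R w" by (simp add: x(2) algebra_simps)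
  have "\<bar>w \<bullet> j\<bar> \<le> (1 + 1 / (e - 1)) * h j" if j: "nonneg_vec j" for j
  proof -
    have "mval j \<le> j \<bullet> x" by (rule mval_le_N[OF j]) (use x C_sub in auto)
    then have 1: "- (w \<bullet> j) \<le> h j" unfolding h_def x(2) by (simp add: inner_commute inner_diff_right)
    have "mval j \<le> j \<bullet> (p - (e - 1) *\<^sub>R w)" by (rule mval_le_N[OF j]) (use e eq C_sub in auto)
    then have "(e - 1) * (w \<bullet> j) \<le> h j" unfolding h_def by (simp add: inner_commute inner_diff_right)
    then have 2: "w \<bullet> j \<le> 1 / (e - 1) * h j" using e(1) by (simp add: field_simps)
    have "0 \<le> h j" "0 \<le> 1 / (e - 1) * h j" using h_nonneg[OF j] e(1) by auto
    then show ?thesis using 1 2 unfolding distrib_right by linarith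
  qed
  moreover have "1 + 1 / (e - 1) > 0" using e(1) by (simp add: add_pos_pos)
  ultimately show ?thesis by blast
qed

lemma ex_basis_dirs:
  "\<exists>B. B \<subseteq> dirs \<and> independent B \<and> span B = span dirs \<and> finite B \<and> int (card B) = aff_dim C"
proof -
  obtain B where B: "B \<subseteq> dirs" "independent B" "dirs \<subseteq> span B" "card B = dim dirs"
    using basis_exists[of dirs] by metis
  have "span B = span dirs" using B by (meson span_eq subset_trans span_superset)
  moreover have "finite B" using B(2) by (rule independent_imp_finite)
  ultimately show ?thesis using B dim_dirs by auto
qed

section \<open>The normal cone at p and its dimension\<close>

definition normal_cone :: "(real^'n) set" where
  "normal_cone = {u. \<forall>x\<in>N. u \<bullet> p \<le> u \<bullet> x}"

lemma normal_cone_nonneg: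
  assumes "u \<in> normal_cone"
  shows "nonneg_vec u"
proof
  fix i
  have "p + axis i 1 \<in> N" by (rule N_up[OF p_in_N]) (auto simp: axis_def)
  then show "0 \<le> u $ i" using assms by (auto simp: normal_cone_def inner_add_right inner_axis)
qed

lemma mval_normal_cone:
  assumes "u \<in> normal_cone"
  shows "mval u = p \<bullet> u"
proof -
  obtain g where g: "g \<in> G" "mval u = u \<bullet> pt g" using mval_attained by blast
  have "pt g \<in> N" using pt_in_N g(1) minimal_exponents_subset[of s] by blast
  then have "u \<bullet> p \<le> mval u" using assms g(2) by (simp add: normal_cone_def)
  moreover have "mval u \<le> u \<bullet> p" by (rule mval_le_N[OF normal_cone_nonneg[OF assms] p_in_N])
  ultimately show ?thesis by (simp add: inner_commute)
qed

text \<open>Duality. A vector orthogonal to the normal cone lies in the cone of feasible directions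
  at p, since a separating functional would belong to the normal cone. This applies to z and to -z,
  so p is inside a segment of N parallel to z, and a face through p contains that segment.\<close>

lemma orthogonal_normal_cone:
  assumes z: "\<And>u. u \<in> normal_cone \<Longrightarrow> u \<bullet> z = 0"
  shows "z \<in> span dirs"
proof -
  define K where "K = convex_cone hull ((\<lambda>g. pt g - p) ` G \<union> range (\<lambda>i. axis i 1))"
  let ?X = "{y. \<exists>\<eta>>0. p + \<eta> *\<^sub>R y \<in> N}"
  have shrink: "p + \<eta>' *\<^sub>R y \<in> N" if "p + \<eta> *\<^sub>R y \<in> N" "0 < \<eta>'" "\<eta>' \<le> \<eta>" for \<eta> \<eta>' y
  proof -
    have "(1 - \<eta>' / \<eta>) *\<^sub>R p + (\<eta>' / \<eta>) *\<^sub>R (p + \<eta> *\<^sub>R y) \<in> N"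
      using that by (intro convexD_alt[OF convex_N p_in_N]) auto
    moreover have "(1 - \<eta>' / \<eta>) *\<^sub>R p + (\<eta>' / \<eta>) *\<^sub>R (p + \<eta> *\<^sub>R y) = p + \<eta>' *\<^sub>R y"
      using that by (simp add: algebra_simps)
    ultimately show ?thesis by simp
  qed
  have "K \<subseteq> ?X"
    unfolding K_def
  proof (rule hull_minimal)
    have "pt g - p \<in> ?X" if "g \<in> G" for g
      using pt_in_N[of g] that minimal_exponents_subset[of s] by (auto intro!: exI[of _ "1::real"])
    moreover have "axis i 1 \<in> ?X" for i
      using N_up[OF p_in_N, of "axis i 1"] by (auto intro!: exI[of _ "1::real"] simp: axis_def)
    ultimately show "(\<lambda>g. pt g - p) ` G \<union> range (\<lambda>i. axis i 1) \<subseteq> ?X" by blast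
    show "convex_cone ?X"
      unfolding convex_cone_iff
    proof (intro conjI ballI allI impI)
      show "0 \<in> ?X" using p_in_N by (auto intro!: exI[of _ "1::real"])
    next
      fix x y assume "x \<in> ?X" "y \<in> ?X"
      then obtain a b where ab: "a > 0" "p + a *\<^sub>R x \<in> N" "b > 0" "p + b *\<^sub>R y \<in> N" by blast
      define m where "m = min a b"
      have m: "m > 0" "p + m *\<^sub>R x \<in> N" "p + m *\<^sub>R y \<in> N"
        using shrink[OF ab(2), of m] shrink[OF ab(4), of m] ab by (auto simp: m_def)
      have "(1 - 1/2) *\<^sub>R (p + m *\<^sub>R x) + (1/2) *\<^sub>R (p + m *\<^sub>R y) \<in> N"
        by (intro convexD_alt[OF convex_N] m) auto
      moreover have "(1 - 1/2) *\<^sub>R (p + m *\<^sub>R x) + (1/2) *\<^sub>R (p + m *\<^sub>R y) = p + (m / 2) *\<^sub>R (x + y)"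
        by (simp add: vec_eq_iff field_simps)
      ultimately have "p + (m / 2) *\<^sub>R (x + y) \<in> N" by simp
      moreover have "m / 2 > 0" using m(1) by simp
      ultimately show "x + y \<in> ?X" by blast
    next
      fix x and c :: real assume "x \<in> ?X" "0 \<le> c"
      then obtain a where a: "a > 0" "p + a *\<^sub>R x \<in> N" by blast
      show "c *\<^sub>R x \<in> ?X"
      proof (cases "c = 0")
        case True
        then show ?thesis using p_in_N by (auto intro!: exI[of _ "1::real"])
      next
        case False
        then have "a / c > 0" "p + (a / c) *\<^sub>R (c *\<^sub>R x) \<in> N" using a \<open>0 \<le> c\<close> by auto
        then show ?thesis by blast
      qed
    qed
  qed
  \<comment> \<open>Separation needs a closed cone. The generated cone is closed since it has
    finitely many generators; for the set of feasible directions this is not apparent.\<close>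
  have "polyhedron K" unfolding K_def using G_finite by (intro polyhedron_convex_cone_hull) auto
  then have K: "closed K" "convex K" "convex_cone K"
    using polyhedron_imp_closed polyhedron_imp_convex convex_cone_convex_cone_hull by (auto simp: K_def)
  have gen: "pt g - p \<in> K" if "g \<in> G" for g unfolding K_def using that by (intro hull_inc) auto
  have gen': "axis i 1 \<in> K" for i unfolding K_def by (intro hull_inc) auto
  have inK: "y \<in> K" if y: "\<And>u. u \<in> normal_cone \<Longrightarrow> u \<bullet> y = 0" for y
  proof (rule ccontr)
    assume "y \<notin> K"
    then obtain a b where ab: "a \<bullet> y < b" "\<And>x. x \<in> K \<Longrightarrow> a \<bullet> x > b"
      using separating_hyperplane_closed_point[OF K(2,1)] by blast
    have b0: "b < 0" using ab(2)[of 0] K(3) convex_cone_contains_0 by auto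
    have pos: "0 \<le> a \<bullet> x" if "x \<in> K" for x
    proof (rule ccontr)
      assume n: "\<not> 0 \<le> a \<bullet> x"
      \<comment> \<open>Both numbers are negative, so this is a positive multiple of x; the
        functional takes the value b there, although it exceeds b on K.\<close>
      have "(b / (a \<bullet> x)) *\<^sub>R x \<in> K" using n b0 that K(3) by (intro convex_cone_scaleR) (auto simp: divide_nonpos_neg)
      from ab(2)[OF this] n show False by simp
    qed
    have "a \<in> normal_cone"
    proof -
      have a0: "nonneg_vec a" using pos[OF gen'] by (simp add: inner_axis)
      obtain g where "g \<in> G" "mval a = a \<bullet> pt g" using mval_attained by blast
      then have "a \<bullet> p \<le> mval a" using pos[OF gen] by (simp add: inner_diff_right)
      then show ?thesis unfolding normal_cone_def using mval_le_N[OF a0] by force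
    qed
    then show False using y ab(1) b0 by fastforce
  qed
  have "z \<in> ?X" using inK[OF z] \<open>K \<subseteq> ?X\<close> by blast
  moreover have "- z \<in> ?X"
    by (rule subsetD[OF \<open>K \<subseteq> ?X\<close> inK]) (simp add: z)
  ultimately obtain a b where ab: "a > 0" "p + a *\<^sub>R z \<in> N" "b > 0" "p + b *\<^sub>R (- z) \<in> N" by blast
  show ?thesis
  proof (cases "z = 0")
    case False
    have "p \<in> open_segment (p + a *\<^sub>R z) (p + b *\<^sub>R (- z))"
    proof -
      have "p = (1 - a / (a + b)) *\<^sub>R (p + a *\<^sub>R z) + (a / (a + b)) *\<^sub>R (p + b *\<^sub>R (- z))"
      proof -
        have sum1: "b / (a + b) + a / (a + b) = 1"
          using ab by (simp add: add_divide_distrib[symmetric] add.commute)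
        then have "1 - a / (a + b) = b / (a + b)" by linarith
        then have "(1 - a / (a + b)) *\<^sub>R (p + a *\<^sub>R z) + (a / (a + b)) *\<^sub>R (p + b *\<^sub>R (- z))
            = (b / (a + b) + a / (a + b)) *\<^sub>R p"
          by (simp only: scaleR_add_left scaleR_add_right) (simp add: mult.commute)
        then show ?thesis unfolding sum1 by simp
      qed
      moreover have "p + a *\<^sub>R z \<noteq> p + b *\<^sub>R (- z)"
      proof
        assume "p + a *\<^sub>R z = p + b *\<^sub>R (- z)"
        then have "(a + b) *\<^sub>R z = 0" by (simp add: algebra_simps)
        then show False using False ab by simp
      qed
      ultimately show ?thesis unfolding in_segment using ab
        by (intro conjI exI[of _ "a / (a + b)"]) (auto simp: field_simps)
    qed
    then have "p + a *\<^sub>R z \<in> C"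
      using central_face(1) ab(2,4) p_in_C unfolding face_of_def by blast
    then have "a *\<^sub>R z \<in> dirs" by (force simp: dirs_def)
    then have "(1 / a) *\<^sub>R (a *\<^sub>R z) \<in> span dirs" by (intro span_scale span_base)
    then show ?thesis using ab(1) by simp
  qed (simp add: span_zero)
qed

text \<open>By duality the orthogonal complement of the normal cone is contained in the direction
  space of C, so the cone spans a space of dimension at least n - k.\<close>

lemma ex_independent_normal_cone:
  "\<exists>B. B \<subseteq> normal_cone \<and> independent B \<and> finite B \<and> int (card B) = int CARD('n) - aff_dim C"
proof -
  let ?O = "{y. \<forall>x\<in>span normal_cone. orthogonal x y}"
  have "dim {y\<in>UNIV. \<forall>x\<in>span normal_cone. orthogonal x y} + dim (span normal_cone) = dim (UNIV :: (real^'n) set)"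
    by (rule dim_subspace_orthogonal_to_vectors) auto
  then have "dim ?O + dim normal_cone = CARD('n)" by simp
  moreover have "dim ?O \<le> dim dirs"
  proof -
    have "?O \<subseteq> span dirs"
    proof
      fix y assume "y \<in> ?O"
      then have "u \<bullet> y = 0" if "u \<in> normal_cone" for u
        using span_base[OF that] by (simp add: orthogonal_def)
      then show "y \<in> span dirs" by (rule orthogonal_normal_cone)
    qed
    then have "dim ?O \<le> dim (span dirs)" by (rule dim_subset)
    then show ?thesis by simp
  qed
  ultimately have le: "CARD('n) \<le> dim dirs + dim normal_cone" by linarith
  obtain B where B: "B \<subseteq> normal_cone" "independent B" "card B = dim normal_cone"
    using basis_exists[of normal_cone] by metis
  have le': "dim dirs \<le> CARD('n)" using dim_subset_UNIV[of dirs] by simp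
  have "CARD('n) - dim dirs \<le> card B" using B(3) le by linarith
  then obtain B' where B': "B' \<subseteq> B" "card B' = CARD('n) - dim dirs"
    by (rule obtain_subset_with_card_n)
  have "int (card B') = int CARD('n) - aff_dim C" using B'(2) le' dim_dirs by simp
  moreover have "independent B'" by (rule independent_mono[OF B(2) B'(1)])
  ultimately show ?thesis using B(1) B'(1) independent_imp_finite by blast
qed

lemma aff_dim_C_less: "aff_dim C < int CARD('n)" "0 \<le> aff_dim C"
proof -
  have "dim dirs < CARD('n)"
  proof -
    have "dim dirs \<noteq> DIM(real^'n)"
      using p_notin_span_dirs dim_eq_full[of dirs] by blast
    then show ?thesis using dim_subset_UNIV[of dirs] by simp
  qed
  then show "aff_dim C < int CARD('n)" "0 \<le> aff_dim C" using dim_dirs by auto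
qed

end

section \<open>Sums of exponentials over lattice points\<close>

text \<open>On unit vectors orthogonal to the annihilator the sum of the absolute values is
  positive, hence bounded below by compactness. Later this moves a lattice point that is nearly flat
  on a face to a nearby weight that is exactly flat on it.\<close>

lemma dist_to_annihilator:
  fixes W :: "'a::euclidean_space set"
  assumes "finite W"
  shows "\<exists>c>0. \<forall>x. \<exists>v. (\<forall>w\<in>W. w \<bullet> v = 0) \<and> c * norm (x - v) \<le> (\<Sum>w\<in>W. \<bar>w \<bullet> x\<bar>)"
proof -
  define L where "L = {v. \<forall>w\<in>W. w \<bullet> v = 0}"
  have L: "subspace L" by (auto simp: L_def subspace_def inner_add_right)
  define U where "U = sphere 0 1 \<inter> {u. \<forall>y\<in>L. y \<bullet> u = 0}"
  define f where "f u = (\<Sum>w\<in>W. \<bar>w \<bullet> u\<bar>)" for u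
  have "{u. \<forall>y\<in>L. y \<bullet> u = 0} = (\<Inter>y\<in>L. {u. y \<bullet> u = 0})" by auto
  then have "closed {u. \<forall>y\<in>L. y \<bullet> u = 0}" by (auto intro: closed_hyperplane)
  then have cU: "compact U" unfolding U_def by (intro compact_Int_closed) auto
  have cf: "continuous_on U f" unfolding f_def by (intro continuous_intros)
  have fpos: "f u > 0" if "u \<in> U" for u
  proof (rule ccontr)
    assume "\<not> f u > 0"
    then have "f u = 0" unfolding f_def by (metis abs_ge_zero antisym not_le sum_nonneg)
    then have "u \<in> L" unfolding f_def L_def using assms by (simp add: sum_nonneg_eq_0_iff)
    then have "u \<bullet> u = 0" using that by (auto simp: U_def)
    then show False using that by (auto simp: U_def)
  qed
  obtain c where c: "c > 0" "\<And>u. u \<in> U \<Longrightarrow> c \<le> f u"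
  proof (cases "U = {}")
    case True
    then show ?thesis using that[of 1] by auto
  next
    case False
    then obtain u0 where "u0 \<in> U" "\<forall>u\<in>U. f u0 \<le> f u"
      using continuous_attains_inf[OF cU _ cf] by blast
    then show ?thesis using that[of "f u0"] fpos by blast
  qed
  have "\<exists>v. (\<forall>w\<in>W. w \<bullet> v = 0) \<and> c * norm (x - v) \<le> (\<Sum>w\<in>W. \<bar>w \<bullet> x\<bar>)" for x
  proof -
    obtain v z where vz: "v \<in> span L" "\<And>y. y \<in> span L \<Longrightarrow> orthogonal z y" "x = v + z"
      using orthogonal_subspace_decomp_exists[of L x] by metis
    have v: "v \<in> L" using vz(1) L by (metis span_eq_iff)
    have fx: "(\<Sum>w\<in>W. \<bar>w \<bullet> x\<bar>) = f z"
      unfolding f_def vz(3) using v by (intro sum.cong) (auto simp: inner_add_right L_def)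
    have "c * norm z \<le> f z"
    proof (cases "z = 0")
      case False
      then have "(1 / norm z) *\<^sub>R z \<in> U"
        using vz(2) span_base by (auto simp: U_def orthogonal_def inner_commute)
      then have "c \<le> f ((1 / norm z) *\<^sub>R z)" by (rule c(2))
      also have "\<dots> = f z / norm z" by (simp add: f_def abs_mult sum_divide_distrib)
      finally show ?thesis using False by (simp add: pos_le_divide_eq)
    qed (simp add: f_def)
    then show ?thesis using v fx vz(3) by (intro exI[of _ v]) (auto simp: L_def)
  qed
  then show ?thesis using c(1) by blast
qed

lemma norm_le_spanning_functionals:
  fixes W :: "'a::euclidean_space set"
  assumes "finite W" "span W = UNIV"
  shows "\<exists>c>0. \<forall>x. c * norm x \<le> (\<Sum>w\<in>W. \<bar>w \<bullet> x\<bar>)"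
proof -
  obtain c where c: "c > 0" "\<And>x. \<exists>v. (\<forall>w\<in>W. w \<bullet> v = 0) \<and> c * norm (x - v) \<le> (\<Sum>w\<in>W. \<bar>w \<bullet> x\<bar>)"
    using dist_to_annihilator[OF assms(1)] by blast
  have "v = 0" if "\<forall>w\<in>W. w \<bullet> v = 0" for v
  proof -
    have "orthogonal v v" 
      by (rule orthogonal_to_span[of v W]) (use assms(2) that in \<open>auto simp: orthogonal_def inner_commute\<close>)
    then show ?thesis by (simp add: orthogonal_def)
  qed
  then show ?thesis using c by (metis diff_zero)
qed

lemma sum_geometric_int_le:
  fixes q :: real
  assumes "0 < q" "q < 1"
  shows "(\<Sum>y\<in>{-int m..int m}. q ^ nat \<bar>y\<bar>) \<le> 2 / (1 - q)"
proof -
  have "{-int m..int m} \<subseteq> int ` {..m} \<union> (\<lambda>i. - int i) ` {..m}"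
  proof
    fix y assume "y \<in> {-int m..int m}"
    then have "y = int (nat y) \<and> nat y \<le> m \<or> y = - int (nat (- y)) \<and> nat (- y) \<le> m" by auto
    then show "y \<in> int ` {..m} \<union> (\<lambda>i. - int i) ` {..m}" by blast
  qed
  then have "(\<Sum>y\<in>{-int m..int m}. q ^ nat \<bar>y\<bar>)
      \<le> (\<Sum>y\<in>int ` {..m} \<union> (\<lambda>i. - int i) ` {..m}. q ^ nat \<bar>y\<bar>)"
    using assms by (intro sum_mono2) auto
  also have "\<dots> \<le> (\<Sum>y\<in>int ` {..m}. q ^ nat \<bar>y\<bar>) + (\<Sum>y\<in>(\<lambda>i. - int i) ` {..m}. q ^ nat \<bar>y\<bar>)"
    using assms by (simp add: sum_Un sum_nonneg)
  also have "\<dots> = 2 * (\<Sum>i\<le>m. q ^ i)"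
    by (simp add: sum.reindex inj_on_def)
  also have "\<dots> \<le> 2 * (1 / (1 - q))"
    using assms by (intro mult_left_mono) (auto simp: sum_gp0 divide_right_mono)
  finally show ?thesis by simp
qed

lemma sum_group_le:
  fixes F :: "'b \<Rightarrow> real"
  assumes "finite A" "finite Y" "\<Psi> ` A \<subseteq> Y" "\<And>y. y \<in> Y \<Longrightarrow> 0 \<le> F y"
    and "\<And>y. card {x\<in>A. \<Psi> x = y} \<le> K"
  shows "(\<Sum>x\<in>A. F (\<Psi> x)) \<le> real K * (\<Sum>y\<in>Y. F y)"
proof -
  have "(\<Sum>x\<in>A. F (\<Psi> x)) = (\<Sum>y\<in>\<Psi> ` A. \<Sum>x\<in>{x\<in>A. \<Psi> x = y}. F (\<Psi> x))"
    by (rule sum.image_gen[OF assms(1)])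
  also have "\<dots> = (\<Sum>y\<in>\<Psi> ` A. real (card {x\<in>A. \<Psi> x = y}) * F y)" by simp
  also have "\<dots> \<le> (\<Sum>y\<in>\<Psi> ` A. real K * F y)"
    using assms by (intro sum_mono mult_right_mono) auto
  also have "\<dots> \<le> (\<Sum>y\<in>Y. real K * F y)" using assms by (intro sum_mono2) auto
  finally show ?thesis by (simp add: sum_distrib_left)
qed

lemma norm_exponent_point_le:
  "norm (exponent_point \<alpha> :: real^'n::finite) \<le> real (mdeg \<alpha>)"
  using norm_le_l1_cart[of "exponent_point \<alpha> :: real^'n"]
  by (simp add: exponent_point_def mdeg_def)

text \<open>Extend \<open>W\<close> to a basis. The integer parts of the basis functionals determine
  j up to boundedly many choices. In the directions of \<open>W\<close> the sum is geometric,
  uniformly in the shifts b; each of the other directions takes O(1 + R) values.\<close>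

lemma sum_exp_functionals:
  fixes W :: "(real^'n::finite) set"
  assumes W: "independent W" and c: "c > 0"
  shows "\<exists>K. \<forall>b R. (\<Sum>j\<in>mbox R. 2 powr (- (c * (\<Sum>w\<in>W. \<bar>w \<bullet> exponent_point j - b w\<bar>))))
    \<le> K * (1 + real R) ^ (CARD('n) - card W)"
proof -
  obtain B where B: "W \<subseteq> B" "independent B" "UNIV \<subseteq> span B"
    by (rule maximal_independent_subset_extend[OF subset_UNIV W])
  have fB: "finite B" using B(2) by (rule independent_imp_finite)
  have fW: "finite W" using B(1) fB by (rule finite_subset)
  have cardB: "card B = CARD('n)" using basis_card_eq_dim[OF subset_UNIV B(3,2)] by simp
  obtain c1 where c1: "c1 > 0" "\<And>x. c1 * norm x \<le> (\<Sum>w\<in>B. \<bar>w \<bullet> x\<bar>)"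
    using norm_le_spanning_functionals[OF fB top.extremum_uniqueI[OF B(3)]] by blast
  obtain M where M: "real CARD('n) / c1 \<le> real M" using real_arch_simple by blast
  obtain D where D: "(\<Sum>w\<in>B. norm w) * real CARD('n) \<le> real D" using real_arch_simple by blast
  define q where "q = 2 powr (- c)"
  have q: "0 < q" "q < 1" using c by (auto simp: q_def powr_less_one)
  define C0 where "C0 = (2 * M + 1) ^ CARD('n)"
  define K where "K = real C0 * ((2 powr c * (2 / (1 - q))) ^ card W * real (2 * D + 3) ^ (CARD('n) - card W))"
  have "(\<Sum>j\<in>mbox R. 2 powr (- (c * (\<Sum>w\<in>W. \<bar>w \<bullet> exponent_point j - b w\<bar>))))
    \<le> K * (1 + real R) ^ (CARD('n) - card W)" for b R
  proof -
    define b' where "b' w = (if w \<in> W then b w else 0)" for w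
    define \<Psi> where "\<Psi> j = (\<lambda>w\<in>B. \<lfloor>w \<bullet> exponent_point j - b' w\<rfloor>)" for j :: "'n \<Rightarrow> nat"
    \<comment> \<open>The factor 2 powr c pays for the replacement of a functional by its integer
      part.\<close>
    define g where "g w y = (if w \<in> W then 2 powr c * q ^ nat \<bar>y\<bar> else 1)" for w :: "real^'n" and y :: int
    have g0: "0 \<le> g w y" for w y using q by (simp add: g_def)
    have fin: "finite ((\<lambda>j. \<bar>\<Psi> j w\<bar>) ` mbox R)" for w by (intro finite_imageI finite_mbox)
    define m where "m w = nat (Max (insert 0 ((\<lambda>j. \<bar>\<Psi> j w\<bar>) ` mbox R)))" for w
    have m: "\<bar>\<Psi> j w\<bar> \<le> int (m w)" if "j \<in> mbox R" for j w
    proof -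
      have "\<bar>\<Psi> j w\<bar> \<le> Max (insert 0 ((\<lambda>j. \<bar>\<Psi> j w\<bar>) ` mbox R))"
        using that fin by (intro Max_ge) auto
      then show ?thesis unfolding m_def by linarith
    qed
    \<comment> \<open>For w in \<open>W\<close> any finite range will do, because the geometric
      bound does not depend on it. Otherwise the range has 2 D R + 3 elements.\<close>
    define Yw where "Yw w = (if w \<in> W then {- int (m w)..int (m w)} else {- int (D * R + 1)..int (D * R + 1)})" for w
    define Y where "Y = PiE B Yw"
    have fY: "finite Y" unfolding Y_def using fB by (intro finite_PiE) (auto simp: Yw_def)
    have \<Psi>Y: "\<Psi> ` mbox R \<subseteq> Y"
    proof
      fix y assume "y \<in> \<Psi> ` mbox R"
      then obtain j where j: "j \<in> mbox R" "y = \<Psi> j" by blast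
      have "\<Psi> j w \<in> Yw w" if w: "w \<in> B" for w
      proof (cases "w \<in> W")
        case True
        then show ?thesis using m[OF j(1), of w] by (auto simp: Yw_def abs_le_iff)
      next
        case False
        have "mdeg j \<le> (\<Sum>i\<in>(UNIV::'n set). R)"
          unfolding mdeg_def using j(1) by (intro sum_mono) (auto simp: mbox_def)
        then have jn: "norm (exponent_point j :: real^'n) \<le> real CARD('n) * real R"
          using norm_exponent_point_le[of j] by (simp flip: of_nat_mult)
        have "\<bar>w \<bullet> exponent_point j\<bar> \<le> norm w * norm (exponent_point j :: real^'n)"
          by (rule Cauchy_Schwarz_ineq2)
        also have "\<dots> \<le> (\<Sum>w\<in>B. norm w) * (real CARD('n) * real R)"
          using w fB jn by (intro mult_mono member_le_sum sum_nonneg) auto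
        also have "\<dots> \<le> real D * real R"
          using mult_right_mono[OF D, of "real R"] by (simp add: mult.assoc)
        finally have "\<bar>w \<bullet> exponent_point j\<bar> \<le> real (D * R)" by simp
        then have "\<bar>\<lfloor>w \<bullet> exponent_point j\<rfloor>\<bar> \<le> int (D * R + 1)" by linarith
        then show ?thesis using False w by (auto simp: Yw_def \<Psi>_def b'_def abs_le_iff)
      qed
      then show "y \<in> Y" unfolding j(2) Y_def by (auto simp: \<Psi>_def)
    qed
    have fibre: "card {j\<in>mbox R. \<Psi> j = y} \<le> C0" for y
    proof (cases "{j\<in>mbox R. \<Psi> j = y} = {}")
      case False
      then obtain j0 where j0: "j0 \<in> mbox R" "\<Psi> j0 = y" by blast
      have "{j\<in>mbox R. \<Psi> j = y} \<subseteq> (\<Pi>\<^sub>E i\<in>UNIV. {j0 i - M..j0 i + M})"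
      proof
        fix j assume j: "j \<in> {j\<in>mbox R. \<Psi> j = y}"
        let ?x = "exponent_point j - exponent_point j0 :: real^'n"
        have "\<bar>w \<bullet> ?x\<bar> \<le> 1" if w: "w \<in> B" for w
        proof -
          have "\<lfloor>w \<bullet> exponent_point j - b' w\<rfloor> = \<lfloor>w \<bullet> exponent_point j0 - b' w\<rfloor>"
          proof -
            have "\<Psi> j w = \<Psi> j0 w" using j j0 by simp
            then show ?thesis using w by (simp add: \<Psi>_def)
          qed
          then show ?thesis unfolding inner_diff_right by linarith
        qed
        then have "(\<Sum>w\<in>B. \<bar>w \<bullet> ?x\<bar>) \<le> (\<Sum>w\<in>B. 1)" by (intro sum_mono) auto
        then have "c1 * norm ?x \<le> real CARD('n)" using c1(2)[of ?x] cardB by simp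
        then have "norm ?x \<le> real CARD('n) / c1" using c1(1) by (simp add: pos_le_divide_eq mult.commute)
        then have "norm ?x \<le> real M" using M by linarith
        then have "\<bar>?x $ i\<bar> \<le> real M" for i using component_le_norm_cart[of ?x i] by linarith
        then have "\<bar>real (j i) - real (j0 i)\<bar> \<le> real M" for i by (simp add: exponent_point_def)
        then have "j i \<in> {j0 i - M..j0 i + M}" for i
          unfolding abs_le_iff by (auto simp: le_diff_conv) (metis of_nat_add of_nat_le_iff add.commute diff_le_eq minus_diff_eq)+
        then show "j \<in> (\<Pi>\<^sub>E i\<in>UNIV. {j0 i - M..j0 i + M})" by (intro PiE_I) simp_all
      qed
      then have "card {j\<in>mbox R. \<Psi> j = y} \<le> card (\<Pi>\<^sub>E i\<in>UNIV. {j0 i - M..j0 i + M})"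
        by (intro card_mono finite_PiE) auto
      also have "\<dots> = (\<Prod>i\<in>UNIV. card {j0 i - M..j0 i + M})" by (simp add: card_PiE)
      also have "\<dots> \<le> (\<Prod>i\<in>(UNIV::'n set). 2 * M + 1)" by (intro prod_mono) auto
      finally show ?thesis by (simp add: C0_def)
    next
      case True
      then show ?thesis by (simp only: card.empty)
    qed
    have term_le: "2 powr (- (c * (\<Sum>w\<in>W. \<bar>w \<bullet> exponent_point j - b w\<bar>))) \<le> (\<Prod>w\<in>B. g w (\<Psi> j w))" for j
    proof -
      have "2 powr (- (c * (\<Sum>w\<in>W. \<bar>w \<bullet> exponent_point j - b w\<bar>)))
          = (\<Prod>w\<in>W. 2 powr (- c * \<bar>w \<bullet> exponent_point j - b w\<bar>))"
        using fW by (simp add: powr_sum sum_distrib_left sum_negf[symmetric])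
      also have "\<dots> \<le> (\<Prod>w\<in>W. g w (\<Psi> j w))"
      proof (rule prod_mono, safe)
        fix w assume w: "w \<in> W"
        let ?x = "w \<bullet> exponent_point j - b w"
        have \<Psi>w: "\<Psi> j w = \<lfloor>?x\<rfloor>" using w B(1) by (auto simp: \<Psi>_def b'_def)
        have "real (nat \<bar>\<lfloor>?x\<rfloor>\<bar>) - 1 \<le> \<bar>?x\<bar>" by linarith
        then have "- c * \<bar>?x\<bar> \<le> - c * (real (nat \<bar>\<lfloor>?x\<rfloor>\<bar>) - 1)" using c by simp
        then have "2 powr (- c * \<bar>?x\<bar>) \<le> 2 powr (- c * (real (nat \<bar>\<lfloor>?x\<rfloor>\<bar>) - 1))" by simp
        also have "\<dots> = 2 powr c * q ^ nat \<bar>\<lfloor>?x\<rfloor>\<bar>"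
          unfolding q_def by (simp add: powr_power powr_add[symmetric] algebra_simps)
        finally show "2 powr (- c * \<bar>?x\<bar>) \<le> g w (\<Psi> j w)" using w \<Psi>w by (simp add: g_def)
      qed simp
      also have "\<dots> = (\<Prod>w\<in>B. g w (\<Psi> j w))"
        using B(1) fB by (intro prod.mono_neutral_left) (auto simp: g_def)
      finally show ?thesis .
    qed
    have "(\<Sum>y\<in>Y. \<Prod>w\<in>B. g w (y w)) = (\<Prod>w\<in>B. \<Sum>y\<in>Yw w. g w y)"
      unfolding Y_def by (rule prod_sum_PiE[symmetric]) (use fB in \<open>auto simp: Yw_def\<close>)
    also have "\<dots> \<le> (\<Prod>w\<in>B. if w \<in> W then 2 powr c * (2 / (1 - q)) else real (2 * D + 3) * (1 + real R))"
    proof (rule prod_mono, safe)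
      fix w assume "w \<in> B"
      show "(\<Sum>y\<in>Yw w. g w y) \<le> (if w \<in> W then 2 powr c * (2 / (1 - q)) else real (2 * D + 3) * (1 + real R))"
      proof (cases "w \<in> W")
        case True
        then have "(\<Sum>y\<in>Yw w. g w y) = 2 powr c * (\<Sum>y\<in>{- int (m w)..int (m w)}. q ^ nat \<bar>y\<bar>)"
          by (simp add: g_def Yw_def sum_distrib_left)
        also have "\<dots> \<le> 2 powr c * (2 / (1 - q))"
          by (intro mult_left_mono sum_geometric_int_le[OF q]) simp
        finally show ?thesis using True by simp
      next
        case False
        have "(\<Sum>y\<in>Yw w. g w y) = 2 * (D * R) + 3" using False by (simp add: g_def Yw_def)
        also have "\<dots> \<le> real (2 * D + 3) * (1 + real R)" by (simp add: algebra_simps)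
        finally show ?thesis using False by simp
      qed
    qed (intro sum_nonneg g0)
    also have "\<dots> = (2 powr c * (2 / (1 - q))) ^ card W * (real (2 * D + 3) * (1 + real R)) ^ (CARD('n) - card W)"
    proof -
      have "B \<inter> {w. w \<in> W} = W" "B \<inter> - {w. w \<in> W} = B - W" using B(1) by auto
      moreover have "card (B - W) = CARD('n) - card W" using B(1) fW cardB by (simp add: card_Diff_subset)
      ultimately show ?thesis using fB by (simp add: prod.If_cases)
    qed
    finally have Ysum: "(\<Sum>y\<in>Y. \<Prod>w\<in>B. g w (y w))
        \<le> (2 powr c * (2 / (1 - q))) ^ card W * (real (2 * D + 3) * (1 + real R)) ^ (CARD('n) - card W)" .
    have "(\<Sum>j\<in>mbox R. 2 powr (- (c * (\<Sum>w\<in>W. \<bar>w \<bullet> exponent_point j - b w\<bar>))))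
        \<le> (\<Sum>j\<in>mbox R. \<Prod>w\<in>B. g w (\<Psi> j w))" by (intro sum_mono term_le)
    also have "\<dots> \<le> real C0 * (\<Sum>y\<in>Y. \<Prod>w\<in>B. g w (y w))"
      by (rule sum_group_le[OF finite_mbox fY \<Psi>Y _ fibre]) (intro prod_nonneg g0 ballI)
    also have "\<dots> \<le> real C0 * ((2 powr c * (2 / (1 - q))) ^ card W
        * (real (2 * D + 3) * (1 + real R)) ^ (CARD('n) - card W))"
      by (intro mult_left_mono Ysum) simp
    also have "\<dots> = K * (1 + real R) ^ (CARD('n) - card W)"
      by (simp only: K_def power_mult_distrib mult.assoc)
    finally show ?thesis .
  qed
  then show ?thesis by blast
qed

section \<open>Dyadic pieces\<close>

definition annulus :: "real \<Rightarrow> (real^'n::finite) set" where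
  "annulus M = {y. \<forall>i. 1 / M \<le> \<bar>y $ i\<bar> \<and> \<bar>y $ i\<bar> \<le> M}"

lemma compact_annulus: "compact (annulus M :: (real^'n::finite) set)"
proof -
  have "annulus M = cube M \<inter> (\<Inter>i. {y::real^'n. 1 / M \<le> \<bar>y $ i\<bar>})"
    by (auto simp: annulus_def cube_def)
  moreover have "closed {y::real^'n. 1 / M \<le> \<bar>y $ i\<bar>}" for i
    by (intro closed_Collect_le continuous_intros)
  ultimately show ?thesis using compact_cube[of M] by (auto intro!: compact_Int_closed closed_INT)
qed

text \<open>All sign patterns are included. Neighbouring boxes share boundary points, which is
  harmless for upper bounds; the lower bound uses the disjoint \<open>pos_box\<close>
  instead.\<close>

definition dyadic_box :: "('n::finite \<Rightarrow> nat) \<Rightarrow> (real^'n) set" where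
  "dyadic_box j = {x. \<forall>i. 2 powr (- real (j i)) \<le> \<bar>x $ i\<bar> \<and> \<bar>x $ i\<bar> \<le> 2 powr (1 - real (j i))}"

lemma compact_dyadic_box: "compact (dyadic_box j :: (real^'n::finite) set)"
proof -
  have "dyadic_box j = (\<Inter>i. {y::real^'n. 2 powr (- real (j i)) \<le> \<bar>y $ i\<bar>})
      \<inter> (\<Inter>i. {y::real^'n. \<bar>y $ i\<bar> \<le> 2 powr (1 - real (j i))})"
    by (auto simp: dyadic_box_def)
  moreover have "closed {y::real^'n. c \<le> \<bar>y $ i\<bar>}" "closed {y::real^'n. \<bar>y $ i\<bar> \<le> c}" for i c
    by (intro closed_Collect_le continuous_intros)+
  ultimately have "closed (dyadic_box j :: (real^'n) set)" by (auto intro!: closed_Int closed_INT)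
  moreover have "dyadic_box j \<subseteq> (cube 2 :: (real^'n) set)"
  proof
    fix x :: "real^'n" assume x: "x \<in> dyadic_box j"
    have "\<bar>x $ i\<bar> \<le> 2" for i
    proof -
      have "\<bar>x $ i\<bar> \<le> 2 powr (1 - real (j i))" using x by (simp add: dyadic_box_def)
      also have "\<dots> \<le> 2 powr 1" by (intro powr_mono) auto
      finally show ?thesis by simp
    qed
    then show "x \<in> cube 2" by (simp add: cube_def)
  qed
  ultimately show ?thesis using compact_cube[of 2] by (metis bounded_subset compact_eq_bounded_closed)
qed

text \<open>Real exponents are needed, because the weight to which a lattice point is moved need not
  be integral.\<close>

definition rescale :: "real^'n::finite \<Rightarrow> real^'n \<Rightarrow> real^'n" where
  "rescale u y = (\<chi> i. 2 powr (- (u $ i)) * y $ i)"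

lemma mpow_rescale: "mpow (rescale u y) \<alpha> = 2 powr (- (u \<bullet> exponent_point \<alpha>)) * mpow y \<alpha>"
proof -
  have "mpow (rescale u y) \<alpha> = (\<Prod>i\<in>UNIV. 2 powr (- (u $ i * real (\<alpha> i)))) * mpow y \<alpha>"
    by (simp add: mpow_def rescale_def power_mult_distrib prod.distrib powr_power mult.commute)
  also have "(\<Prod>i\<in>UNIV. 2 powr (- (u $ i * real (\<alpha> i)))) = (2::real) powr (\<Sum>i\<in>UNIV. - (u $ i * real (\<alpha> i)))"
    by (simp add: powr_sum)
  finally show ?thesis by (simp add: inner_vec_real exponent_point_def sum_negf)
qed

section \<open>The measure of the sublevel set in a single dyadic box\<close>

locale germ = newton s for s :: "('n::finite \<Rightarrow> nat) \<Rightarrow> real" +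
  fixes S :: "real^'n \<Rightarrow> real" and r1 :: real
  assumes r1: "0 < r1" "r1 < 1"
    and s_summable: "(\<lambda>\<alpha>. \<bar>s \<alpha>\<bar> * r1 ^ mdeg \<alpha>) summable_on UNIV"
    and S_sum: "\<And>x. x \<in> cube r1 \<Longrightarrow> ((\<lambda>\<alpha>. s \<alpha> * mpow x \<alpha>) has_sum S x) UNIV"
begin

lemma S_continuous: "continuous_on (cube r1) S"
proof (rule uniform_limit_theorem)
  show "uniform_limit (cube r1) (\<lambda>X y. \<Sum>\<alpha>\<in>X. s \<alpha> * mpow y \<alpha>) S (finite_subsets_at_top UNIV)"
  proof (rule Weierstrass_m_test_general'[OF _ S_sum s_summable])
    fix \<alpha> and y :: "real^'n" assume "y \<in> cube r1"
    then have "\<bar>mpow y \<alpha>\<bar> \<le> r1 ^ mdeg \<alpha>" by (intro abs_mpow_le) (simp add: cube_def)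
    then show "norm (s \<alpha> * mpow y \<alpha>) \<le> \<bar>s \<alpha>\<bar> * r1 ^ mdeg \<alpha>"
      by (simp add: abs_mult mult_left_mono)
  qed
  show "\<forall>\<^sub>F X in finite_subsets_at_top UNIV. continuous_on (cube r1) (\<lambda>y. \<Sum>\<alpha>\<in>X. s \<alpha> * mpow y \<alpha>)"
    by (intro always_eventually allI continuous_intros)
qed simp

definition dyadic_piece :: "('n \<Rightarrow> nat) \<Rightarrow> real \<Rightarrow> (real^'n) set" where
  "dyadic_piece j \<epsilon> = {x\<in>dyadic_box j. \<bar>S x\<bar> < \<epsilon>}"

definition piece_bound :: "real \<Rightarrow> real \<Rightarrow> ('n \<Rightarrow> nat) \<Rightarrow> bool" where
  "piece_bound D c j \<longleftrightarrow> (\<forall>\<epsilon>>0. measure lebesgue (dyadic_piece j \<epsilon>)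
     \<le> c * (2 powr (- real (mdeg j)) * (\<epsilon> * 2 powr mval (pt j)) powr (1 / D)))"

lemma piece_bound_mono: "piece_bound D c j \<Longrightarrow> c \<le> c' \<Longrightarrow> piece_bound D c' j"
  unfolding piece_bound_def by (meson mult_right_mono mult_nonneg_nonneg order_trans powr_ge_zero)

text \<open>\<open>A\<close> consists of all minimal exponents on the face exposed by
  \<open>u\<close>. Strict positivity of \<open>u\<close> makes that face compact.\<close>

definition exact_face :: "('n \<Rightarrow> nat) set \<Rightarrow> real^'n \<Rightarrow> bool" where
  "exact_face A u \<longleftrightarrow> A \<subseteq> G \<and> (\<forall>i. u $ i > 0) \<and>
     (\<exists>V. (\<forall>\<alpha>\<in>A. u \<bullet> pt \<alpha> = V) \<and> (\<forall>\<alpha>\<in>G - A. u \<bullet> pt \<alpha> > V))"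

definition face_poly :: "('n \<Rightarrow> nat) set \<Rightarrow> real^'n \<Rightarrow> real" where
  "face_poly A x = (\<Sum>\<alpha>\<in>A. s \<alpha> * mpow x \<alpha>)"

text \<open>Points where the polynomial does not vanish are included; there the empty list is a
  witness.\<close>

definition low_order :: "real \<Rightarrow> ('n \<Rightarrow> nat) set \<Rightarrow> bool" where
  "low_order D A \<longleftrightarrow> (\<forall>p. (\<forall>i. p $ i \<noteq> 0) \<longrightarrow>
     (\<exists>js. partial_derivs js (face_poly A) p \<noteq> 0 \<and> real (length js) \<le> D))"

text \<open>After rescaling, the exponents in \<open>A\<close> keep their coefficients exactly.
  Those in \<open>G - A\<close> are damped by the gap \<Lambda>. Any other exponent lies strictly
  above a minimal one and is damped by 2^(-J) for every additional degree, which is compared with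
  the convergence at \<open>r1\<close>.\<close>

lemma near_face_poly:
  assumes A: "A \<subseteq> G" and R: "R \<ge> 1" and \<eta>: "\<eta> > 0"
  shows "\<exists>J \<Lambda>. J > 0 \<and> (\<forall>u V. (\<forall>i. J \<le> u $ i) \<and> (\<forall>\<alpha>\<in>A. u \<bullet> pt \<alpha> = V) \<and>
    (\<forall>\<alpha>\<in>G - A. V + \<Lambda> \<le> u \<bullet> pt \<alpha>) \<and> (\<forall>\<alpha>\<in>G. V \<le> u \<bullet> pt \<alpha>) \<longrightarrow>
    (\<forall>y\<in>cube R. rescale u y \<in> cube r1) \<and>
    near_poly R (face_poly A) \<eta> (\<lambda>y. 2 powr V * S (rescale u y)))"
proof -
  have fA: "finite A" using A G_finite by (rule finite_subset)
  define B1 where "B1 = (\<Sum>\<alpha>\<in>G. \<bar>s \<alpha>\<bar> * R ^ mdeg \<alpha>)"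
  obtain B2 where B2: "((\<lambda>\<alpha>. \<bar>s \<alpha>\<bar> * r1 ^ mdeg \<alpha>) has_sum B2) UNIV"
    using s_summable by (auto simp: summable_on_def)
  have B0: "B1 \<ge> 0" "B2 \<ge> 0"
    unfolding B1_def using R r1 by (auto intro!: sum_nonneg has_sum_nonneg[OF B2])
  define l1 where "l1 = \<eta> / (2 * (B1 + 1))"
  define l2 where "l2 = \<eta> / (2 * (B2 + 1))"
  have l: "l1 > 0" "l2 > 0" using \<eta> B0 by (auto simp: l1_def l2_def)
  have lB: "l1 * B1 \<le> \<eta> / 2" "l2 * B2 \<le> \<eta> / 2"
    using \<eta> B0 by (auto simp: l1_def l2_def field_simps)
  define Dg where "Dg = (\<Sum>g\<in>G. mdeg g)"
  have Dg: "mdeg g \<le> Dg" if "g \<in> G" for g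
    unfolding Dg_def using that G_finite by (intro member_le_sum) auto
  \<comment> \<open>At least one additional degree is present, so a single factor \<theta> is
    available; it absorbs the quotient of R ^ Dg and r1 ^ Dg.\<close>
  define \<theta> where "\<theta> = min 1 (l2 * r1 ^ Dg / R ^ Dg)"
  have \<theta>: "0 < \<theta>" "\<theta> \<le> 1" "\<theta> * R ^ Dg \<le> l2 * r1 ^ Dg"
    using l r1 R by (auto simp: \<theta>_def min_def field_simps)
  define J where "J = max 1 (log 2 (R / (r1 * \<theta>)))"
  have J0: "J > 0" by (simp add: J_def)
  have JR: "2 powr (- J) * R \<le> r1 * \<theta>"
  proof -
    have "R / (r1 * \<theta>) = 2 powr (log 2 (R / (r1 * \<theta>)))" using R r1 \<theta> by simp
    also have "\<dots> \<le> 2 powr J" by (intro powr_mono) (auto simp: J_def)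
    finally show ?thesis using r1 \<theta> by (simp add: powr_minus field_simps)
  qed
  define \<Lambda> where "\<Lambda> = - log 2 l1"
  have "(\<forall>y\<in>cube R. rescale u y \<in> cube r1) \<and>
      near_poly R (face_poly A) \<eta> (\<lambda>y. 2 powr V * S (rescale u y))"
    if u: "\<And>i. J \<le> u $ i" and V: "\<And>\<alpha>. \<alpha> \<in> A \<Longrightarrow> u \<bullet> pt \<alpha> = V"
      and gap: "\<And>\<alpha>. \<alpha> \<in> G - A \<Longrightarrow> V + \<Lambda> \<le> u \<bullet> pt \<alpha>" and min: "\<And>\<alpha>. \<alpha> \<in> G \<Longrightarrow> V \<le> u \<bullet> pt \<alpha>"
    for u V
  proof
    show resc: "\<forall>y\<in>cube R. rescale u y \<in> cube r1"
    proof
      fix y :: "real^'n" assume y: "y \<in> cube R"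
      have "\<bar>rescale u y $ i\<bar> \<le> r1" for i
      proof -
        have "\<bar>rescale u y $ i\<bar> = 2 powr (- (u $ i)) * \<bar>y $ i\<bar>" by (simp add: rescale_def abs_mult)
        also have "\<dots> \<le> 2 powr (- J) * R" using u[of i] y by (intro mult_mono powr_mono) (auto simp: cube_def)
        also have "\<dots> \<le> r1 * \<theta>" by (rule JR)
        also have "\<dots> \<le> r1" using r1 \<theta> by (simp add: mult_left_le)
        finally show ?thesis .
      qed
      then show "rescale u y \<in> cube r1" by (simp add: cube_def)
    qed
    define c where "c \<alpha> = s \<alpha> * 2 powr (V - u \<bullet> pt \<alpha>)" for \<alpha>
    define e where "e \<alpha> = (if \<alpha> \<in> A then 0 else c \<alpha>)" for \<alpha>
    \<comment> \<open>The first summand is for \<open>G - A\<close>, the second for the exponents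
      outside \<open>G\<close>; each accounts for half of \<eta>.\<close>
    define bnd where "bnd \<alpha> = l1 * (if \<alpha> \<in> G then \<bar>s \<alpha>\<bar> * R ^ mdeg \<alpha> else 0) + l2 * (\<bar>s \<alpha>\<bar> * r1 ^ mdeg \<alpha>)" for \<alpha>
    have bnd_sum: "(bnd has_sum (l1 * B1 + l2 * B2)) UNIV"
      unfolding bnd_def B1_def
      by (intro has_sum_add has_sum_cmult_right B2 has_sum_finite_neutralI[OF G_finite]) auto
    have e_bnd: "\<bar>e \<alpha>\<bar> * R ^ mdeg \<alpha> \<le> bnd \<alpha>" for \<alpha>
    proof -
      have nn: "0 \<le> l2 * (\<bar>s \<alpha>\<bar> * r1 ^ mdeg \<alpha>)" "0 \<le> l1 * (\<bar>s \<alpha>\<bar> * R ^ mdeg \<alpha>)" using l r1 R by auto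
      consider "\<alpha> \<in> A \<or> s \<alpha> = 0" | "\<alpha> \<in> G - A" | "\<alpha> \<in> msupp s - G" by (auto simp: msupp_def)
      then show ?thesis
      proof cases
        case 1
        then have "e \<alpha> = 0" by (auto simp: e_def c_def)
        then show ?thesis using nn by (simp add: bnd_def)
      next
        case 2
        have "2 powr (V - u \<bullet> pt \<alpha>) \<le> 2 powr (- \<Lambda>)" using gap[OF 2] by (intro powr_mono) auto
        also have "\<dots> = l1" using l by (simp add: \<Lambda>_def)
        finally have "2 powr (V - u \<bullet> pt \<alpha>) * \<bar>s \<alpha>\<bar> \<le> l1 * \<bar>s \<alpha>\<bar>" by (rule mult_right_mono) simp
        then have "\<bar>e \<alpha>\<bar> \<le> l1 * \<bar>s \<alpha>\<bar>"
          using 2 by (simp add: e_def c_def abs_mult mult.commute)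
        then have "\<bar>e \<alpha>\<bar> * R ^ mdeg \<alpha> \<le> l1 * \<bar>s \<alpha>\<bar> * R ^ mdeg \<alpha>" using R by (intro mult_right_mono) auto
        then show ?thesis using 2 nn by (simp add: bnd_def)
      next
        case 3
        obtain g where g: "g \<in> G" "g \<le> \<alpha>" using ex_minimal_exponent_le[of \<alpha> s] 3 by blast
        then have lt: "mdeg g < mdeg \<alpha>" using 3 by (intro mdeg_strict_mono) auto
        define l where "l = mdeg \<alpha> - mdeg g"
        have l: "mdeg \<alpha> = mdeg g + l" "l > 0" using lt by (auto simp: l_def)
        have rl: "real (mdeg \<alpha>) - real (mdeg g) = real l" using l by simp
        have "J * real l = (\<Sum>i\<in>UNIV. J * (real (\<alpha> i) - real (g i)))"
          unfolding rl[symmetric] mdeg_def by (simp add: sum_distrib_left sum_subtractf right_diff_distrib)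
        also have "\<dots> \<le> (\<Sum>i\<in>UNIV. u $ i * (real (\<alpha> i) - real (g i)))"
          using u g(2) by (intro sum_mono mult_right_mono) (auto simp: le_fun_def)
        also have "\<dots> = u \<bullet> pt \<alpha> - u \<bullet> pt g"
          by (simp add: inner_vec_real exponent_point_def sum_subtractf right_diff_distrib)
        finally have "V - u \<bullet> pt \<alpha> \<le> - J * real l" using min[OF g(1)] by simp
        then have "2 powr (V - u \<bullet> pt \<alpha>) \<le> 2 powr (- J * real l)" by (intro powr_mono) auto
        also have "\<dots> = (2 powr (- J)) ^ l" by (simp add: powr_power mult.commute)
        finally have "2 powr (V - u \<bullet> pt \<alpha>) * R ^ mdeg \<alpha> \<le> (2 powr (- J)) ^ l * R ^ mdeg \<alpha>"
          using R by (intro mult_right_mono) auto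
        also have "\<dots> = R ^ mdeg g * (2 powr (- J) * R) ^ l"
          by (simp add: l(1) power_add power_mult_distrib)
        also have "\<dots> \<le> R ^ Dg * (r1 * \<theta>) ^ l"
          by (rule mult_mono[OF power_increasing[OF Dg[OF g(1)] R] power_mono[OF JR]]) (use R in auto)
        also have "\<dots> = R ^ Dg * \<theta> ^ l * r1 ^ l" by (simp add: power_mult_distrib)
        also have "\<dots> \<le> R ^ Dg * \<theta> * r1 ^ l"
          using \<theta> R r1 power_decreasing[of 1 l \<theta>] l(2) by (intro mult_right_mono mult_left_mono) auto
        also have "\<dots> \<le> l2 * r1 ^ Dg * r1 ^ l"
          using \<theta>(3) r1 by (intro mult_right_mono) (auto simp: mult.commute)
        also have "\<dots> \<le> l2 * r1 ^ mdeg \<alpha>"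
          using Dg[OF g(1)] r1 \<open>l2 > 0\<close>
          by (simp add: l(1) power_add mult.assoc mult_right_mono power_decreasing)
        finally have "\<bar>s \<alpha>\<bar> * (2 powr (V - u \<bullet> pt \<alpha>) * R ^ mdeg \<alpha>) \<le> \<bar>s \<alpha>\<bar> * (l2 * r1 ^ mdeg \<alpha>)"
          by (intro mult_left_mono) auto
        moreover have "\<alpha> \<notin> A" "\<alpha> \<notin> G" using 3 A by auto
        ultimately show ?thesis by (simp add: e_def c_def bnd_def abs_mult mult.assoc mult.left_commute)
      qed
    qed
    have e_summ: "(\<lambda>\<alpha>. \<bar>e \<alpha>\<bar> * R ^ mdeg \<alpha>) summable_on UNIV"
      by (rule summable_on_comparison_test[OF has_sum_imp_summable[OF bnd_sum]]) (use e_bnd R in auto)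
    define \<sigma> where "\<sigma> = infsum (\<lambda>\<alpha>. \<bar>e \<alpha>\<bar> * R ^ mdeg \<alpha>) UNIV"
    have e_sum: "((\<lambda>\<alpha>. \<bar>e \<alpha>\<bar> * R ^ mdeg \<alpha>) has_sum \<sigma>) UNIV"
      unfolding \<sigma>_def using e_summ by (rule has_sum_infsum)
    have "\<sigma> \<le> l1 * B1 + l2 * B2" by (rule has_sum_mono[OF e_sum bnd_sum]) (rule e_bnd)
    then have \<sigma>: "\<sigma> \<le> \<eta>" using lB by linarith
    have c_sum: "((\<lambda>\<alpha>. c \<alpha> * mpow y \<alpha>) has_sum 2 powr V * S (rescale u y)) UNIV" if y: "y \<in> cube R" for y
    proof -
      have "((\<lambda>\<alpha>. 2 powr V * (s \<alpha> * mpow (rescale u y) \<alpha>)) has_sum 2 powr V * S (rescale u y)) UNIV"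
        using resc y by (intro has_sum_cmult_right S_sum) auto
      moreover have "2 powr V * (s \<alpha> * mpow (rescale u y) \<alpha>) = c \<alpha> * mpow y \<alpha>" for \<alpha>
        by (simp add: mpow_rescale c_def powr_diff powr_minus divide_inverse mult_ac)
      ultimately show ?thesis by simp
    qed
    have A_sum: "((\<lambda>\<alpha>. if \<alpha> \<in> A then c \<alpha> * mpow y \<alpha> else 0) has_sum face_poly A y) UNIV" for y
    proof (rule has_sum_finite_neutralI[OF fA])
      have "c \<alpha> = s \<alpha>" if "\<alpha> \<in> A" for \<alpha> using V[OF that] by (simp add: c_def)
      then show "face_poly A y = (\<Sum>\<alpha>\<in>A. if \<alpha> \<in> A then c \<alpha> * mpow y \<alpha> else 0)"
        by (simp add: face_poly_def)
    qed auto
    have e_has: "((\<lambda>\<alpha>. e \<alpha> * mpow y \<alpha>) has_sum (2 powr V * S (rescale u y) - face_poly A y)) UNIV"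
      if y: "y \<in> cube R" for y
    proof -
      have "((\<lambda>\<alpha>. c \<alpha> * mpow y \<alpha> + - (if \<alpha> \<in> A then c \<alpha> * mpow y \<alpha> else 0)) has_sum
          (2 powr V * S (rescale u y) + - face_poly A y)) UNIV"
        by (intro has_sum_add has_sum_uminusI c_sum[OF y] A_sum)
      moreover have "c \<alpha> * mpow y \<alpha> + - (if \<alpha> \<in> A then c \<alpha> * mpow y \<alpha> else 0) = e \<alpha> * mpow y \<alpha>" for \<alpha>
        by (simp add: e_def)
      ultimately show ?thesis by simp
    qed
    have cont: "continuous_on (cube R) (\<lambda>y. 2 powr V * S (rescale u y))"
    proof (intro continuous_intros continuous_on_compose2[OF S_continuous])
      show "continuous_on (cube R) (rescale u)"
        unfolding rescale_def by (intro continuous_intros)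
    qed (use resc in auto)
    show "near_poly R (face_poly A) \<eta> (\<lambda>y. 2 powr V * S (rescale u y))"
      unfolding near_poly_def using cont \<sigma> e_sum e_has by blast
  qed
  note main = this
  show ?thesis
    by (intro exI[of _ J] exI[of _ \<Lambda>] conjI[OF J0] allI impI, elim conjE, rule main) auto
qed

text \<open>Change of variables by \<open>rescale u\<close>, whose Jacobian is comparable to
  2^(-|j|). The excess 1 of \<nu> over the distance from j to u covers the factor 2 between the ends
  of a dyadic interval, and \<kappa> is the loss from using V instead of m(j).\<close>

lemma piece_bound_by_rescaling:
  assumes near: "near_poly R P \<eta> (\<lambda>y. 2 powr V * S (rescale u y))"
    and est: "\<And>f t. near_poly R P \<eta> f \<Longrightarrow> t > 0 \<Longrightarrow>
      measure lebesgue {x\<in>annulus (2 powr \<nu>). \<bar>f x\<bar> < t} \<le> c * t powr (1 / D)"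
    and c: "c \<ge> 0" and D: "D > 0" and \<nu>: "\<nu> \<ge> 1" "\<And>i. \<bar>real (j i) - u $ i\<bar> \<le> \<nu> - 1"
    and R: "2 powr \<nu> \<le> R" and V: "V \<le> mval (pt j) + \<kappa>"
    and resc: "\<And>y. y \<in> cube R \<Longrightarrow> rescale u y \<in> cube r1"
  shows "piece_bound D (2 powr (real CARD('n) * \<nu>) * c * 2 powr (\<kappa> / D)) j"
  unfolding piece_bound_def
proof (intro allI impI)
  fix \<epsilon> :: real assume \<epsilon>: "\<epsilon> > 0"
  let ?f = "\<lambda>y. 2 powr V * S (rescale u y)"
  let ?Y = "{y\<in>annulus (2 powr \<nu>). \<bar>?f y\<bar> < 2 powr V * \<epsilon>}"
  have sub: "annulus (2 powr \<nu>) \<subseteq> (cube R :: (real^'n) set)"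
    using R by (auto simp: annulus_def cube_def intro: order_trans)
  have Ym: "?Y \<in> lmeasurable"
    using near sub unfolding near_poly_def
    by (intro sublevel_lmeasurable[where X = "cube R"] lmeasurable_compact compact_annulus) auto
  have sub2: "dyadic_piece j \<epsilon> \<subseteq> rescale u ` ?Y \<and> dyadic_box j \<subseteq> cube r1"
  proof -
    have mem: "rescale (- u) x \<in> annulus (2 powr \<nu>) \<and> rescale u (rescale (- u) x) = x"
      if x: "x \<in> dyadic_box j" for x
    proof
      show eq: "rescale u (rescale (- u) x) = x"
        by (simp add: rescale_def vec_eq_iff mult.assoc[symmetric] powr_add[symmetric])
      have "1 / 2 powr \<nu> \<le> \<bar>rescale (- u) x $ i\<bar> \<and> \<bar>rescale (- u) x $ i\<bar> \<le> 2 powr \<nu>" for i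
      proof -
        have a: "\<bar>rescale (- u) x $ i\<bar> = 2 powr (u $ i) * \<bar>x $ i\<bar>" by (simp add: rescale_def abs_mult)
        have "\<bar>rescale (- u) x $ i\<bar> \<le> 2 powr (u $ i) * 2 powr (1 - real (j i))"
          unfolding a using x by (intro mult_left_mono) (auto simp: dyadic_box_def)
        also have "\<dots> = 2 powr (u $ i + (1 - real (j i)))" by (simp add: powr_add)
        also have "\<dots> \<le> 2 powr \<nu>" using \<nu>(2)[of i] by (intro powr_mono) auto
        finally have 1: "\<bar>rescale (- u) x $ i\<bar> \<le> 2 powr \<nu>" .
        have "1 / 2 powr \<nu> = 2 powr (- \<nu>)" by (simp add: powr_minus divide_inverse)
        also have "\<dots> \<le> 2 powr (u $ i - real (j i))" using \<nu>(2)[of i] by (intro powr_mono) auto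
        also have "\<dots> = 2 powr (u $ i) * 2 powr (- real (j i))" by (simp add: powr_add[symmetric])
        also have "\<dots> \<le> \<bar>rescale (- u) x $ i\<bar>"
          unfolding a using x by (intro mult_left_mono) (auto simp: dyadic_box_def)
        finally show ?thesis using 1 by simp
      qed
      then show "rescale (- u) x \<in> annulus (2 powr \<nu>)" by (simp add: annulus_def)
    qed
    have "x \<in> rescale u ` ?Y" if x: "x \<in> dyadic_piece j \<epsilon>" for x
    proof (rule image_eqI[of _ _ "rescale (- u) x"])
      have "x \<in> dyadic_box j" "\<bar>S x\<bar> < \<epsilon>" using x by (auto simp: dyadic_piece_def)
      then show "x = rescale u (rescale (- u) x)" "rescale (- u) x \<in> ?Y" using mem by (auto simp: abs_mult)
    qed
    moreover have "x \<in> cube r1" if "x \<in> dyadic_box j" for x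
      using mem[OF that] resc sub by (metis subsetD)
    ultimately show ?thesis by blast
  qed
  have rm: "rescale u ` ?Y \<in> lmeasurable"
    unfolding rescale_def by (rule measurable_stretch[OF Ym[unfolded rescale_def]])
  have "measure lebesgue (dyadic_piece j \<epsilon>) \<le> measure lebesgue (rescale u ` ?Y)"
  proof (rule measure_mono_fmeasurable[OF _ _ rm])
    show "dyadic_piece j \<epsilon> \<in> sets lebesgue"
      unfolding dyadic_piece_def using sub2
      by (intro fmeasurableD sublevel_lmeasurable[OF S_continuous] lmeasurable_compact compact_dyadic_box) auto
  qed (use sub2 in blast)
  also have "\<dots> = \<bar>\<Prod>i\<in>UNIV. 2 powr (- (u $ i))\<bar> * measure lebesgue ?Y"
    unfolding rescale_def by (rule measure_stretch[OF Ym[unfolded rescale_def]])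
  also have "\<dots> \<le> (2 powr (- real (mdeg j)) * 2 powr (real CARD('n) * \<nu>)) * (c * (2 powr V * \<epsilon>) powr (1 / D))"
  proof (intro mult_mono)
    have "\<bar>\<Prod>i\<in>UNIV. 2 powr (- (u $ i))\<bar> = 2 powr (\<Sum>i\<in>UNIV. - (u $ i))" by (simp add: powr_sum prod_nonneg)
    also have "\<dots> \<le> 2 powr (- real (mdeg j) + real CARD('n) * \<nu>)"
    proof (intro powr_mono)
      have "(\<Sum>i\<in>UNIV. - (u $ i)) \<le> (\<Sum>i\<in>(UNIV::'n set). - real (j i) + \<nu>)"
      proof (rule sum_mono)
        fix i show "- (u $ i) \<le> - real (j i) + \<nu>" using \<nu>(2)[of i] by linarith
      qed
      then show "(\<Sum>i\<in>UNIV. - (u $ i)) \<le> - real (mdeg j) + real CARD('n) * \<nu>"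
        by (simp add: sum.distrib sum_negf sum_subtractf mdeg_def)
    qed simp
    finally show "\<bar>\<Prod>i\<in>UNIV. 2 powr (- (u $ i))\<bar> \<le> 2 powr (- real (mdeg j)) * 2 powr (real CARD('n) * \<nu>)"
      by (simp only: powr_add)
    show "measure lebesgue ?Y \<le> c * (2 powr V * \<epsilon>) powr (1 / D)" using \<epsilon> by (intro est near) auto
  qed (rule mult_nonneg_nonneg[OF powr_ge_zero powr_ge_zero], rule measure_nonneg)
  also have "\<dots> \<le> (2 powr (- real (mdeg j)) * 2 powr (real CARD('n) * \<nu>)) *
      (c * (2 powr (\<kappa> / D) * (\<epsilon> * 2 powr mval (pt j)) powr (1 / D)))"
  proof (intro mult_left_mono)
    have "(2 powr V * \<epsilon>) powr (1 / D) \<le> (2 powr (mval (pt j) + \<kappa>) * \<epsilon>) powr (1 / D)"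
      using \<epsilon> D V by (intro powr_mono2 mult_right_mono powr_mono) auto
    also have "\<dots> = 2 powr (\<kappa> / D) * (\<epsilon> * 2 powr mval (pt j)) powr (1 / D)"
      using \<epsilon> by (simp add: powr_add powr_mult powr_powr mult_ac)
    finally show "(2 powr V * \<epsilon>) powr (1 / D) \<le> 2 powr (\<kappa> / D) * (\<epsilon> * 2 powr mval (pt j)) powr (1 / D)" .
  qed (use c in auto)
  finally show "measure lebesgue (dyadic_piece j \<epsilon>)
      \<le> 2 powr (real CARD('n) * \<nu>) * c * 2 powr (\<kappa> / D) * (2 powr - real (mdeg j) * (\<epsilon> * 2 powr mval (pt j)) powr (1 / D))"
    by (simp only: mult_ac)
qed

text \<open>If j is nearly minimal on all of \<open>A\<close>, it is at bounded distance from a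
  weight u that is constant on \<open>A\<close>. Once the remaining exponents are far from minimal
  at j, they stay above at u, so u exposes exactly \<open>A\<close> and the uniform estimate for
  that face applies.\<close>

lemma piece_bound_near_face:
  assumes A: "A \<subseteq> G" and D: "D > 0" and K: "K \<ge> 0"
    and low: "\<And>u. exact_face A u \<Longrightarrow> A \<noteq> {} \<Longrightarrow> low_order D A"
  shows "\<exists>K' J0 c. \<forall>j. (\<forall>i. J0 \<le> j i) \<and> (\<forall>\<alpha>\<in>A. pt j \<bullet> pt \<alpha> \<le> mval (pt j) + K) \<and>
    (\<forall>\<alpha>\<in>G - A. pt j \<bullet> pt \<alpha> > mval (pt j) + K') \<longrightarrow> piece_bound D c j"
proof (cases "A = {}")
  case True
  \<comment> \<open>The minimum is attained somewhere in \<open>G\<close>, so for empty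
    \<open>A\<close> the premise fails with K' = 0.\<close>
  have "\<not> (\<forall>\<alpha>\<in>G - A. pt j \<bullet> pt \<alpha> > mval (pt j) + 0)" for j
    using mval_attained[of "pt j"] True by force
  then show ?thesis by blast
next
  case ne: False
  then obtain \<alpha>0 where \<alpha>0: "\<alpha>0 \<in> A" by blast
  have fA: "finite A" using A G_finite by (rule finite_subset)
  define W where "W = (\<lambda>(\<alpha>, \<beta>). pt \<alpha> - pt \<beta>) ` (A \<times> A)"
  have fW: "finite W" unfolding W_def using fA by simp
  obtain c0 where c0: "c0 > 0" "\<And>x. \<exists>v. (\<forall>w\<in>W. w \<bullet> v = 0) \<and> c0 * norm (x - v) \<le> (\<Sum>w\<in>W. \<bar>w \<bullet> x\<bar>)"
    using dist_to_annihilator[OF fW] by blast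
  \<comment> \<open>Differences of exponents in \<open>A\<close> take values of size at most K at j;
    by the choice of \<open>c0\<close> this bounds the distance from j to u.\<close>
  define \<mu> where "\<mu> = real (card W) * K / c0"
  have \<mu>: "\<mu> \<ge> 0" using K c0 by (simp add: \<mu>_def)
  define \<nu> where "\<nu> = \<mu> + 1"
  \<comment> \<open>A margin above 1 between the annulus and the cube, as
    \<open>compact_sublevel_estimate\<close> requires.\<close>
  define R where "R = 2 powr \<nu> + 2"
  have R: "2 powr \<nu> < R - 1" "1 \<le> R" by (auto simp: R_def add_nonneg_nonneg)
  define Dg where "Dg = (\<Sum>g\<in>G. norm (pt g))"
  have Dg: "norm (pt g) \<le> Dg" if "g \<in> G" for g
    unfolding Dg_def using that G_finite by (intro member_le_sum) auto
  have Dg0: "0 \<le> Dg" unfolding Dg_def by (intro sum_nonneg) auto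
  obtain \<eta> c where \<eta>: "\<eta> > 0" and c: "c \<ge> 0" and est: "\<And>u f t. exact_face A u \<Longrightarrow>
      near_poly R (face_poly A) \<eta> f \<Longrightarrow> t > 0 \<Longrightarrow>
      measure lebesgue {x\<in>annulus (2 powr \<nu>). \<bar>f x\<bar> < t} \<le> c * t powr (1 / D)"
  \<comment> \<open>The constants must be fixed before any weight is known. If no weight exposes
    \<open>A\<close>, the estimate is void and any constants serve.\<close>
  proof (cases "\<exists>u. exact_face A u")
    case True
    then have low': "low_order D A" using low ne by blast
    have "\<exists>\<eta>>0. \<exists>C. \<forall>f t. near_poly R (\<lambda>x. \<Sum>\<alpha>\<in>A. s \<alpha> * mpow x \<alpha>) \<eta> f \<and> t > 0 \<longrightarrow>
        measure lebesgue {x\<in>annulus (2 powr \<nu>). \<bar>f x\<bar> < t} \<le> C * t powr (1 / D)"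
    proof (rule compact_sublevel_estimate[OF fA D compact_annulus])
      fix p :: "real^'n" and i assume p: "p \<in> annulus (2 powr \<nu>)"
      then show "\<bar>p $ i\<bar> < R - 1" using R(1) by (auto simp: annulus_def intro: le_less_trans)
      have "p $ i \<noteq> 0" for i
      proof
        assume "p $ i = 0"
        moreover have "1 / 2 powr \<nu> \<le> \<bar>p $ i\<bar>" using p by (auto simp: annulus_def)
        ultimately show False by (simp add: not_le)
      qed
      then show "\<exists>js. partial_derivs js (\<lambda>x. \<Sum>\<alpha>\<in>A. s \<alpha> * mpow x \<alpha>) p \<noteq> 0 \<and> real (length js) \<le> D"
        using low' unfolding low_order_def face_poly_def[abs_def] by blast
    qed
    then obtain \<eta> c where "\<eta> > 0" "\<And>f t. near_poly R (face_poly A) \<eta> f \<Longrightarrow> t > 0 \<Longrightarrow>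
        measure lebesgue {x\<in>annulus (2 powr \<nu>). \<bar>f x\<bar> < t} \<le> c * t powr (1 / D)"
      unfolding face_poly_def[abs_def] by blast
    note c0 = this
    have "\<bar>c\<bar> \<ge> 0" "\<And>f t. near_poly R (face_poly A) \<eta> f \<Longrightarrow> t > 0 \<Longrightarrow>
        measure lebesgue {x\<in>annulus (2 powr \<nu>). \<bar>f x\<bar> < t} \<le> \<bar>c\<bar> * t powr (1 / D)"
      using order_trans[OF c0(2) mult_right_mono[OF abs_ge_self powr_ge_zero]] by simp_all
    with c0(1) show ?thesis using that by blast
  next
    case False
    then show ?thesis using that[of 1 0] by auto
  qed
  from near_face_poly[OF A R(2) \<eta>] obtain J \<Lambda> where J: "J > 0" and
      near0: "\<forall>u V. (\<forall>i. J \<le> u $ i) \<and> (\<forall>\<alpha>\<in>A. u \<bullet> pt \<alpha> = V) \<and>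
      (\<forall>\<alpha>\<in>G - A. V + \<Lambda> \<le> u \<bullet> pt \<alpha>) \<and> (\<forall>\<alpha>\<in>G. V \<le> u \<bullet> pt \<alpha>) \<longrightarrow>
      (\<forall>y\<in>cube R. rescale u y \<in> cube r1) \<and>
      near_poly R (face_poly A) \<eta> (\<lambda>y. 2 powr V * S (rescale u y))"
    by (elim exE conjE) rule
  \<comment> \<open>Passing from j to u changes each pairing by at most \<mu> Dg, once for V and
    once for the exponent off \<open>A\<close>; |\<Lambda>| is the gap that must remain.\<close>
  define K' where "K' = K + 2 * \<mu> * Dg + \<bar>\<Lambda>\<bar>"
  obtain J0 :: nat where J0: "J + \<mu> \<le> real J0" using real_arch_simple by blast
  have "piece_bound D (2 powr (real CARD('n) * \<nu>) * c * 2 powr ((K + \<mu> * Dg) / D)) j"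
    if j: "\<And>i. J0 \<le> j i" and jA: "\<And>\<alpha>. \<alpha> \<in> A \<Longrightarrow> pt j \<bullet> pt \<alpha> \<le> mval (pt j) + K"
      and jG: "\<And>\<alpha>. \<alpha> \<in> G - A \<Longrightarrow> pt j \<bullet> pt \<alpha> > mval (pt j) + K'" for j
  proof -
    obtain u where u: "\<And>w. w \<in> W \<Longrightarrow> w \<bullet> u = 0" "c0 * norm (pt j - u) \<le> (\<Sum>w\<in>W. \<bar>w \<bullet> pt j\<bar>)"
      using c0(2)[of "pt j"] by blast
    have "\<bar>w \<bullet> pt j\<bar> \<le> K" if "w \<in> W" for w
    proof -
      obtain \<alpha> \<beta> where w: "\<alpha> \<in> A" "\<beta> \<in> A" "w = pt \<alpha> - pt \<beta>" using \<open>w \<in> W\<close> by (auto simp: W_def)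
      have "mval (pt j) \<le> pt j \<bullet> pt \<alpha>" "mval (pt j) \<le> pt j \<bullet> pt \<beta>" using w A by (auto intro: mval_le_G)
      moreover have "w \<bullet> pt j = pt j \<bullet> pt \<alpha> - pt j \<bullet> pt \<beta>"
        unfolding w(3) by (simp add: inner_diff_left inner_commute[of "pt j"])
      ultimately show ?thesis using jA[OF w(1)] jA[OF w(2)] by linarith
    qed
    then have "(\<Sum>w\<in>W. \<bar>w \<bullet> pt j\<bar>) \<le> (\<Sum>w\<in>W. K)" by (rule sum_mono)
    then have "c0 * norm (pt j - u) \<le> real (card W) * K" using u(2) by simp
    then have nu: "norm (pt j - u) \<le> \<mu>" using c0(1) by (simp add: \<mu>_def pos_le_divide_eq mult.commute)
    have diff: "\<bar>pt j \<bullet> pt \<alpha> - u \<bullet> pt \<alpha>\<bar> \<le> \<mu> * Dg" if "\<alpha> \<in> G" for \<alpha>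
    proof -
      have "\<bar>(pt j - u) \<bullet> pt \<alpha>\<bar> \<le> norm (pt j - u) * norm (pt \<alpha>)" by (rule Cauchy_Schwarz_ineq2)
      also have "\<dots> \<le> \<mu> * Dg" using nu Dg[OF that] \<mu> by (intro mult_mono) auto
      finally show ?thesis by (simp add: inner_diff_left)
    qed
    define V where "V = u \<bullet> pt \<alpha>0"
    have uA: "u \<bullet> pt \<alpha> = V" if "\<alpha> \<in> A" for \<alpha>
    proof -
      have "(pt \<alpha> - pt \<alpha>0) \<bullet> u = 0" using that \<alpha>0 by (intro u(1)) (auto simp: W_def)
      then show ?thesis by (simp add: V_def inner_diff_left inner_commute[of u])
    qed
    have V: "V \<le> mval (pt j) + (K + \<mu> * Dg)"
      using jA[OF \<alpha>0] diff[of \<alpha>0] \<alpha>0 A unfolding V_def by (auto simp: abs_le_iff)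
    have uG: "V + \<bar>\<Lambda>\<bar> < u \<bullet> pt \<alpha>" if "\<alpha> \<in> G - A" for \<alpha>
      using jG[OF that] diff[of \<alpha>] that V unfolding K'_def by (auto simp: abs_le_iff)
    have ji: "\<bar>real (j i) - u $ i\<bar> \<le> \<mu>" for i
      using component_le_norm_cart[of "pt j - u" i] nu by (simp add: exponent_point_def)
    have uJ: "J \<le> u $ i" for i
    proof -
      have "real J0 \<le> real (j i)" using j[of i] by simp
      then show ?thesis using ji[of i] J0 by linarith
    qed
    have ex: "exact_face A u"
      unfolding exact_face_def
    proof (intro conjI A allI exI[of _ V] ballI)
      show "0 < u $ i" for i using uJ[of i] J by linarith
      show "V < u \<bullet> pt \<alpha>" if "\<alpha> \<in> G - A" for \<alpha> using uG[OF that] by linarith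
    qed (rule uA)
    have nr: "(\<forall>y\<in>cube R. rescale u y \<in> cube r1) \<and>
        near_poly R (face_poly A) \<eta> (\<lambda>y. 2 powr V * S (rescale u y))"
    proof (rule near0[rule_format], intro conjI allI ballI)
      show "V + \<Lambda> \<le> u \<bullet> pt \<alpha>" if "\<alpha> \<in> G - A" for \<alpha> using uG[OF that] by linarith
      show "V \<le> u \<bullet> pt \<alpha>" if "\<alpha> \<in> G" for \<alpha> using uG[of \<alpha>] uA[of \<alpha>] that by (cases "\<alpha> \<in> A") auto
    qed (use uJ uA in auto)
    show ?thesis
    proof (rule piece_bound_by_rescaling[OF conjunct2[OF nr] est[OF ex] c D _ _ _ V])
      show "1 \<le> \<nu>" using \<mu> by (simp add: \<nu>_def)
      show "\<bar>real (j i) - u $ i\<bar> \<le> \<nu> - 1" for i using ji[of i] by (simp add: \<nu>_def)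
      show "2 powr \<nu> \<le> R" using R by simp
    qed (use nr in auto)
  qed
  then show ?thesis by blast
qed

text \<open>Downward induction on the set \<open>A\<close> of exponents that are nearly minimal at \<open>j\<close>: either all
  others are far from minimal and the estimate at the face of \<open>A\<close> applies, or one of them can be
  added to \<open>A\<close> with a larger constant.\<close>

lemma piece_bound_all:
  assumes G0: "G0 \<subseteq> G" and D: "D > 0"
    and low: "\<And>A u. A \<subseteq> G0 \<Longrightarrow> exact_face A u \<Longrightarrow> A \<noteq> {} \<Longrightarrow> low_order D A"
  shows "\<exists>J0 c K0. \<forall>j. (\<forall>i. J0 \<le> j i) \<and> (\<forall>\<alpha>\<in>G - G0. pt j \<bullet> pt \<alpha> > mval (pt j) + K0)
    \<longrightarrow> piece_bound D c j"
proof -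
  have fin: "finite G0" using G0 G_finite by (rule finite_subset)
  define good where "good A K J0 c K0 \<longleftrightarrow> (\<forall>j. (\<forall>i. J0 \<le> j i) \<and> (\<forall>\<alpha>\<in>A. pt j \<bullet> pt \<alpha> \<le> mval (pt j) + K) \<and>
    (\<forall>\<alpha>\<in>G - G0. pt j \<bullet> pt \<alpha> > mval (pt j) + K0) \<longrightarrow> piece_bound D c j)"
    for A and K :: real and J0 :: nat and c K0 :: real
  have "\<exists>J0 c K0. good A K J0 c K0" if "A \<subseteq> G0" "K \<ge> 0" for A K
    using that
  proof (induction "card (G0 - A)" arbitrary: A K rule: less_induct)
    case less
    have AG: "A \<subseteq> G" using less.prems G0 by blast
    have "\<exists>K' J0 c. \<forall>j. (\<forall>i. J0 \<le> j i) \<and> (\<forall>\<alpha>\<in>A. pt j \<bullet> pt \<alpha> \<le> mval (pt j) + K) \<and>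
        (\<forall>\<alpha>\<in>G - A. pt j \<bullet> pt \<alpha> > mval (pt j) + K') \<longrightarrow> piece_bound D c j"
      by (rule piece_bound_near_face[OF AG D less.prems(2)]) (rule low[OF less.prems(1)])
    then obtain K' J' c' where X: "\<And>j. (\<forall>i. J' \<le> j i) \<Longrightarrow> (\<forall>\<alpha>\<in>A. pt j \<bullet> pt \<alpha> \<le> mval (pt j) + K) \<Longrightarrow>
        (\<forall>\<alpha>\<in>G - A. pt j \<bullet> pt \<alpha> > mval (pt j) + K') \<Longrightarrow> piece_bound D c' j"
      by blast
    have "\<forall>\<alpha>\<in>G0 - A. \<exists>J0 c K0. good (insert \<alpha> A) (max K K') J0 c K0"
    proof
      fix \<alpha> assume a: "\<alpha> \<in> G0 - A"
      then have "card (G0 - insert \<alpha> A) < card (G0 - A)" using fin by (intro psubset_card_mono) auto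
      then show "\<exists>J0 c K0. good (insert \<alpha> A) (max K K') J0 c K0" using less a by auto
    qed
    then obtain Jf cf Kf where f: "\<And>\<alpha>. \<alpha> \<in> G0 - A \<Longrightarrow> good (insert \<alpha> A) (max K K') (Jf \<alpha>) (cf \<alpha>) (Kf \<alpha>)"
      by metis
    define J0 where "J0 = J' + (\<Sum>\<alpha>\<in>G0 - A. Jf \<alpha>)"
    define c where "c = \<bar>c'\<bar> + (\<Sum>\<alpha>\<in>G0 - A. \<bar>cf \<alpha>\<bar>)"
    define K0 where "K0 = \<bar>K'\<bar> + (\<Sum>\<alpha>\<in>G0 - A. \<bar>Kf \<alpha>\<bar>)"
    have bounds: "Jf \<alpha> \<le> J0" "cf \<alpha> \<le> c" "Kf \<alpha> \<le> K0" if "\<alpha> \<in> G0 - A" for \<alpha>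
    proof -
      have "Jf \<alpha> \<le> (\<Sum>\<alpha>\<in>G0 - A. Jf \<alpha>)" "\<bar>cf \<alpha>\<bar> \<le> (\<Sum>\<alpha>\<in>G0 - A. \<bar>cf \<alpha>\<bar>)" "\<bar>Kf \<alpha>\<bar> \<le> (\<Sum>\<alpha>\<in>G0 - A. \<bar>Kf \<alpha>\<bar>)"
        using that fin by (auto intro: member_le_sum)
      then show "Jf \<alpha> \<le> J0" "cf \<alpha> \<le> c" "Kf \<alpha> \<le> K0" unfolding J0_def c_def K0_def by linarith+
    qed
    have bounds': "J' \<le> J0" "c' \<le> c" "K' \<le> K0"
    proof -
      have "0 \<le> (\<Sum>\<alpha>\<in>G0 - A. \<bar>cf \<alpha>\<bar>)" "0 \<le> (\<Sum>\<alpha>\<in>G0 - A. \<bar>Kf \<alpha>\<bar>)" by (auto intro: sum_nonneg)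
      then show "J' \<le> J0" "c' \<le> c" "K' \<le> K0" unfolding J0_def c_def K0_def by linarith+
    qed
    have "good A K J0 c K0"
      unfolding good_def
    proof (intro allI impI, elim conjE)
      fix j assume j: "\<forall>i. J0 \<le> j i" "\<forall>\<alpha>\<in>A. pt j \<bullet> pt \<alpha> \<le> mval (pt j) + K"
        "\<forall>\<alpha>\<in>G - G0. pt j \<bullet> pt \<alpha> > mval (pt j) + K0"
      show "piece_bound D c j"
      proof (cases "\<exists>\<alpha>\<in>G0 - A. pt j \<bullet> pt \<alpha> \<le> mval (pt j) + K'")
        case True
        then obtain \<alpha> where a: "\<alpha> \<in> G0 - A" "pt j \<bullet> pt \<alpha> \<le> mval (pt j) + K'" by blast
        have "piece_bound D (cf \<alpha>) j"
        proof (rule f[OF a(1), unfolded good_def, rule_format], intro conjI allI ballI)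
          show "Jf \<alpha> \<le> j i" for i using j(1) bounds(1)[OF a(1)] by (metis order_trans)
          show "pt j \<bullet> pt \<beta> \<le> mval (pt j) + max K K'" if "\<beta> \<in> insert \<alpha> A" for \<beta>
            using that a(2) j(2) by fastforce
          show "mval (pt j) + Kf \<alpha> < pt j \<bullet> pt \<beta>" if "\<beta> \<in> G - G0" for \<beta>
            using bspec[OF j(3) that] bounds(3)[OF a(1)] by linarith
        qed
        then show ?thesis using bounds(2)[OF a(1)] by (rule piece_bound_mono)
      next
        case False
        have "piece_bound D c' j"
        proof (rule X[OF _ j(2)])
          show "\<forall>i. J' \<le> j i" using j(1) bounds'(1) by (metis order_trans)
          show "\<forall>\<alpha>\<in>G - A. mval (pt j) + K' < pt j \<bullet> pt \<alpha>"
          proof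
            fix \<alpha> assume a: "\<alpha> \<in> G - A"
            show "mval (pt j) + K' < pt j \<bullet> pt \<alpha>"
            proof (cases "\<alpha> \<in> G0")
              case True
              then show ?thesis using False a by (auto simp: not_le)
            next
              case False
              then have "\<alpha> \<in> G - G0" using a by blast
              then show ?thesis using bspec[OF j(3), of \<alpha>] bounds'(3) by linarith
            qed
          qed
        qed
        then show ?thesis using bounds'(2) by (rule piece_bound_mono)
      qed
    qed
    then show ?case by blast
  qed
  \<comment> \<open>For empty \<open>A\<close> the near-minimality condition is void, and only the
    condition on \<open>G - G0\<close> remains.\<close>
  from this[of "{}" 0] show ?thesis unfolding good_def by auto
qed

end

section \<open>From the pieces to upper bounds\<close>

context newton
begin

text \<open>As all weights are positive, moving up from an exponent in any coordinate strictly
  increases the functional, so equality is possible only at the points of \<open>A\<close>.\<close>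

lemma exact_face_strict:
  assumes A: "A \<subseteq> G" and u: "\<And>i. u $ i > 0" and V: "\<And>\<alpha>. \<alpha> \<in> A \<Longrightarrow> u \<bullet> pt \<alpha> = V"
    "\<And>\<alpha>. \<alpha> \<in> G - A \<Longrightarrow> u \<bullet> pt \<alpha> > V"
    and \<alpha>: "\<alpha> \<in> msupp s" and x: "nonneg_vec (x - pt \<alpha>)"
  shows "x \<in> pt ` A \<or> u \<bullet> x > V"
proof -
  have u0: "nonneg_vec u" using u by (simp add: less_imp_le)
  obtain g where g: "g \<in> G" "g \<le> \<alpha>" using ex_minimal_exponent_le[OF \<alpha>] by blast
  have xg: "pt g $ i \<le> x $ i" for i using x pt_mono[OF g(2), of i] by (auto intro: order_trans)
  have le: "u \<bullet> pt g \<le> u \<bullet> x" by (rule inner_nonneg_mono[OF u0 xg])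
  show ?thesis
  proof (cases "g \<in> A")
    case True
    show ?thesis
    proof (cases "x = pt g")
      case False
      then obtain i where "x $ i \<noteq> pt g $ i" by (auto simp: vec_eq_iff)
      then have i: "pt g $ i < x $ i" using xg[of i] by simp
      have "(\<Sum>i\<in>UNIV. u $ i * pt g $ i) < (\<Sum>i\<in>UNIV. u $ i * x $ i)"
      proof (rule sum_strict_mono_ex1)
        show "\<forall>i\<in>UNIV. u $ i * pt g $ i \<le> u $ i * x $ i" using u0 xg by (simp add: mult_left_mono)
        show "\<exists>i\<in>UNIV. u $ i * pt g $ i < u $ i * x $ i" using i u[of i] by (intro bexI[of _ i]) auto
      qed simp
      then show ?thesis using V(1)[OF True] by (simp add: inner_vec_real)
    qed (use True in auto)
  next
    case False
    then show ?thesis using V(2)[of g] g(1) le by auto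
  qed
qed

text \<open>The open half-space together with \<open>F\<close> is convex, since a proper mixture
  with one point strictly above V is strictly above V. It contains all octants and hence N, so
  \<open>F\<close> is the part of N on the hyperplane. No exponent of the support outside
  \<open>A\<close> lies on \<open>F\<close>.\<close>

lemma compact_face_of_weights:
  assumes A: "A \<subseteq> G" "A \<noteq> {}" and u: "\<And>i. u $ i > 0" and V: "\<And>\<alpha>. \<alpha> \<in> A \<Longrightarrow> u \<bullet> pt \<alpha> = V"
    "\<And>\<alpha>. \<alpha> \<in> G - A \<Longrightarrow> u \<bullet> pt \<alpha> > V"
  defines "F \<equiv> convex hull (pt ` A)"
  shows "F \<in> compact_faces s" "face_polynomial s F = (\<lambda>x. \<Sum>\<alpha>\<in>A. s \<alpha> * mpow x \<alpha>)"
proof -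
  have fA: "finite A" using A(1) G_finite by (rule finite_subset)
  have FV: "F \<subseteq> {x. u \<bullet> x = V}"
    unfolding F_def by (rule hull_minimal) (use V in \<open>auto simp: convex_hyperplane\<close>)
  have cF: "convex F" by (simp add: F_def)
  have sub: "N \<subseteq> {x. u \<bullet> x > V} \<union> F"
  proof (rule N_minimal)
    show "convex ({x. u \<bullet> x > V} \<union> F)"
    proof (rule convexI)
      fix x y and a b :: real
      assume xy: "x \<in> {x. u \<bullet> x > V} \<union> F" "y \<in> {x. u \<bullet> x > V} \<union> F" and ab: "0 \<le> a" "0 \<le> b" "a + b = 1"
      have ge: "u \<bullet> x \<ge> V" "u \<bullet> y \<ge> V" using xy FV by auto
      consider "x \<in> F" "y \<in> F" | "a = 0" | "b = 0" | "a > 0" "b > 0" "u \<bullet> x > V \<or> u \<bullet> y > V"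
        using xy ab by fastforce
      then show "a *\<^sub>R x + b *\<^sub>R y \<in> {x. u \<bullet> x > V} \<union> F"
      proof cases
        case 1
        then show ?thesis using convexD[OF cF] ab by blast
      next
        case 4
        have "V = a * V + b * V" using ab by (simp add: distrib_right[symmetric])
        also have "\<dots> < a * (u \<bullet> x) + b * (u \<bullet> y)"
          using 4 ge by (auto intro: add_less_le_mono add_le_less_mono)
        finally show ?thesis by (simp add: inner_add_right)
      qed (use xy ab in auto)
    qed
    show "x \<in> {x. u \<bullet> x > V} \<union> F" if "\<alpha> \<in> msupp s" "nonneg_vec (x - pt \<alpha>)" for \<alpha> x
      using exact_face_strict[OF A(1) u V that] hull_subset[of "pt ` A" convex] by (auto simp: F_def)
  qed
  have ptA: "pt ` A \<subseteq> N" using A(1) minimal_exponents_subset[of s] pt_in_N by auto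
  then have FN: "F \<subseteq> N" unfolding F_def by (rule hull_minimal) (rule convex_N)
  have Feq: "F = N \<inter> {x. u \<bullet> x = V}" using sub FV FN by auto
  have "F face_of N"
    unfolding Feq by (rule face_of_Int_supporting_hyperplane_ge[OF convex_N]) (use sub FV in fastforce)
  moreover have cpt: "compact F" unfolding F_def using fA by (intro finite_imp_compact_convex_hull) auto
  moreover have "F \<noteq> {}" using A(2) by (simp add: F_def)
  ultimately show "F \<in> compact_faces s" by (simp add: compact_faces_def)
  have fin: "finite {\<alpha>. pt \<alpha> \<in> F}"
  proof -
    obtain B where B: "\<And>x. x \<in> F \<Longrightarrow> norm x \<le> B" using compact_imp_bounded[OF cpt] by (auto simp: bounded_iff)
    obtain M :: nat where M: "B \<le> real M" using real_arch_simple by blast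
    have "\<alpha> i \<le> M" if "pt \<alpha> \<in> F" for \<alpha> i
      using component_le_norm_cart[of "pt \<alpha>" i] B[OF that] M by (simp add: exponent_point_def)
    then have "{\<alpha>. pt \<alpha> \<in> F} \<subseteq> mbox M" by (auto simp: mbox_def)
    then show ?thesis by (rule finite_subset) (rule finite_mbox)
  qed
  show "face_polynomial s F = (\<lambda>x. \<Sum>\<alpha>\<in>A. s \<alpha> * mpow x \<alpha>)"
  proof
    fix x
    have "(\<Sum>\<alpha>\<in>A. s \<alpha> * mpow x \<alpha>) = (\<Sum>\<alpha>\<in>{\<alpha>. pt \<alpha> \<in> F}. s \<alpha> * mpow x \<alpha>)"
    proof (rule sum.mono_neutral_left[OF fin])
      show "A \<subseteq> {\<alpha>. pt \<alpha> \<in> F}" using hull_subset[of "pt ` A" convex] by (auto simp: F_def)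
      show "\<forall>\<alpha>\<in>{\<alpha>. pt \<alpha> \<in> F} - A. s \<alpha> * mpow x \<alpha> = 0"
      proof
        fix \<alpha> assume a: "\<alpha> \<in> {\<alpha>. pt \<alpha> \<in> F} - A"
        have "\<alpha> \<notin> msupp s"
        proof
          assume "\<alpha> \<in> msupp s"
          moreover have "pt \<alpha> \<notin> pt ` A"
          proof
            assume "pt \<alpha> \<in> pt ` A"
            then obtain \<beta> where "\<beta> \<in> A" "pt \<alpha> = pt \<beta>" by blast
            then have "\<alpha> \<in> A" by (simp add: exponent_point_def vec_eq_iff fun_eq_iff[symmetric])
            then show False using a by blast
          qed
          ultimately have "u \<bullet> pt \<alpha> > V" using exact_face_strict[OF A(1) u V, of \<alpha> "pt \<alpha>"] by auto
          then show False using a FV by auto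
        qed
        then show "s \<alpha> * mpow x \<alpha> = 0" by (simp add: msupp_def)
      qed
    qed
    then show "face_polynomial s F x = (\<Sum>\<alpha>\<in>A. s \<alpha> * mpow x \<alpha>)"
      by (simp add: face_polynomial_def mpow_def)
  qed
qed

lemma h_dirs:
  "\<exists>W \<kappa>. W \<subseteq> dirs \<and> independent W \<and> span W = span dirs \<and> finite W \<and> int (card W) = aff_dim C \<and> \<kappa> > 0 \<and>
    (\<forall>j. nonneg_vec j \<longrightarrow> \<kappa> * (\<Sum>w\<in>W. \<bar>w \<bullet> j\<bar>) \<le> h j)"
proof -
  obtain W where W: "W \<subseteq> dirs" "independent W" "span W = span dirs" "finite W" "int (card W) = aff_dim C"
    using ex_basis_dirs by blast
  have "\<forall>w\<in>W. \<exists>K>0. \<forall>j. nonneg_vec j \<longrightarrow> \<bar>w \<bullet> j\<bar> \<le> K * h j" using dirs_le_h W(1) by blast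
  then obtain K where K: "\<And>w. w \<in> W \<Longrightarrow> K w > 0" "\<And>w j. w \<in> W \<Longrightarrow> nonneg_vec j \<Longrightarrow> \<bar>w \<bullet> j\<bar> \<le> K w * h j"
    by metis
  have K0: "0 \<le> (\<Sum>w\<in>W. K w)" using K(1) by (intro sum_nonneg) (auto intro: less_imp_le)
  define \<kappa> where "\<kappa> = 1 / (1 + (\<Sum>w\<in>W. K w))"
  have "\<kappa> * (\<Sum>w\<in>W. \<bar>w \<bullet> j\<bar>) \<le> h j" if j: "nonneg_vec j" for j
  proof -
    have "(\<Sum>w\<in>W. \<bar>w \<bullet> j\<bar>) \<le> (\<Sum>w\<in>W. K w) * h j"
      unfolding sum_distrib_right using K(2) j by (intro sum_mono) auto
    also have "\<dots> \<le> (1 + (\<Sum>w\<in>W. K w)) * h j" using h_nonneg[OF j] by (intro mult_right_mono) auto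
    finally show ?thesis using K0 by (simp add: \<kappa>_def divide_le_eq mult.commute add_pos_nonneg)
  qed
  moreover have "\<kappa> > 0" using K0 by (simp add: \<kappa>_def)
  ultimately show ?thesis using W by blast
qed

lemma nonneg_pt: "nonneg_vec (pt j)" by (simp add: exponent_point_def)

lemma card_minus_eq:
  assumes "int a = aff_dim C"
  shows "CARD('n) - a = nat (int CARD('n) - aff_dim C)"
  using assms by linarith

lemma sum_exp_h:
  assumes "\<kappa> > 0"
  shows "\<exists>K. \<forall>R. (\<Sum>j\<in>mbox R. 2 powr (- (\<kappa> * h (pt j)))) \<le> K * (1 + real R) ^ nat (int CARD('n) - aff_dim C)"
proof -
  obtain W \<kappa>' where W: "independent W" "int (card W) = aff_dim C" "\<kappa>' > 0"
      "\<And>j. nonneg_vec j \<Longrightarrow> \<kappa>' * (\<Sum>w\<in>W. \<bar>w \<bullet> j\<bar>) \<le> h j"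
    using h_dirs by blast
  have pos: "\<kappa> * \<kappa>' > 0" using assms W(3) by simp
  obtain K where K: "\<And>b R. (\<Sum>j\<in>mbox R. 2 powr (- (\<kappa> * \<kappa>' * (\<Sum>w\<in>W. \<bar>w \<bullet> exponent_point j - b w\<bar>))))
      \<le> K * (1 + real R) ^ (CARD('n) - card W)"
    using sum_exp_functionals[OF W(1) pos] by blast
  have "(\<Sum>j\<in>mbox R. 2 powr (- (\<kappa> * h (pt j)))) \<le> K * (1 + real R) ^ (CARD('n) - card W)" for R
  proof -
    have "(\<Sum>j\<in>mbox R. 2 powr (- (\<kappa> * h (pt j))))
        \<le> (\<Sum>j\<in>mbox R. 2 powr (- (\<kappa> * \<kappa>' * (\<Sum>w\<in>W. \<bar>w \<bullet> exponent_point j - 0\<bar>))))"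
      using mult_left_mono[OF W(4)[OF nonneg_pt], of \<kappa>] assms
      by (intro sum_mono powr_mono) (auto simp: mult.assoc)
    also have "\<dots> \<le> K * (1 + real R) ^ (CARD('n) - card W)" by (rule K)
    finally show ?thesis .
  qed
  then show ?thesis using card_minus_eq[OF W(2)] by auto
qed

text \<open>This is where a logarithm is saved: \<open>w0\<close> is one more independent damped
  functional besides a basis of the direction space. Uniformity in the shift L matters, as L will
  depend on eps.\<close>

lemma sum_exp_h_transversal:
  assumes "\<kappa> > 0" and w0: "w0 \<notin> span dirs"
  shows "\<exists>K. \<forall>R L. (\<Sum>j\<in>mbox R. 2 powr (- (\<kappa> * (h (pt j) + \<bar>w0 \<bullet> pt j - L\<bar>))))
    \<le> K * (1 + real R) ^ nat (int CARD('n) - aff_dim C - 1)"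
proof -
  obtain W \<kappa>' where W: "independent W" "span W = span dirs" "finite W" "int (card W) = aff_dim C" "\<kappa>' > 0"
      "\<And>j. nonneg_vec j \<Longrightarrow> \<kappa>' * (\<Sum>w\<in>W. \<bar>w \<bullet> j\<bar>) \<le> h j"
    using h_dirs by blast
  define c where "c = \<kappa> * min \<kappa>' 1"
  have pos: "c > 0" using assms W(5) by (simp add: c_def)
  have nW: "w0 \<notin> W" using w0 W(2) span_base by blast
  have ind: "independent (insert w0 W)" using w0 W(1,2) by (simp add: independent_insert)
  obtain K where K: "\<And>b R. (\<Sum>j\<in>mbox R. 2 powr (- (c * (\<Sum>w\<in>insert w0 W. \<bar>w \<bullet> exponent_point j - b w\<bar>))))
      \<le> K * (1 + real R) ^ (CARD('n) - card (insert w0 W))"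
    using sum_exp_functionals[OF ind pos] by blast
  have "(\<Sum>j\<in>mbox R. 2 powr (- (\<kappa> * (h (pt j) + \<bar>w0 \<bullet> pt j - L\<bar>))))
      \<le> K * (1 + real R) ^ (CARD('n) - card (insert w0 W))" for R L
  proof -
    define b where "b w = (if w = w0 then L else 0)" for w
    have "(\<Sum>j\<in>mbox R. 2 powr (- (\<kappa> * (h (pt j) + \<bar>w0 \<bullet> pt j - L\<bar>))))
        \<le> (\<Sum>j\<in>mbox R. 2 powr (- (c * (\<Sum>w\<in>insert w0 W. \<bar>w \<bullet> exponent_point j - b w\<bar>))))"
    proof (intro sum_mono powr_mono)
      fix j
      have "(\<Sum>w\<in>insert w0 W. \<bar>w \<bullet> pt j - b w\<bar>) = \<bar>w0 \<bullet> pt j - L\<bar> + (\<Sum>w\<in>W. \<bar>w \<bullet> pt j\<bar>)"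
      proof -
        have "(\<Sum>w\<in>W. \<bar>w \<bullet> pt j - b w\<bar>) = (\<Sum>w\<in>W. \<bar>w \<bullet> pt j\<bar>)"
          using nW by (intro sum.cong) (auto simp: b_def)
        then show ?thesis using nW W(3) by (simp add: b_def)
      qed
      moreover have "min \<kappa>' 1 * (\<Sum>w\<in>W. \<bar>w \<bullet> pt j\<bar>) \<le> h (pt j)"
        using mult_right_mono[of "min \<kappa>' 1" \<kappa>' "\<Sum>w\<in>W. \<bar>w \<bullet> pt j\<bar>"] W(6)[OF nonneg_pt, of j]
        by (auto simp: sum_nonneg)
      moreover have "min \<kappa>' 1 * \<bar>w0 \<bullet> pt j - L\<bar> \<le> 1 * \<bar>w0 \<bullet> pt j - L\<bar>" by (intro mult_right_mono) auto
      ultimately have "min \<kappa>' 1 * (\<Sum>w\<in>insert w0 W. \<bar>w \<bullet> pt j - b w\<bar>) \<le> h (pt j) + \<bar>w0 \<bullet> pt j - L\<bar>"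
        by (simp add: distrib_left)
      then have "\<kappa> * (min \<kappa>' 1 * (\<Sum>w\<in>insert w0 W. \<bar>w \<bullet> pt j - b w\<bar>)) \<le> \<kappa> * (h (pt j) + \<bar>w0 \<bullet> pt j - L\<bar>)"
        using assms(1) by (intro mult_left_mono) auto
      then show "- (\<kappa> * (h (pt j) + \<bar>w0 \<bullet> pt j - L\<bar>)) \<le> - (c * (\<Sum>w\<in>insert w0 W. \<bar>w \<bullet> pt j - b w\<bar>))"
        by (simp add: c_def mult.assoc)
    qed simp
    also have "\<dots> \<le> K * (1 + real R) ^ (CARD('n) - card (insert w0 W))" by (rule K)
    finally show ?thesis .
  qed
  moreover have "CARD('n) - card (insert w0 W) = nat (int CARD('n) - aff_dim C - 1)"
    using nW W(3,4) by (simp add: nat_diff_distrib)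
  ultimately show ?thesis by auto
qed

end

context germ
begin

text \<open>The conditional premise about C lets the same lemma serve a hypothesis on all compact
  faces and one on the compact faces inside C(S).\<close>

lemma low_order_face:
  assumes ex: "exact_face A u" and ne: "A \<noteq> {}" and D: "D > 0"
    and ord: "\<And>F p. F \<in> compact_faces s \<Longrightarrow> (pt ` A \<subseteq> C \<Longrightarrow> F \<subseteq> C) \<Longrightarrow>
      p \<in> torus_zeros (face_polynomial s F) \<Longrightarrow> real (order_at (face_polynomial s F) p) \<le> D"
  shows "low_order D A"
  unfolding low_order_def
proof (intro allI impI)
  fix p :: "real^'n" assume p: "\<forall>i. p $ i \<noteq> 0"
  obtain V where A: "A \<subseteq> G" and u: "\<And>i. u $ i > 0" and V: "\<And>\<alpha>. \<alpha> \<in> A \<Longrightarrow> u \<bullet> pt \<alpha> = V"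
    "\<And>\<alpha>. \<alpha> \<in> G - A \<Longrightarrow> u \<bullet> pt \<alpha> > V" using ex unfolding exact_face_def by blast
  let ?F = "convex hull (pt ` A)"
  have F: "?F \<in> compact_faces s" "face_polynomial s ?F = face_poly A"
    using compact_face_of_weights[OF A ne u V] by (simp_all add: face_poly_def[abs_def])
  have FC: "?F \<subseteq> C" if "pt ` A \<subseteq> C" using that convex_C by (rule hull_minimal)
  show "\<exists>js. partial_derivs js (face_poly A) p \<noteq> 0 \<and> real (length js) \<le> D"
  proof (cases "face_poly A p = 0")
    case False
    then show ?thesis using D by (intro exI[of _ "[]"]) auto
  next
    case True
    then have "p \<in> torus_zeros (face_polynomial s ?F)" using p F(2) by (simp add: torus_zeros_def)
    then have o: "real (order_at (face_poly A) p) \<le> D" using ord[OF F(1) FC] F(2) by simp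
    obtain \<alpha> where \<alpha>: "\<alpha> \<in> A" using ne by blast
    have "s \<alpha> \<noteq> 0" using \<alpha> A minimal_exponents_subset[of s] by (auto simp: msupp_def)
    then have "\<exists>js. partial_derivs js (face_poly A) p \<noteq> 0"
      unfolding face_poly_def[abs_def]
      by (intro ex_nonzero_partial_deriv[OF finite_subset[OF A G_finite] \<alpha>])
    then have "\<exists>m. \<exists>js. length js = m \<and> partial_derivs js (face_poly A) p \<noteq> 0" by blast
    from LeastI_ex[OF this] o show ?thesis unfolding order_at_def by auto
  qed
qed

section \<open>Truncating the dyadic decomposition\<close>

lemma dyadic_piece_trivial:
  "measure lebesgue (dyadic_piece j \<epsilon>) \<le> 4 ^ CARD('n) * 2 powr (- real (mdeg j))"
proof -
  let ?a = "\<chi> i. - (2 powr (1 - real (j i))) :: real^'n" and ?b = "\<chi> i. 2 powr (1 - real (j i)) :: real^'n"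
  have sub: "dyadic_piece j \<epsilon> \<subseteq> cbox ?a ?b"
    by (auto simp: dyadic_piece_def dyadic_box_def mem_box_cart abs_le_iff minus_le_iff)
  have "measure lebesgue (dyadic_piece j \<epsilon>) \<le> measure lebesgue (cbox ?a ?b)"
  proof (cases "dyadic_piece j \<epsilon> \<in> sets lebesgue")
    case True
    then show ?thesis using sub by (intro measure_mono_fmeasurable) auto
  next
    case False
    then show ?thesis by (simp add: measure_notin_sets)
  qed
  also have "\<dots> = (\<Prod>i\<in>UNIV. ?b $ i - ?a $ i)"
    by (simp add: content_cbox_if_cart interval_eq_empty_cart not_less)
  also have "\<dots> = (\<Prod>i\<in>(UNIV::'n set). 4 * 2 powr (- real (j i)))"
    by (intro prod.cong) (auto simp: powr_diff powr_minus divide_inverse)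
  also have "\<dots> = 4 ^ CARD('n) * 2 powr (- real (mdeg j))"
    by (simp add: prod.distrib mdeg_def powr_sum[symmetric] sum_negf)
  finally show ?thesis .
qed

lemma measure_thin_slab:
  "measure lebesgue {x\<in>cube 1. \<bar>x $ i\<bar> \<le> \<delta>} \<le> 2 ^ CARD('n) * \<delta>"
  "{x\<in>cube 1. \<bar>x $ i\<bar> \<le> \<delta>} \<in> lmeasurable" if "\<delta> \<ge> 0" for \<delta> and i :: 'n
proof -
  let ?b = "\<chi> k. if k = i then \<delta> else 1 :: real^'n"
  have "closed {x::real^'n. \<bar>x $ i\<bar> \<le> \<delta>}" by (intro closed_Collect_le continuous_intros)
  then have "compact (cube 1 \<inter> {x::real^'n. \<bar>x $ i\<bar> \<le> \<delta>})" using compact_cube by (rule compact_Int_closed[rotated])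
  moreover have "cube 1 \<inter> {x::real^'n. \<bar>x $ i\<bar> \<le> \<delta>} = {x\<in>cube 1. \<bar>x $ i\<bar> \<le> \<delta>}" by auto
  ultimately show m: "{x\<in>cube 1. \<bar>x $ i\<bar> \<le> \<delta>} \<in> lmeasurable" by (metis lmeasurable_compact)
  have sub: "{x\<in>cube 1. \<bar>x $ i\<bar> \<le> \<delta>} \<subseteq> cbox (- ?b) ?b"
    by (auto simp: cube_def mem_box_cart abs_le_iff minus_le_iff)
  have "measure lebesgue {x\<in>cube 1. \<bar>x $ i\<bar> \<le> \<delta>} \<le> measure lebesgue (cbox (- ?b) ?b)"
    using sub m by (intro measure_mono_fmeasurable) auto
  also have "\<dots> = (\<Prod>k\<in>UNIV. ?b $ k - (- ?b) $ k)"
  proof -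
    have "cbox (- ?b) ?b \<noteq> {}" using that by (auto simp: interval_eq_empty_cart not_less)
    then show ?thesis by (simp add: content_cbox_cart)
  qed
  also have "\<dots> = (\<Prod>k\<in>(UNIV::'n set). 2 * (if k = i then \<delta> else 1))" by (intro prod.cong) auto
  also have "\<dots> = 2 ^ CARD('n) * \<delta>" by (simp add: prod.distrib)
  finally show "measure lebesgue {x\<in>cube 1. \<bar>x $ i\<bar> \<le> \<delta>} \<le> 2 ^ CARD('n) * \<delta>" .
qed

lemma sublevel_lmeasurable_cube: "r \<le> r1 \<Longrightarrow> {x\<in>cube r. \<bar>S x\<bar> < \<epsilon>} \<in> lmeasurable"
  by (intro sublevel_lmeasurable[OF S_continuous] lmeasurable_compact compact_cube) (auto simp: cube_def intro: order_trans)

lemma dyadic_piece_lmeasurable: "(\<And>i. 2 powr (1 - real (j i)) \<le> r1) \<Longrightarrow> dyadic_piece j \<epsilon> \<in> lmeasurable"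
  unfolding dyadic_piece_def
  by (intro sublevel_lmeasurable[OF S_continuous] lmeasurable_compact compact_dyadic_box)
    (auto simp: cube_def dyadic_box_def intro: order_trans)

text \<open>Points with some coordinate of size at most 2^(-R) are put into thin slabs, so that only
  finitely many boxes remain.\<close>

lemma dyadic_cover:
  assumes J: "2 powr (1 - real J) \<le> r1"
  shows "measure lebesgue {x\<in>cube (2 powr (- real J)). \<bar>S x\<bar> < \<epsilon>}
    \<le> (\<Sum>j\<in>{j\<in>mbox R. \<forall>i. J \<le> j i}. measure lebesgue (dyadic_piece j \<epsilon>)) + real CARD('n) * 2 ^ CARD('n) * 2 powr (- real R)"
proof -
  let ?I = "{j\<in>mbox R. \<forall>i. J \<le> j i}"
  let ?T = "\<lambda>i. {x\<in>cube 1. \<bar>x $ i\<bar> \<le> 2 powr (- real R)} :: (real^'n) set"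
  have J': "2 powr (- real J) \<le> r1" "2 powr (- real J) \<le> (1::real)"
  proof -
    have "2 powr (- real J) \<le> 2 powr (1 - real J)" by (intro powr_mono) auto
    then show "2 powr (- real J) \<le> r1" using J by linarith
    show "2 powr (- real J) \<le> (1::real)" using powr_mono[of "- real J" 0 2] by simp
  qed
  have sub: "{x\<in>cube (2 powr (- real J)). \<bar>S x\<bar> < \<epsilon>} \<subseteq> (\<Union>j\<in>?I. dyadic_piece j \<epsilon>) \<union> (\<Union>i. ?T i)"
  proof
    fix x assume x: "x \<in> {x\<in>cube (2 powr (- real J)). \<bar>S x\<bar> < \<epsilon>}"
    show "x \<in> (\<Union>j\<in>?I. dyadic_piece j \<epsilon>) \<union> (\<Union>i. ?T i)"
    proof (cases "\<exists>i. \<bar>x $ i\<bar> \<le> 2 powr (- real R)")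
      case True
      have "x \<in> cube 1" using x J'(2) by (auto simp: cube_def intro: order_trans)
      then show ?thesis using True by blast
    next
      case False
      then have gt: "2 powr (- real R) < \<bar>x $ i\<bar>" for i by (simp add: not_le)
      have pos: "0 < \<bar>x $ i\<bar>" for i using le_less_trans[OF powr_ge_zero gt[of i]] .
      define l where "l i = - log 2 \<bar>x $ i\<bar>" for i
      have xl: "\<bar>x $ i\<bar> = 2 powr (- l i)" for i using pos[of i] by (simp add: l_def)
      have lR: "l i < real R" for i using gt[of i] unfolding xl by simp
      have lJ: "real J \<le> l i" for i
      proof -
        have "\<bar>x $ i\<bar> \<le> 2 powr (- real J)" using x by (simp add: cube_def)
        then have "2 powr (- l i) \<le> 2 powr (- real J)" by (simp only: xl)
        then show ?thesis by simp
      qed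
      \<comment> \<open>Rounding up gives l <= j <= l + 1, which is membership in the closed dyadic
        interval, and l < R gives j <= R.\<close>
      define j where "j i = nat \<lceil>l i\<rceil>" for i
      have jl: "l i \<le> real (j i)" "real (j i) \<le> l i + 1" "j i \<le> R" "J \<le> j i" for i
        using lR[of i] lJ[of i] unfolding j_def by linarith+
      have "2 powr (- real (j i)) \<le> \<bar>x $ i\<bar> \<and> \<bar>x $ i\<bar> \<le> 2 powr (1 - real (j i))" for i
        unfolding xl[of i] using jl(1,2)[of i] by (intro conjI powr_mono) auto
      then have "x \<in> dyadic_piece j \<epsilon>"
        using x by (simp add: dyadic_piece_def dyadic_box_def)
      moreover have "j \<in> ?I" using jl by (auto simp: mbox_def)
      ultimately show ?thesis by blast
    qed
  qed
  have fin: "finite ?I" by (rule finite_subset[OF Collect_restrict finite_mbox])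
  have pm: "dyadic_piece j \<epsilon> \<in> lmeasurable" if "j \<in> ?I" for j
  proof (rule dyadic_piece_lmeasurable)
    fix i
    have "2 powr (1 - real (j i)) \<le> 2 powr (1 - real J)" using that by (intro powr_mono) auto
    then show "2 powr (1 - real (j i)) \<le> r1" using J by linarith
  qed
  have Tm: "?T i \<in> lmeasurable" for i by (rule measure_thin_slab(2)) simp
  have U: "(\<Union>j\<in>?I. dyadic_piece j \<epsilon>) \<in> lmeasurable" "(\<Union>i. ?T i) \<in> lmeasurable"
    by (rule fmeasurable.finite_UN[OF fin pm], assumption, rule fmeasurable.finite_UN[OF finite Tm])
  have "measure lebesgue {x\<in>cube (2 powr (- real J)). \<bar>S x\<bar> < \<epsilon>}
      \<le> measure lebesgue ((\<Union>j\<in>?I. dyadic_piece j \<epsilon>) \<union> (\<Union>i. ?T i))"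
    by (rule measure_mono_fmeasurable[OF sub fmeasurableD[OF sublevel_lmeasurable_cube[OF J'(1)]] fmeasurable.Un[OF U]])
  also have "\<dots> \<le> measure lebesgue (\<Union>j\<in>?I. dyadic_piece j \<epsilon>) + measure lebesgue (\<Union>i. ?T i)"
    by (rule measure_Un_le[OF fmeasurableD[OF U(1)] fmeasurableD[OF U(2)]])
  also have "\<dots> \<le> (\<Sum>j\<in>?I. measure lebesgue (dyadic_piece j \<epsilon>)) + (\<Sum>i\<in>UNIV. measure lebesgue (?T i))"
    by (rule add_mono[OF measure_UNION_le[OF fin fmeasurableD[OF pm]] measure_UNION_le[OF finite fmeasurableD[OF Tm]]])
  also have "(\<Sum>i\<in>UNIV. measure lebesgue (?T i)) \<le> (\<Sum>i\<in>(UNIV::'n set). 2 ^ CARD('n) * 2 powr (- real R))"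
    by (rule sum_mono, rule measure_thin_slab(1)) simp
  finally show ?thesis by (simp add: mult.assoc)
qed

text \<open>Powers of 1 + R become powers of |ln eps| here. The restriction eps < exp (-1) gives |ln
  eps| >= 1, which absorbs additive constants.\<close>

lemma measure_le_of_piece_sums:
  assumes J: "2 powr (1 - real J) \<le> r1" and D: "D > 0" and A: "A \<ge> 0"
    and sums: "\<And>\<epsilon> R. 0 < \<epsilon> \<Longrightarrow> \<epsilon> < 1 \<Longrightarrow>
      (\<Sum>j\<in>{j\<in>mbox R. \<forall>i. J \<le> j i}. measure lebesgue (dyadic_piece j \<epsilon>)) \<le> A * (1 + real R) ^ e * \<epsilon> powr (1 / D)"
  shows "\<exists>c. \<forall>\<epsilon>. 0 < \<epsilon> \<and> \<epsilon> < exp (- 1) \<longrightarrow>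
    measure lebesgue {x\<in>cube (2 powr (- real J)). \<bar>S x\<bar> < \<epsilon>} \<le> c * \<bar>ln \<epsilon>\<bar> ^ e * \<epsilon> powr (1 / D)"
proof -
  define B where "B = 2 + 1 / (D * ln 2)"
  have B: "B > 0" using D by (simp add: B_def add_pos_pos)
  let ?n = "real CARD('n) * 2 ^ CARD('n) :: real"
  have "measure lebesgue {x\<in>cube (2 powr (- real J)). \<bar>S x\<bar> < \<epsilon>} \<le> (A * B ^ e + ?n) * \<bar>ln \<epsilon>\<bar> ^ e * \<epsilon> powr (1 / D)"
    if \<epsilon>: "0 < \<epsilon>" "\<epsilon> < exp (- 1)" for \<epsilon>
  proof -
    have "exp (- 1 :: real) < 1" by simp
    then have \<epsilon>1: "\<epsilon> < 1" using \<epsilon> by linarith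
    have "ln \<epsilon> < - 1" using \<epsilon> by (metis exp_less_cancel_iff exp_ln)
    then have l: "\<bar>ln \<epsilon>\<bar> = - ln \<epsilon>" "\<bar>ln \<epsilon>\<bar> \<ge> 1" by auto
    \<comment> \<open>The least R with 2^(-R) <= eps^(1/D), so that the slabs are
      negligible.\<close>
    define R where "R = nat \<lceil>\<bar>ln \<epsilon>\<bar> / (D * ln 2)\<rceil>"
    have q0: "\<bar>ln \<epsilon>\<bar> / (D * ln 2) \<ge> 0" using D by simp
    have R1: "\<bar>ln \<epsilon>\<bar> / (D * ln 2) \<le> real R" "real R \<le> \<bar>ln \<epsilon>\<bar> / (D * ln 2) + 1"
      unfolding R_def using q0 by linarith+
    have "1 + real R \<le> 2 * \<bar>ln \<epsilon>\<bar> + \<bar>ln \<epsilon>\<bar> / (D * ln 2)" using R1(2) l(2) by linarith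
    also have "\<dots> = B * \<bar>ln \<epsilon>\<bar>" by (simp add: B_def algebra_simps)
    finally have R2: "(1 + real R) ^ e \<le> B ^ e * \<bar>ln \<epsilon>\<bar> ^ e"
      unfolding power_mult_distrib[symmetric] by (intro power_mono) auto
    have "2 powr (- real R) \<le> 2 powr (- (\<bar>ln \<epsilon>\<bar> / (D * ln 2)))" using R1(1) by (intro powr_mono) auto
    also have "\<dots> = \<epsilon> powr (1 / D)"
      using \<epsilon> D unfolding l(1) by (simp add: powr_def field_simps)
    finally have tail: "2 powr (- real R) \<le> \<epsilon> powr (1 / D)" .
    have "1 \<le> \<bar>ln \<epsilon>\<bar> ^ e" using l(2) by simp
    then have tail': "?n * 2 powr (- real R) \<le> ?n * (\<bar>ln \<epsilon>\<bar> ^ e * \<epsilon> powr (1 / D))"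
      using tail mult_right_mono[of 1 "\<bar>ln \<epsilon>\<bar> ^ e" "\<epsilon> powr (1 / D)"] by (intro mult_left_mono) auto
    have "measure lebesgue {x\<in>cube (2 powr (- real J)). \<bar>S x\<bar> < \<epsilon>}
      \<le> A * (1 + real R) ^ e * \<epsilon> powr (1 / D) + ?n * 2 powr (- real R)"
      using dyadic_cover[OF J, of \<epsilon> R] sums[OF \<epsilon>(1) \<epsilon>1, of R] by linarith
    also have "\<dots> \<le> A * (B ^ e * \<bar>ln \<epsilon>\<bar> ^ e) * \<epsilon> powr (1 / D) + ?n * (\<bar>ln \<epsilon>\<bar> ^ e * \<epsilon> powr (1 / D))"
      using R2 tail' A by (intro add_mono mult_right_mono mult_left_mono) auto
    also have "\<dots> = (A * B ^ e + ?n) * \<bar>ln \<epsilon>\<bar> ^ e * \<epsilon> powr (1 / D)" by (simp add: algebra_simps)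
    finally show ?thesis .
  qed
  then show ?thesis by blast
qed

end

text \<open>Decay on both sides of t = 1: for t >= 1 the trivial bound 1 is better than t^(1/d), for
  t < 1 the exponent 1/D > 1/d is.\<close>

lemma min_powr_le:
  fixes t d D :: real
  assumes t: "t > 0" and d: "0 < D" "D < d"
  defines "\<theta> \<equiv> min (1 / d) (1 / D - 1 / d)"
  shows "min 1 (t powr (1 / D)) \<le> t powr (1 / d) * 2 powr (- (\<theta> * \<bar>log 2 t\<bar>))"
proof -
  define l where "l = log 2 t"
  have tl: "t = 2 powr l" using t by (simp add: l_def)
  have rhs: "t powr (1 / d) * 2 powr (- (\<theta> * \<bar>log 2 t\<bar>)) = 2 powr (l / d - \<theta> * \<bar>l\<bar>)"
    unfolding l_def[symmetric] tl by (simp add: powr_powr powr_add[symmetric])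
  show ?thesis
  proof (cases "l \<ge> 0")
    case True
    have "\<theta> * \<bar>l\<bar> \<le> 1 / d * \<bar>l\<bar>" by (intro mult_right_mono) (auto simp: \<theta>_def)
    then have "2 powr 0 \<le> 2 powr (l / d - \<theta> * \<bar>l\<bar>)" using True by (intro powr_mono) auto
    then show ?thesis unfolding rhs by simp
  next
    case False
    have "\<theta> * \<bar>l\<bar> \<le> (1 / D - 1 / d) * \<bar>l\<bar>" by (intro mult_right_mono) (auto simp: \<theta>_def)
    then have "l / D \<le> l / d - \<theta> * \<bar>l\<bar>" using False by (simp add: algebra_simps)
    then have "2 powr (l / D) \<le> 2 powr (l / d - \<theta> * \<bar>l\<bar>)" by (intro powr_mono) auto
    moreover have "t powr (1 / D) = 2 powr (l / D)" by (simp add: tl powr_powr)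
    ultimately show ?thesis unfolding rhs by (simp add: min_le_iff_disj)
  qed
qed

section \<open>The upper bounds for the three hypotheses on the orders\<close>

context germ
begin

lemma h_pt: "h (pt j) = d * real (mdeg j) - mval (pt j)"
  by (simp add: h_def inner_p exponent_point_def mdeg_def)

lemma piece_weight:
  assumes "\<epsilon> > 0"
  shows "2 powr (- real (mdeg j)) * (\<epsilon> * 2 powr mval (pt j)) powr (1 / d)
    = \<epsilon> powr (1 / d) * 2 powr (- (1 / d * h (pt j)))"
proof -
  have "- real (mdeg j) + mval (pt j) * (1 / d) = - (1 / d * h (pt j))"
    using d_pos by (simp add: h_pt field_simps)
  then show ?thesis
    using assms by (simp add: powr_mult powr_powr powr_add[symmetric] mult.left_commute)
qed

lemma ex_dyadic_radius: "\<exists>J. J0 \<le> J \<and> 2 powr (1 - real J) \<le> r1"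
proof -
  obtain k :: nat where k: "1 - log 2 r1 \<le> real k" using real_arch_simple by blast
  have "2 powr (1 - real (max J0 k)) \<le> 2 powr (log 2 r1)"
    using k by (intro powr_mono) auto
  then show ?thesis using r1 by (intro exI[of _ "max J0 k"]) auto
qed

lemma sum_pieces_le:
  assumes "\<And>j. (\<forall>i. J \<le> j i) \<Longrightarrow> measure lebesgue (dyadic_piece j \<epsilon>) \<le> f j" "\<And>j. 0 \<le> f j"
  shows "(\<Sum>j\<in>{j\<in>mbox R. \<forall>i. J \<le> j i}. measure lebesgue (dyadic_piece j \<epsilon>)) \<le> (\<Sum>j\<in>mbox R. f j)"
proof -
  have "(\<Sum>j\<in>{j\<in>mbox R. \<forall>i. J \<le> j i}. measure lebesgue (dyadic_piece j \<epsilon>)) \<le> (\<Sum>j\<in>{j\<in>mbox R. \<forall>i. J \<le> j i}. f j)"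
    using assms(1) by (intro sum_mono) auto
  also have "\<dots> \<le> (\<Sum>j\<in>mbox R. f j)"
    by (rule sum_mono2[OF finite_mbox]) (use assms(2) in auto)
  finally show ?thesis .
qed

lemma measure_upper_log:
  assumes ord: "\<And>F q. F \<in> compact_faces s \<Longrightarrow> q \<in> torus_zeros (face_polynomial s F) \<Longrightarrow>
    real (order_at (face_polynomial s F) q) \<le> d"
  shows "\<exists>r>0. r \<le> r1 \<and> (\<exists>c. \<forall>\<epsilon>. 0 < \<epsilon> \<and> \<epsilon> < exp (- 1) \<longrightarrow>
    measure lebesgue {x\<in>cube r. \<bar>S x\<bar> < \<epsilon>} \<le> c * \<bar>ln \<epsilon>\<bar> ^ nat (int CARD('n) - aff_dim C) * \<epsilon> powr (1 / d))"
proof -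
  have d0: "d > 0" by (rule d_pos)
  have "\<exists>J0 c K0. \<forall>j. (\<forall>i. J0 \<le> j i) \<and> (\<forall>\<alpha>\<in>G - G. pt j \<bullet> pt \<alpha> > mval (pt j) + K0) \<longrightarrow> piece_bound d c j"
    by (rule piece_bound_all[OF order_refl d0], erule low_order_face[OF _ _ d0], assumption, rule ord)
  then obtain J0 c where pb: "\<And>j. (\<forall>i. J0 \<le> j i) \<Longrightarrow> piece_bound d c j" by auto
  obtain J where J: "J0 \<le> J" "2 powr (1 - real J) \<le> r1" using ex_dyadic_radius by blast
  obtain K where K: "\<And>R. (\<Sum>j\<in>mbox R. 2 powr (- (1 / d * h (pt j)))) \<le> K * (1 + real R) ^ nat (int CARD('n) - aff_dim C)"
    using sum_exp_h[of "1 / d"] d0 by auto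
  have "\<exists>c. \<forall>\<epsilon>. 0 < \<epsilon> \<and> \<epsilon> < exp (- 1) \<longrightarrow>
    measure lebesgue {x\<in>cube (2 powr (- real J)). \<bar>S x\<bar> < \<epsilon>} \<le> c * \<bar>ln \<epsilon>\<bar> ^ nat (int CARD('n) - aff_dim C) * \<epsilon> powr (1 / d)"
  proof (rule measure_le_of_piece_sums[OF J(2) d0, of "\<bar>c\<bar> * \<bar>K\<bar>"])
    fix \<epsilon> :: real and R assume \<epsilon>: "0 < \<epsilon>" "\<epsilon> < 1"
    have "(\<Sum>j\<in>{j\<in>mbox R. \<forall>i. J \<le> j i}. measure lebesgue (dyadic_piece j \<epsilon>))
        \<le> (\<Sum>j\<in>mbox R. \<bar>c\<bar> * (\<epsilon> powr (1 / d) * 2 powr (- (1 / d * h (pt j)))))"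
    proof (rule sum_pieces_le)
      fix j :: "'n \<Rightarrow> nat" assume "\<forall>i. J \<le> j i"
      then have "piece_bound d \<bar>c\<bar> j" using J(1) by (intro piece_bound_mono[OF pb]) (auto intro: order_trans)
      then show "measure lebesgue (dyadic_piece j \<epsilon>) \<le> \<bar>c\<bar> * (\<epsilon> powr (1 / d) * 2 powr (- (1 / d * h (pt j))))"
        unfolding piece_weight[OF \<epsilon>(1), symmetric] using \<epsilon> by (simp add: piece_bound_def)
    qed simp
    also have "\<dots> = \<bar>c\<bar> * \<epsilon> powr (1 / d) * (\<Sum>j\<in>mbox R. 2 powr (- (1 / d * h (pt j))))"
      by (simp add: sum_distrib_left mult.assoc)
    also have "\<dots> \<le> \<bar>c\<bar> * \<epsilon> powr (1 / d) * (\<bar>K\<bar> * (1 + real R) ^ nat (int CARD('n) - aff_dim C))"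
      by (intro mult_left_mono order_trans[OF K] mult_right_mono) auto
    finally show "(\<Sum>j\<in>{j\<in>mbox R. \<forall>i. J \<le> j i}. measure lebesgue (dyadic_piece j \<epsilon>))
        \<le> \<bar>c\<bar> * \<bar>K\<bar> * (1 + real R) ^ nat (int CARD('n) - aff_dim C) * \<epsilon> powr (1 / d)"
      by (simp only: mult_ac)
  qed simp
  moreover have "2 powr (- real J) \<le> r1" by (rule order_trans[OF _ J(2)]) (intro powr_mono, auto)
  ultimately show ?thesis by (intro exI[of _ "2 powr (- real J)"]) auto
qed

lemma sum_mbox_geometric:
  fixes q :: real
  assumes "0 < q" "q < 1"
  shows "(\<Sum>j\<in>mbox R. q ^ mdeg (j :: 'n \<Rightarrow> nat)) \<le> (1 / (1 - q)) ^ CARD('n)"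
proof -
  have "(\<Sum>j\<in>mbox R. q ^ mdeg (j :: 'n \<Rightarrow> nat)) = (\<Sum>j\<in>mbox R. \<Prod>i\<in>(UNIV :: 'n set). q ^ j i)"
    by (simp add: mdeg_def power_sum)
  also have "\<dots> = (\<Prod>i\<in>(UNIV :: 'n set). \<Sum>k\<le>R. q ^ k)"
    unfolding mbox_def by (rule prod_sum_PiE[symmetric]) auto
  also have "\<dots> \<le> (\<Prod>i\<in>(UNIV :: 'n set). 1 / (1 - q))"
  proof (intro prod_mono conjI)
    show "0 \<le> (\<Sum>k\<le>R. q ^ k)" using assms by (intro sum_nonneg) auto
    show "(\<Sum>k\<le>R. q ^ k) \<le> 1 / (1 - q)" using assms by (simp add: sum_gp0 divide_right_mono)
  qed
  finally show ?thesis by simp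
qed

text \<open>Since m(j) <= d |j|, the j-th term is at most eps^(1/D) q^|j| with q < 1. All directions
  are damped, and no logarithm arises.\<close>

lemma measure_upper_power:
  assumes D: "D > d"
    and ord: "\<And>F q. F \<in> compact_faces s \<Longrightarrow> q \<in> torus_zeros (face_polynomial s F) \<Longrightarrow>
      real (order_at (face_polynomial s F) q) \<le> D"
  shows "\<exists>r>0. r \<le> r1 \<and> (\<exists>c. \<forall>\<epsilon>. 0 < \<epsilon> \<and> \<epsilon> < exp (- 1) \<longrightarrow>
    measure lebesgue {x\<in>cube r. \<bar>S x\<bar> < \<epsilon>} \<le> c * \<epsilon> powr (1 / D))"
proof -
  have D0: "D > 0" using D d_pos by linarith
  have "\<exists>J0 c K0. \<forall>j. (\<forall>i. J0 \<le> j i) \<and> (\<forall>\<alpha>\<in>G - G. pt j \<bullet> pt \<alpha> > mval (pt j) + K0) \<longrightarrow> piece_bound D c j"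
    by (rule piece_bound_all[OF order_refl D0], erule low_order_face[OF _ _ D0], assumption, rule ord)
  then obtain J0 c where pb: "\<And>j. (\<forall>i. J0 \<le> j i) \<Longrightarrow> piece_bound D c j" by auto
  obtain J where J: "J0 \<le> J" "2 powr (1 - real J) \<le> r1" using ex_dyadic_radius by blast
  define q where "q = 2 powr (- (1 - d / D))"
  have dD: "d / D < 1" using D D0 by simp
  have q: "0 < q" "q < 1" using dD by (auto simp: q_def powr_less_one)
  let ?K = "(1 / (1 - q)) ^ CARD('n)"
  have "\<exists>c. \<forall>\<epsilon>. 0 < \<epsilon> \<and> \<epsilon> < exp (- 1) \<longrightarrow>
    measure lebesgue {x\<in>cube (2 powr (- real J)). \<bar>S x\<bar> < \<epsilon>} \<le> c * \<bar>ln \<epsilon>\<bar> ^ 0 * \<epsilon> powr (1 / D)"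
  proof (rule measure_le_of_piece_sums[OF J(2) D0, of "\<bar>c\<bar> * ?K"])
    fix \<epsilon> :: real and R assume \<epsilon>: "0 < \<epsilon>" "\<epsilon> < 1"
    have "(\<Sum>j\<in>{j\<in>mbox R. \<forall>i. J \<le> j i}. measure lebesgue (dyadic_piece j \<epsilon>))
        \<le> (\<Sum>j\<in>mbox R. \<bar>c\<bar> * (\<epsilon> powr (1 / D) * q ^ mdeg (j :: 'n \<Rightarrow> nat)))"
    proof (rule sum_pieces_le)
      fix j :: "'n \<Rightarrow> nat" assume "\<forall>i. J \<le> j i"
      then have "piece_bound D \<bar>c\<bar> j" using J(1) by (intro piece_bound_mono[OF pb]) (auto intro: order_trans)
      then have "measure lebesgue (dyadic_piece j \<epsilon>)
          \<le> \<bar>c\<bar> * (2 powr (- real (mdeg j)) * (\<epsilon> * 2 powr mval (pt j)) powr (1 / D))"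
        using \<epsilon> by (simp add: piece_bound_def)
      also have "\<dots> \<le> \<bar>c\<bar> * (\<epsilon> powr (1 / D) * q ^ mdeg j)"
      proof (intro mult_left_mono)
        have "mval (pt j) \<le> d * real (mdeg j)" using h_nonneg[OF nonneg_pt, of j] by (simp add: h_pt)
        then have "mval (pt j) / D \<le> d * real (mdeg j) / D" using D0 by (intro divide_right_mono) auto
        then have "- real (mdeg j) + mval (pt j) / D \<le> - (1 - d / D) * real (mdeg j)" by (simp add: algebra_simps)
        then have le: "2 powr (- real (mdeg j) + mval (pt j) / D) \<le> 2 powr (- (1 - d / D) * real (mdeg j))" by (intro powr_mono) auto
        have "2 powr (- real (mdeg j)) * (\<epsilon> * 2 powr mval (pt j)) powr (1 / D)
            = \<epsilon> powr (1 / D) * 2 powr (- real (mdeg j) + mval (pt j) / D)"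
          using \<epsilon> by (simp only: powr_add) (simp add: powr_mult powr_powr)
        also have "\<dots> \<le> \<epsilon> powr (1 / D) * 2 powr (- (1 - d / D) * real (mdeg j))"
          by (intro mult_left_mono le) simp
        also have "2 powr (- (1 - d / D) * real (mdeg j)) = q ^ mdeg j" by (simp add: q_def powr_power mult.commute)
        finally show "2 powr (- real (mdeg j)) * (\<epsilon> * 2 powr mval (pt j)) powr (1 / D) \<le> \<epsilon> powr (1 / D) * q ^ mdeg j" .
      qed simp
      finally show "measure lebesgue (dyadic_piece j \<epsilon>) \<le> \<bar>c\<bar> * (\<epsilon> powr (1 / D) * q ^ mdeg j)" .
    qed (use q in simp)
    also have "\<dots> = \<bar>c\<bar> * \<epsilon> powr (1 / D) * (\<Sum>j\<in>mbox R. q ^ mdeg (j :: 'n \<Rightarrow> nat))"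
      by (simp add: sum_distrib_left mult.assoc)
    also have "\<dots> \<le> \<bar>c\<bar> * \<epsilon> powr (1 / D) * ?K"
      using sum_mbox_geometric[OF q] by (intro mult_left_mono) auto
    finally show "(\<Sum>j\<in>{j\<in>mbox R. \<forall>i. J \<le> j i}. measure lebesgue (dyadic_piece j \<epsilon>))
        \<le> \<bar>c\<bar> * ?K * (1 + real R) ^ 0 * \<epsilon> powr (1 / D)"
      by (simp only: mult_ac power_0 mult_1_left mult_1_right)
  qed (use q in simp)
  moreover have "2 powr (- real J) \<le> r1" by (rule order_trans[OF _ J(2)]) (intro powr_mono, auto)
  ultimately show ?thesis by (intro exI[of _ "2 powr (- real J)"]) auto
qed

text \<open>Boxes at which every exponent off C(S) is far from minimal see only faces inside C(S),
  where the order is at most some D < d; this yields decay in |m(j) - log(1/eps)|. At the other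
  boxes an exponent off C(S) is nearly minimal, which itself acts as a transversal damping.\<close>

lemma measure_upper_log_sharp:
  assumes ord: "\<And>F q. F \<in> compact_faces s \<Longrightarrow> q \<in> torus_zeros (face_polynomial s F) \<Longrightarrow>
      real (order_at (face_polynomial s F) q) \<le> d"
    and ordC: "\<And>F q. F \<in> compact_faces s \<Longrightarrow> F \<subseteq> C \<Longrightarrow> q \<in> torus_zeros (face_polynomial s F) \<Longrightarrow>
      real (order_at (face_polynomial s F) q) \<noteq> d"
  shows "\<exists>r>0. r \<le> r1 \<and> (\<exists>c. \<forall>\<epsilon>. 0 < \<epsilon> \<and> \<epsilon> < exp (- 1) \<longrightarrow>
    measure lebesgue {x\<in>cube r. \<bar>S x\<bar> < \<epsilon>} \<le> c * \<bar>ln \<epsilon>\<bar> ^ nat (int CARD('n) - aff_dim C - 1) * \<epsilon> powr (1 / d))"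
proof -
  let ?e = "nat (int CARD('n) - aff_dim C - 1)"
  have d0: "d > 0" by (rule d_pos)
  \<comment> \<open>Orders are integers, so those below d are at most the largest integer below d; d
    / 2 keeps D positive if that integer is 0.\<close>
  define D where "D = max (real_of_int (\<lceil>d\<rceil> - 1)) (d / 2)"
  have D: "0 < D" "D < d" unfolding D_def using d0 by linarith+
  have ordD: "real m \<le> D" if "real m \<le> d" "real m \<noteq> d" for m :: nat
  proof -
    have "int m \<le> \<lceil>d\<rceil> - 1" using that by linarith
    then have "real m \<le> real_of_int (\<lceil>d\<rceil> - 1)" by linarith
    then show ?thesis by (simp add: D_def)
  qed
  define G0 where "G0 = {\<alpha>\<in>G. pt \<alpha> \<in> C}"
  have "\<exists>J0 c K0. \<forall>j. (\<forall>i. J0 \<le> j i) \<and> (\<forall>\<alpha>\<in>G - G. pt j \<bullet> pt \<alpha> > mval (pt j) + K0) \<longrightarrow> piece_bound d c j"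
    by (rule piece_bound_all[OF order_refl d0], erule low_order_face[OF _ _ d0], assumption, rule ord)
  then obtain J1 c1 where pb: "\<And>j. (\<forall>i. J1 \<le> j i) \<Longrightarrow> piece_bound d c1 j" by auto
  have "\<exists>J0 c K0. \<forall>j. (\<forall>i. J0 \<le> j i) \<and> (\<forall>\<alpha>\<in>G - G0. pt j \<bullet> pt \<alpha> > mval (pt j) + K0) \<longrightarrow> piece_bound D c j"
  proof (rule piece_bound_all[OF _ D(1)])
    show "G0 \<subseteq> G" by (auto simp: G0_def)
    fix A u assume A: "A \<subseteq> G0" "exact_face A u" "A \<noteq> {}"
    show "low_order D A"
    proof (rule low_order_face[OF A(2,3) D(1)])
      fix F q assume F: "F \<in> compact_faces s" "pt ` A \<subseteq> C \<Longrightarrow> F \<subseteq> C" "q \<in> torus_zeros (face_polynomial s F)"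
      have "F \<subseteq> C" using F(2) A(1) by (auto simp: G0_def)
      then show "real (order_at (face_polynomial s F) q) \<le> D"
        using ordD[OF ord[OF F(1,3)]] ordC[OF F(1) _ F(3)] by blast
    qed
  qed
  then obtain J2 c2 K2 where pb2: "\<And>j. (\<forall>i. J2 \<le> j i) \<Longrightarrow> (\<forall>\<alpha>\<in>G - G0. pt j \<bullet> pt \<alpha> > mval (pt j) + K2)
      \<Longrightarrow> piece_bound D c2 j" by blast
  obtain J where J: "max J1 J2 \<le> J" "2 powr (1 - real J) \<le> r1" using ex_dyadic_radius by blast
  define \<theta> where "\<theta> = min (1 / d) (1 / D - 1 / d)"
  have \<theta>: "\<theta> > 0" using D by (simp add: \<theta>_def field_simps)
  \<comment> \<open>Only half of the decay in h is kept. The other half pays for replacing m(j),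
    respectively the minimal value at \<alpha>, by a linear functional up to an error h.\<close>
  define \<kappa> where "\<kappa> = min (1 / (2 * d)) \<theta>"
  have \<kappa>: "\<kappa> > 0" "\<kappa> \<le> \<theta>" "2 * \<kappa> \<le> 1 / d" using \<theta> d0 by (auto simp: \<kappa>_def min_def field_simps)
  have \<kappa>h: "\<kappa> * (2 * h (pt j)) \<le> 1 / d * h (pt j)" for j
    using mult_right_mono[OF \<kappa>(3) h_nonneg[OF nonneg_pt, of j]] by (simp add: mult_ac)
  obtain Kp where Kp: "\<And>R L. (\<Sum>j\<in>mbox R. 2 powr (- (\<kappa> * (h (pt j) + \<bar>p \<bullet> pt j - L\<bar>)))) \<le> Kp * (1 + real R) ^ ?e"
    using sum_exp_h_transversal[OF \<kappa>(1) p_notin_span_dirs] by blast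
  have "\<forall>\<alpha>\<in>G - G0. \<exists>K. \<forall>R L. (\<Sum>j\<in>mbox R. 2 powr (- (\<kappa> * (h (pt j) + \<bar>(pt \<alpha> - p) \<bullet> pt j - L\<bar>)))) \<le> K * (1 + real R) ^ ?e"
  proof
    fix \<alpha> assume "\<alpha> \<in> G - G0"
    then have "\<alpha> \<in> msupp s" "pt \<alpha> \<notin> C" using minimal_exponents_subset[of s] by (auto simp: G0_def)
    from sum_exp_h_transversal[OF \<kappa>(1) pt_notin_span_dirs[OF this]]
    show "\<exists>K. \<forall>R L. (\<Sum>j\<in>mbox R. 2 powr (- (\<kappa> * (h (pt j) + \<bar>(pt \<alpha> - p) \<bullet> pt j - L\<bar>)))) \<le> K * (1 + real R) ^ ?e" .
  qed
  from bchoice[OF this] obtain K\<alpha> where K\<alpha>: "\<forall>\<alpha>\<in>G - G0. \<forall>R L.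
      (\<Sum>j\<in>mbox R. 2 powr (- (\<kappa> * (h (pt j) + \<bar>(pt \<alpha> - p) \<bullet> pt j - L\<bar>)))) \<le> K\<alpha> \<alpha> * (1 + real R) ^ ?e"
    by (elim exE)
  define a where "a = max (4 ^ CARD('n)) \<bar>c2\<bar>"
  have a: "0 \<le> a" "4 ^ CARD('n) \<le> a" "c2 \<le> a" by (auto simp: a_def)
  define b where "b = \<bar>c1\<bar> * 2 powr (\<kappa> * \<bar>K2\<bar>)"
  have b: "0 \<le> b" by (simp add: b_def)
  define f1 where "f1 L j = 2 powr (- (\<kappa> * (h (pt j) + \<bar>p \<bullet> pt j - L\<bar>)))" for L and j :: "'n \<Rightarrow> nat"
  define f2 where "f2 \<alpha> j = 2 powr (- (\<kappa> * (h (pt j) + \<bar>(pt \<alpha> - p) \<bullet> pt j - 0\<bar>)))" for \<alpha> j :: "'n \<Rightarrow> nat"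
  have f: "0 \<le> f1 L j" "0 \<le> f2 \<alpha> j" for L j \<alpha> by (auto simp: f1_def f2_def)
  have piece: "measure lebesgue (dyadic_piece j \<epsilon>)
      \<le> \<epsilon> powr (1 / d) * (a * f1 (- log 2 \<epsilon>) j + (\<Sum>\<alpha>\<in>G - G0. b * f2 \<alpha> j))"
    if j: "\<forall>i. J \<le> j i" and \<epsilon>: "0 < \<epsilon>" for j \<epsilon>
  proof (cases "\<forall>\<alpha>\<in>G - G0. pt j \<bullet> pt \<alpha> > mval (pt j) + K2")
    case True
    let ?t = "\<epsilon> * 2 powr mval (pt j)"
    have "\<forall>i. J2 \<le> j i" using j J(1) by (auto intro: order_trans)
    then have pa: "piece_bound D a j" using piece_bound_mono[OF pb2 a(3)] True by blast
    have A1: "measure lebesgue (dyadic_piece j \<epsilon>) \<le> a * 2 powr (- real (mdeg j)) * (?t powr (1 / D))"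
      using pa \<epsilon> by (simp add: piece_bound_def mult.assoc)
    have A2: "measure lebesgue (dyadic_piece j \<epsilon>) \<le> a * 2 powr (- real (mdeg j)) * 1"
      using order_trans[OF dyadic_piece_trivial mult_right_mono[OF a(2)]] by simp
    have "measure lebesgue (dyadic_piece j \<epsilon>) \<le> a * 2 powr (- real (mdeg j)) * min 1 (?t powr (1 / D))"
      using A1 A2 unfolding min_def by (simp split: if_split)
    also have "\<dots> \<le> a * 2 powr (- real (mdeg j)) * (?t powr (1 / d) * 2 powr (- (\<theta> * \<bar>log 2 ?t\<bar>)))"
      unfolding \<theta>_def using \<epsilon> a(1) D by (intro mult_left_mono min_powr_le) auto
    also have "\<dots> = a * (\<epsilon> powr (1 / d) * (2 powr (- (1 / d * h (pt j))) * 2 powr (- (\<theta> * \<bar>log 2 ?t\<bar>))))"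
      using piece_weight[OF \<epsilon>, of j] by (simp only: mult.assoc[symmetric]) (simp add: mult_ac)
    also have "\<dots> \<le> a * (\<epsilon> powr (1 / d) * f1 (- log 2 \<epsilon>) j)"
    proof (intro mult_left_mono)
      have lt: "log 2 ?t = mval (pt j) + log 2 \<epsilon>" using \<epsilon> by (simp add: log_mult)
      have hn: "0 \<le> h (pt j)" by (rule h_nonneg[OF nonneg_pt])
      \<comment> \<open>m(j) is not linear in j, but p.j is, and the two differ by h(j).\<close>
      have "\<bar>p \<bullet> pt j - - log 2 \<epsilon>\<bar> \<le> h (pt j) + \<bar>log 2 ?t\<bar>"
        unfolding lt using hn by (simp add: h_def)
      then have "\<kappa> * (h (pt j) + \<bar>p \<bullet> pt j - - log 2 \<epsilon>\<bar>) \<le> \<kappa> * (2 * h (pt j) + \<bar>log 2 ?t\<bar>)"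
        using \<kappa>(1) by (intro mult_left_mono) auto
      also have "\<dots> \<le> 1 / d * h (pt j) + \<theta> * \<bar>log 2 ?t\<bar>"
        using \<kappa>h[of j] mult_right_mono[OF \<kappa>(2), of "\<bar>log 2 ?t\<bar>"] by (simp add: distrib_left)
      finally show "2 powr (- (1 / d * h (pt j))) * 2 powr (- (\<theta> * \<bar>log 2 ?t\<bar>)) \<le> f1 (- log 2 \<epsilon>) j"
        unfolding f1_def powr_add[symmetric] by (intro powr_mono) auto
    qed (use a in auto)
    also have "\<dots> \<le> \<epsilon> powr (1 / d) * (a * f1 (- log 2 \<epsilon>) j + (\<Sum>\<alpha>\<in>G - G0. b * f2 \<alpha> j))"
      using b f by (simp add: distrib_left mult.left_commute sum_nonneg)
    finally show ?thesis .
  next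
    case False
    then obtain \<alpha> where \<alpha>: "\<alpha> \<in> G - G0" "pt j \<bullet> pt \<alpha> \<le> mval (pt j) + K2" by (auto simp: not_less)
    have "\<forall>i. J1 \<le> j i" using j J(1) by (auto intro: order_trans)
    then have "piece_bound d \<bar>c1\<bar> j" by (intro piece_bound_mono[OF pb]) auto
    then have "measure lebesgue (dyadic_piece j \<epsilon>) \<le> \<bar>c1\<bar> * (\<epsilon> powr (1 / d) * 2 powr (- (1 / d * h (pt j))))"
      unfolding piece_weight[OF \<epsilon>, symmetric] using \<epsilon> by (simp add: piece_bound_def)
    also have "\<dots> \<le> \<bar>c1\<bar> * (\<epsilon> powr (1 / d) * (2 powr (\<kappa> * \<bar>K2\<bar>) * f2 \<alpha> j))"
    proof (intro mult_left_mono)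
      have "mval (pt j) \<le> pt j \<bullet> pt \<alpha>" using \<alpha> by (intro mval_le_G) auto
      moreover have "(pt \<alpha> - p) \<bullet> pt j = pt j \<bullet> pt \<alpha> - mval (pt j) - h (pt j)"
        by (simp add: h_def inner_diff_left inner_commute[of "pt j"])
      ultimately have "\<bar>(pt \<alpha> - p) \<bullet> pt j - 0\<bar> \<le> h (pt j) + \<bar>K2\<bar>"
        \<comment> \<open>Here \<alpha>.j lies between m(j) and m(j) + K2, so (\<alpha> - p).j is
          -h(j) up to a bounded error.\<close>
        using \<alpha>(2) h_nonneg[OF nonneg_pt, of j] by linarith
      then have "\<kappa> * (h (pt j) + \<bar>(pt \<alpha> - p) \<bullet> pt j - 0\<bar>) \<le> \<kappa> * (2 * h (pt j) + \<bar>K2\<bar>)"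
        using \<kappa>(1) by (intro mult_left_mono) auto
      also have "\<dots> \<le> 1 / d * h (pt j) + \<kappa> * \<bar>K2\<bar>" using \<kappa>h[of j] by (simp add: distrib_left)
      finally show "2 powr (- (1 / d * h (pt j))) \<le> 2 powr (\<kappa> * \<bar>K2\<bar>) * f2 \<alpha> j"
        unfolding f2_def powr_add[symmetric] by (intro powr_mono) auto
    qed auto
    also have "\<dots> = \<epsilon> powr (1 / d) * (b * f2 \<alpha> j)" by (simp add: b_def mult_ac)
    also have "\<dots> \<le> \<epsilon> powr (1 / d) * (a * f1 (- log 2 \<epsilon>) j + (\<Sum>\<alpha>\<in>G - G0. b * f2 \<alpha> j))"
    proof (intro mult_left_mono)
      have "b * f2 \<alpha> j \<le> (\<Sum>\<alpha>\<in>G - G0. b * f2 \<alpha> j)"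
        using \<alpha>(1) G_finite b f by (intro member_le_sum) auto
      moreover have "0 \<le> a * f1 (- log 2 \<epsilon>) j" using a f by simp
      ultimately show "b * f2 \<alpha> j \<le> a * f1 (- log 2 \<epsilon>) j + (\<Sum>\<alpha>\<in>G - G0. b * f2 \<alpha> j)" by linarith
    qed simp
    finally show ?thesis .
  qed
  define A where "A = a * \<bar>Kp\<bar> + (\<Sum>\<alpha>\<in>G - G0. b * \<bar>K\<alpha> \<alpha>\<bar>)"
  have A0: "A \<ge> 0" unfolding A_def using a b by (auto intro!: add_nonneg_nonneg sum_nonneg)
  have "\<exists>c. \<forall>\<epsilon>. 0 < \<epsilon> \<and> \<epsilon> < exp (- 1) \<longrightarrow>
    measure lebesgue {x\<in>cube (2 powr (- real J)). \<bar>S x\<bar> < \<epsilon>} \<le> c * \<bar>ln \<epsilon>\<bar> ^ ?e * \<epsilon> powr (1 / d)"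
  proof (rule measure_le_of_piece_sums[OF J(2) d0 A0])
    fix \<epsilon> :: real and R assume \<epsilon>: "0 < \<epsilon>" "\<epsilon> < 1"
    let ?P = "(1 + real R) ^ ?e"
    have "(\<Sum>j\<in>{j\<in>mbox R. \<forall>i. J \<le> j i}. measure lebesgue (dyadic_piece j \<epsilon>))
        \<le> (\<Sum>j\<in>mbox R. \<epsilon> powr (1 / d) * (a * f1 (- log 2 \<epsilon>) j + (\<Sum>\<alpha>\<in>G - G0. b * f2 \<alpha> j)))"
      by (rule sum_pieces_le[OF piece[OF _ \<epsilon>(1)]], assumption)
        (use a b f in \<open>auto intro!: add_nonneg_nonneg sum_nonneg mult_nonneg_nonneg\<close>)
    also have "\<dots> = \<epsilon> powr (1 / d) * (a * (\<Sum>j\<in>mbox R. f1 (- log 2 \<epsilon>) j) + (\<Sum>\<alpha>\<in>G - G0. b * (\<Sum>j\<in>mbox R. f2 \<alpha> j)))"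
      by (simp only: sum_distrib_left[symmetric] sum.distrib sum.swap[of _ "G - G0" "mbox R"])
    also have "\<dots> \<le> \<epsilon> powr (1 / d) * (a * (\<bar>Kp\<bar> * ?P) + (\<Sum>\<alpha>\<in>G - G0. b * (\<bar>K\<alpha> \<alpha>\<bar> * ?P)))"
    proof (intro mult_left_mono add_mono sum_mono)
      show "(\<Sum>j\<in>mbox R. f1 (- log 2 \<epsilon>) j) \<le> \<bar>Kp\<bar> * ?P"
        unfolding f1_def by (rule order_trans[OF Kp]) (intro mult_right_mono, auto)
      show "(\<Sum>j\<in>mbox R. f2 \<alpha> j) \<le> \<bar>K\<alpha> \<alpha>\<bar> * ?P" if "\<alpha> \<in> G - G0" for \<alpha>
        unfolding f2_def by (rule order_trans[OF K\<alpha>[rule_format, OF that]]) (intro mult_right_mono, auto)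
    qed (use a b in auto)
    also have "\<dots> = A * ?P * \<epsilon> powr (1 / d)"
    proof -
      have "(\<Sum>\<alpha>\<in>G - G0. b * (\<bar>K\<alpha> \<alpha>\<bar> * ?P)) = (\<Sum>\<alpha>\<in>G - G0. b * \<bar>K\<alpha> \<alpha>\<bar>) * ?P"
        by (simp only: sum_distrib_right mult.assoc)
      then show ?thesis by (simp add: A_def algebra_simps)
    qed
    finally show "(\<Sum>j\<in>{j\<in>mbox R. \<forall>i. J \<le> j i}. measure lebesgue (dyadic_piece j \<epsilon>)) \<le> A * ?P * \<epsilon> powr (1 / d)" .
  qed
  moreover have "2 powr (- real J) \<le> r1" by (rule order_trans[OF _ J(2)]) (intro powr_mono, auto)
  ultimately show ?thesis by (intro exI[of _ "2 powr (- real J)"]) auto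
qed

end

section \<open>The lower bound\<close>

text \<open>The dual basis functionals extend to the whole space and are bounded.\<close>

lemma independent_coordinate_bound:
  fixes B :: "'a::euclidean_space set"
  assumes "independent B"
  shows "\<exists>N>0. \<forall>c. \<forall>u\<in>B. \<bar>c u\<bar> \<le> N * norm (\<Sum>u\<in>B. c u *\<^sub>R u)"
proof -
  have fB: "finite B" using assms by (rule independent_imp_finite)
  have "\<exists>N. \<forall>c. \<bar>c u\<bar> \<le> N * norm (\<Sum>u\<in>B. c u *\<^sub>R u)" if u: "u \<in> B" for u
  proof -
    obtain \<phi> :: "'a \<Rightarrow> real" where \<phi>: "linear \<phi>" "\<And>v. v \<in> B \<Longrightarrow> \<phi> v = (if v = u then 1 else 0)"
      using linear_independent_extend[OF assms, of "\<lambda>v. if v = u then 1 else 0 :: real"] by blast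
    obtain N where N: "\<And>x. norm (\<phi> x) \<le> N * norm x" using linear_bounded[OF \<phi>(1)] by blast
    have "\<phi> (\<Sum>v\<in>B. c v *\<^sub>R v) = c u" for c
    proof -
      have "\<phi> (\<Sum>v\<in>B. c v *\<^sub>R v) = (\<Sum>v\<in>B. c v * \<phi> v)"
        by (simp add: linear_sum[OF \<phi>(1)] linear_cmul[OF \<phi>(1)])
      also have "\<dots> = (\<Sum>v\<in>B. if v = u then c u else 0)" using \<phi>(2) by (intro sum.cong) auto
      finally show ?thesis using u fB by simp
    qed
    then show ?thesis using N by (metis real_norm_def)
  qed
  then obtain N where N: "\<And>u c. u \<in> B \<Longrightarrow> \<bar>c u\<bar> \<le> N u * norm (\<Sum>u\<in>B. c u *\<^sub>R u)"
    by metis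
  have "\<bar>c u\<bar> \<le> (1 + (\<Sum>u\<in>B. \<bar>N u\<bar>)) * norm (\<Sum>u\<in>B. c u *\<^sub>R u)" if u: "u \<in> B" for c u
  proof -
    have "\<bar>N u\<bar> \<le> (\<Sum>u\<in>B. \<bar>N u\<bar>)" using u fB by (intro member_le_sum) auto
    then have "N u \<le> 1 + (\<Sum>u\<in>B. \<bar>N u\<bar>)" by linarith
    then show ?thesis using N[OF u, of c] by (meson mult_right_mono norm_ge_zero order_trans)
  qed
  moreover have "0 < 1 + (\<Sum>u\<in>B. \<bar>N u\<bar>)" by (intro add_pos_nonneg sum_nonneg) auto
  ultimately show ?thesis by blast
qed

text \<open>Open and in the positive orthant, so that different indices give disjoint boxes whose
  measures add up.\<close>

definition pos_box :: "('n::finite \<Rightarrow> nat) \<Rightarrow> (real^'n) set" where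
  "pos_box j = box (\<chi> i. 2 powr (- real (j i) - 1)) (\<chi> i. 2 powr (- real (j i)))"

lemma mem_pos_box: "x \<in> pos_box j \<longleftrightarrow> (\<forall>i. 2 powr (- real (j i) - 1) < x $ i \<and> x $ i < 2 powr (- real (j i)))"
  by (simp add: pos_box_def mem_box_cart)

lemma measure_pos_box: "measure lebesgue (pos_box j :: (real^'n::finite) set) = 2 powr (- real (mdeg j) - real CARD('n))"
proof -
  let ?a = "\<chi> i::'n. 2 powr (- real (j i) - 1)" and ?b = "\<chi> i::'n. 2 powr (- real (j i))"
  have "2 powr (- real (j i) - 1) \<le> (2::real) powr (- real (j i))" for i by (intro powr_mono) auto
  then have "cbox ?a ?b \<noteq> {}" by (auto simp: interval_eq_empty_cart not_less)
  then have "measure lebesgue (pos_box j :: (real^'n) set) = (\<Prod>i\<in>UNIV. ?b $ i - ?a $ i)"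
    unfolding pos_box_def by (simp add: measure_lborel_box_eq measure_lborel_cbox_eq[symmetric] content_cbox_cart)
  also have "\<dots> = (\<Prod>i\<in>UNIV. 2 powr (- real (j i) - 1))"
    by (intro prod.cong) (auto simp: powr_diff)
  also have "\<dots> = 2 powr (\<Sum>i\<in>UNIV. - real (j i) - 1)" by (simp add: powr_sum)
  also have "(\<Sum>i\<in>UNIV. - real (j i) - 1) = - real (mdeg j) - real CARD('n)"
    by (simp add: mdeg_def sum_subtractf sum_negf)
  finally show ?thesis .
qed

lemma disjnt_pos_box:
  fixes j j' :: "'n::finite \<Rightarrow> nat"
  assumes "j \<noteq> j'"
  shows "disjnt (pos_box j :: (real^'n) set) (pos_box j')"
proof -
  have *: "pos_box j \<inter> pos_box j' = ({} :: (real^'n) set)" if lt: "j i < j' i" for j j' :: "'n \<Rightarrow> nat" and i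
  proof -
    have "x \<notin> pos_box j \<inter> pos_box j'" for x :: "real^'n"
    proof
      assume x: "x \<in> pos_box j \<inter> pos_box j'"
      have "x $ i < 2 powr (- real (j' i))" using x by (simp add: mem_pos_box)
      also have "\<dots> \<le> 2 powr (- real (j i) - 1)" using lt by (intro powr_mono) auto
      also have "\<dots> < x $ i" using x by (simp add: mem_pos_box)
      finally show False .
    qed
    then show ?thesis by blast
  qed
  obtain i where "j i \<noteq> j' i" using assms by blast
  then consider "j i < j' i" | "j' i < j i" by linarith
  then show ?thesis using *[of j i j'] *[of j' i j] by cases (auto simp: disjnt_def)
qed

context germ
begin

text \<open>Every monomial of the series is a multiple of a minimal one. The minimal factor is at
  most 2^(-m(y)), and the cofactor is controlled by the convergence at \<open>r1\<close>.\<close>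

lemma abs_S_le:
  "\<exists>M\<ge>1. \<forall>x y. x \<in> cube r1 \<and> (\<forall>i. \<bar>x $ i\<bar> \<le> 2 powr (- (y $ i))) \<longrightarrow> \<bar>S x\<bar> \<le> M * 2 powr (- mval y)"
proof -
  obtain B where B: "((\<lambda>\<alpha>. \<bar>s \<alpha>\<bar> * r1 ^ mdeg \<alpha>) has_sum B) UNIV"
    using s_summable by (auto simp: summable_on_def)
  define Dg where "Dg = (\<Sum>g\<in>G. mdeg g)"
  have Dg: "mdeg g \<le> Dg" if "g \<in> G" for g
    unfolding Dg_def using that G_finite by (intro member_le_sum) auto
  have "\<bar>S x\<bar> \<le> max 1 (B / r1 ^ Dg) * 2 powr (- mval y)"
    if x: "x \<in> cube r1" and y: "\<forall>i. \<bar>x $ i\<bar> \<le> 2 powr (- (y $ i))" for x y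
  proof -
    let ?c = "2 powr (- mval y) / r1 ^ Dg"
    have tb: "\<bar>s \<alpha> * mpow x \<alpha>\<bar> \<le> \<bar>s \<alpha>\<bar> * r1 ^ mdeg \<alpha> * ?c" for \<alpha>
    proof (cases "s \<alpha> = 0")
      case False
      then have "\<alpha> \<in> msupp s" by (simp add: msupp_def)
      then obtain g where g: "g \<in> G" "g \<le> \<alpha>" using ex_minimal_exponent_le by blast
      have split: "\<bar>mpow x \<alpha>\<bar> = \<bar>mpow x g\<bar> * \<bar>mpow x (\<lambda>i. \<alpha> i - g i)\<bar>"
        unfolding abs_mult[symmetric] mpow_def prod.distrib[symmetric] power_add[symmetric]
        using g(2) by (simp add: le_fun_def)
      have "\<bar>mpow x g\<bar> \<le> mpow (rescale y (\<chi> i. 1)) g"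
        unfolding abs_mpow using y by (intro mpow_mono) (auto simp: rescale_def)
      also have "\<dots> = 2 powr (- (y \<bullet> pt g))" by (simp add: mpow_rescale mpow_const)
      also have "\<dots> \<le> 2 powr (- mval y)" using mval_le_G[OF g(1), of y] by (intro powr_mono) auto
      finally have 1: "\<bar>mpow x g\<bar> \<le> 2 powr (- mval y)" .
      have "mdeg \<alpha> = mdeg g + mdeg (\<lambda>i. \<alpha> i - g i)"
        unfolding mdeg_def sum.distrib[symmetric] using g(2) by (intro sum.cong) (auto simp: le_fun_def)
      then have dle: "mdeg \<alpha> \<le> mdeg (\<lambda>i. \<alpha> i - g i) + Dg" using Dg[OF g(1)] by simp
      have "\<bar>mpow x (\<lambda>i. \<alpha> i - g i)\<bar> \<le> r1 ^ mdeg (\<lambda>i. \<alpha> i - g i)"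
        using x by (intro abs_mpow_le) (simp add: cube_def)
      also have "\<dots> \<le> r1 ^ mdeg \<alpha> / r1 ^ Dg"
      proof -
        have "r1 ^ (mdeg (\<lambda>i. \<alpha> i - g i) + Dg) \<le> r1 ^ mdeg \<alpha>" using dle r1 by (intro power_decreasing) auto
        then show ?thesis using r1 by (simp add: pos_le_divide_eq power_add)
      qed
      finally have "\<bar>mpow x \<alpha>\<bar> \<le> 2 powr (- mval y) * (r1 ^ mdeg \<alpha> / r1 ^ Dg)"
        unfolding split using 1 by (intro mult_mono) auto
      then have "\<bar>s \<alpha>\<bar> * \<bar>mpow x \<alpha>\<bar> \<le> \<bar>s \<alpha>\<bar> * (2 powr (- mval y) * (r1 ^ mdeg \<alpha> / r1 ^ Dg))"
        by (intro mult_left_mono) auto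
      then show ?thesis by (simp add: abs_mult mult_ac)
    qed simp
    have hB: "((\<lambda>\<alpha>. \<bar>s \<alpha>\<bar> * r1 ^ mdeg \<alpha> * ?c) has_sum B * ?c) UNIV" by (rule has_sum_cmult_left[OF B])
    have "S x \<le> B * ?c" by (rule has_sum_mono[OF S_sum[OF x] hB]) (rule abs_le_D1[OF tb])
    moreover have "- S x \<le> B * ?c" by (rule has_sum_mono[OF has_sum_uminusI[OF S_sum[OF x]] hB]) (rule abs_le_D2[OF tb])
    ultimately have "\<bar>S x\<bar> \<le> B / r1 ^ Dg * 2 powr (- mval y)" by (simp add: abs_le_iff)
    also have "\<dots> \<le> max 1 (B / r1 ^ Dg) * 2 powr (- mval y)" by (intro mult_right_mono) auto
    finally show ?thesis .
  qed
  then show ?thesis by (intro exI[of _ "max 1 (B / r1 ^ Dg)"]) auto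
qed

text \<open>Exponents are nonnegative, so rounding a vector up to a lattice point cannot lower its
  level.\<close>

lemma mval_mono:
  assumes "\<And>i. y $ i \<le> z $ i"
  shows "mval y \<le> mval z"
proof -
  obtain g where g: "g \<in> G" "mval z = z \<bullet> pt g" using mval_attained by blast
  have "mval y \<le> y \<bullet> pt g" by (rule mval_le_G[OF g(1)])
  also have "\<dots> \<le> z \<bullet> pt g"
    unfolding inner_commute[of _ "pt g"] by (intro inner_nonneg_mono) (auto simp: exponent_point_def assms)
  finally show ?thesis using g(2) by simp
qed

lemma normal_cone_sum:
  assumes "\<And>u. u \<in> B \<Longrightarrow> u \<in> normal_cone" "\<And>u. u \<in> B \<Longrightarrow> 0 \<le> c u"
  shows "(\<Sum>u\<in>B. c u *\<^sub>R u) \<in> normal_cone"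
  unfolding normal_cone_def
proof (intro CollectI ballI)
  fix x assume "x \<in> N"
  then have "u \<bullet> p \<le> u \<bullet> x" if "u \<in> B" for u using assms(1)[OF that] by (simp add: normal_cone_def)
  then show "(\<Sum>u\<in>B. c u *\<^sub>R u) \<bullet> p \<le> (\<Sum>u\<in>B. c u *\<^sub>R u) \<bullet> x"
    using assms(2) by (simp add: inner_sum_left sum_mono mult_left_mono)
qed

lemma p_inner_pos:
  assumes "u \<in> normal_cone" "u \<noteq> 0"
  shows "0 < p \<bullet> u"
proof -
  have u: "nonneg_vec u" by (rule normal_cone_nonneg[OF assms(1)])
  obtain i where "u $ i \<noteq> 0" using assms(2) by (auto simp: vec_eq_iff)
  then have "0 < u $ i" using u by (metis less_le)
  then have "0 < (\<Sum>i\<in>UNIV. u $ i)" using u by (intro sum_pos2[of _ i]) auto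
  then show ?thesis using d_pos by (simp add: inner_p)
qed

text \<open>The exponents are obtained by rounding up integer combinations of a basis contained in the
  normal cone; the coefficient of one basis vector is adjusted to reach the level \<open>\<Lambda>\<close>.\<close>

lemma many_exponents:
  defines "e \<equiv> nat (int CARD('n) - aff_dim C - 1)"
  shows "\<exists>c>0. \<exists>a. \<forall>\<Lambda>>0. \<exists>X. finite X \<and> (c * \<Lambda>) ^ e \<le> real (card X) \<and>
    (\<forall>j\<in>X. (\<forall>i. J \<le> j i) \<and> \<Lambda> \<le> mval (pt j) \<and> real (mdeg j) \<le> \<Lambda> / d + a)"
proof -
  obtain B where B: "B \<subseteq> normal_cone" "independent B" "finite B" "int (card B) = int CARD('n) - aff_dim C"
    using ex_independent_normal_cone by blast
  have "int (card B) > 0" using B(4) aff_dim_C_less(1) by linarith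
  then have "B \<noteq> {}" by auto
  then obtain u0 where u0: "u0 \<in> B" by auto
  define B' where "B' = B - {u0}"
  have B': "finite B'" "card B' = e" using B u0 by (auto simp: B'_def e_def nat_diff_distrib)
  have pos: "0 < p \<bullet> u" if "u \<in> B" for u
    using that B dependent_zero p_inner_pos by (metis subsetD)
  obtain N where N: "N > 0" "\<And>c u. u \<in> B \<Longrightarrow> \<bar>c u\<bar> \<le> N * norm (\<Sum>u\<in>B. c u *\<^sub>R u)"
    using independent_coordinate_bound[OF B(2)] by blast
  \<comment> \<open>Combinations whose coefficients differ by a multiple of \<kappa> are so far
    apart that rounding cannot identify them: equal roundings are at distance at most n, so their
    coefficients differ by at most N n < \<kappa>.\<close>
  define \<kappa> where "\<kappa> = N * real CARD('n) + 1"
  have \<kappa>: "\<kappa> > 0" "N * real CARD('n) < \<kappa>" using N(1) by (auto simp: \<kappa>_def add_nonneg_pos)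
  define P where "P = (\<Sum>u\<in>B. p \<bullet> u)"
  have P: "P > 0" unfolding P_def using pos B(3) u0 by (intro sum_pos2[of _ u0]) (auto intro: less_imp_le)
  \<comment> \<open>With coefficients up to \<kappa> c \<Lambda> on the other basis vectors the
    level used does not exceed \<Lambda>, so the coefficient left for \<open>u0\<close> is
    nonnegative.\<close>
  define c where "c = 1 / (\<kappa> * P)"
  have c: "c > 0" using \<kappa> P by (simp add: c_def)
  have "\<exists>X. finite X \<and> (c * \<Lambda>) ^ e \<le> real (card X) \<and>
    (\<forall>j\<in>X. (\<forall>i. J \<le> j i) \<and> \<Lambda> \<le> mval (pt j) \<and> real (mdeg j) \<le> \<Lambda> / d + real CARD('n) * (real J + 1))"
    if \<Lambda>: "\<Lambda> > 0" for \<Lambda>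
  proof -
    define T where "T = nat \<lfloor>c * \<Lambda>\<rfloor>"
    have c\<Lambda>: "0 \<le> c * \<Lambda>" using c \<Lambda> by simp
    have T: "real T \<le> c * \<Lambda>" "c * \<Lambda> \<le> real (T + 1)" unfolding T_def using c\<Lambda> by linarith+
    define Y where "Y = (B' \<rightarrow>\<^sub>E {..T})"
    define co where "co t u = (if u = u0 then (\<Lambda> - \<kappa> * (\<Sum>v\<in>B'. real (t v) * (p \<bullet> v))) / (p \<bullet> u0) else \<kappa> * real (t u))"
      for t :: "real^'n \<Rightarrow> nat" and u
    define y where "y t = (\<Sum>u\<in>B. co t u *\<^sub>R u)" for t
    define j where "j t i = J + nat \<lceil>y t $ i\<rceil>" for t i
    have co0: "0 \<le> co t u" if t: "t \<in> Y" and u: "u \<in> B" for t u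
    proof (cases "u = u0")
      case True
      have "(\<Sum>v\<in>B'. real (t v) * (p \<bullet> v)) \<le> (\<Sum>v\<in>B'. real T * (p \<bullet> v))"
        using t pos by (intro sum_mono mult_right_mono) (auto simp: Y_def B'_def intro: less_imp_le)
      also have "\<dots> \<le> real T * P"
        unfolding P_def sum_distrib_left[symmetric] using pos B(3)
        by (intro mult_left_mono sum_mono2) (auto simp: B'_def intro: less_imp_le)
      finally have "\<kappa> * (\<Sum>v\<in>B'. real (t v) * (p \<bullet> v)) \<le> \<kappa> * (c * \<Lambda> * P)"
        using T(1) P \<kappa> by (intro mult_left_mono order_trans[OF _ mult_right_mono[OF T(1)]]) auto
      also have "\<dots> = \<Lambda>" using \<kappa> P by (simp add: c_def)
      finally show ?thesis using True pos[OF u0] by (simp add: co_def)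
    next
      case False
      then show ?thesis using \<kappa> by (simp add: co_def)
    qed
    have yn: "y t \<in> normal_cone" if "t \<in> Y" for t
      unfolding y_def using B(1) co0[OF that] by (intro normal_cone_sum) auto
    have py: "p \<bullet> y t = \<Lambda>" for t
    proof -
      have "p \<bullet> y t = co t u0 * (p \<bullet> u0) + (\<Sum>u\<in>B'. co t u * (p \<bullet> u))"
        unfolding y_def B'_def using u0 B(3) by (simp add: sum.remove[of B u0] inner_add_right inner_sum_right)
      also have "(\<Sum>u\<in>B'. co t u * (p \<bullet> u)) = \<kappa> * (\<Sum>v\<in>B'. real (t v) * (p \<bullet> v))"
        unfolding sum_distrib_left by (intro sum.cong) (auto simp: co_def B'_def)
      finally show ?thesis using pos[OF u0] by (simp add: co_def)
    qed
    have jy: "y t $ i \<le> real (j t i)" "real (j t i) \<le> y t $ i + 1 + real J" "J \<le> j t i" if "t \<in> Y" for t i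
    proof -
      have "0 \<le> y t $ i" using normal_cone_nonneg[OF yn[OF that]] by blast
      then show "y t $ i \<le> real (j t i)" "real (j t i) \<le> y t $ i + 1 + real J" "J \<le> j t i"
        unfolding j_def by linarith+
    qed
    have inj: "inj_on j Y"
    proof
      fix t t' assume t: "t \<in> Y" "t' \<in> Y" "j t = j t'"
      have "norm (y t - y t') \<le> (\<Sum>i\<in>UNIV. \<bar>(y t - y t') $ i\<bar>)" by (rule norm_le_l1_cart)
      also have "\<dots> \<le> (\<Sum>i\<in>(UNIV::'n set). 1)"
      proof (rule sum_mono)
        fix i
        have "nat \<lceil>y t $ i\<rceil> = nat \<lceil>y t' $ i\<rceil>" using fun_cong[OF t(3), of i] by (simp add: j_def)
        moreover have "0 \<le> y t $ i" "0 \<le> y t' $ i" using normal_cone_nonneg[OF yn] t by blast+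
        ultimately show "\<bar>(y t - y t') $ i\<bar> \<le> 1" unfolding vector_minus_component by linarith
      qed
      finally have ny: "norm (y t - y t') \<le> real CARD('n)" by simp
      show "t = t'"
      proof (rule PiE_ext[OF t(1,2)[unfolded Y_def]])
        fix u assume u: "u \<in> B'"
        have "y t - y t' = (\<Sum>u\<in>B. (co t u - co t' u) *\<^sub>R u)"
          unfolding y_def by (simp add: sum_subtractf scaleR_diff_left)
        then have "\<bar>co t u - co t' u\<bar> \<le> N * norm (y t - y t')"
          using N(2)[of u "\<lambda>u. co t u - co t' u"] u by (simp add: B'_def)
        also have "\<dots> \<le> N * real CARD('n)" using ny N(1) by (intro mult_left_mono) auto
        also have "\<dots> < \<kappa>" by (rule \<kappa>(2))
        finally have "\<bar>\<kappa> * (real (t u) - real (t' u))\<bar> < \<kappa> * 1"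
          using u by (simp add: co_def B'_def right_diff_distrib)
        then have "\<bar>real (t u) - real (t' u)\<bar> < 1" using \<kappa>(1) by (simp add: abs_mult)
        then show "t u = t' u" by linarith
      qed
    qed
    have "card (j ` Y) = (T + 1) ^ e"
      using card_image[OF inj] B' by (simp add: Y_def card_PiE)
    then have "(c * \<Lambda>) ^ e \<le> real (card (j ` Y))"
      using power_mono[OF T(2) c\<Lambda>, of e] by simp
    moreover have "finite (j ` Y)" using B' by (simp add: Y_def finite_PiE)
    moreover have "(\<forall>i. J \<le> j t i) \<and> \<Lambda> \<le> mval (pt (j t)) \<and> real (mdeg (j t)) \<le> \<Lambda> / d + real CARD('n) * (real J + 1)"
      if t: "t \<in> Y" for t
    proof (intro conjI allI)
      show "J \<le> j t i" for i by (rule jy(3)[OF t])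
      have "mval (y t) = \<Lambda>" using mval_normal_cone[OF yn[OF t]] py by simp
      then show "\<Lambda> \<le> mval (pt (j t))" using mval_mono[of "y t" "pt (j t)"] jy(1)[OF t] by (simp add: exponent_point_def)
      have "real (mdeg (j t)) \<le> (\<Sum>i\<in>UNIV. y t $ i + 1 + real J)"
        unfolding mdeg_def of_nat_sum by (intro sum_mono jy(2)[OF t])
      also have "\<dots> = (\<Sum>i\<in>UNIV. y t $ i) + real CARD('n) * (real J + 1)"
        by (simp add: sum.distrib algebra_simps)
      also have "(\<Sum>i\<in>UNIV. y t $ i) = \<Lambda> / d" using py[of t] d_pos by (simp add: inner_p field_simps)
      finally show "real (mdeg (j t)) \<le> \<Lambda> / d + real CARD('n) * (real J + 1)" .
    qed
    ultimately show ?thesis by blast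
  qed
  then show ?thesis using c by blast
qed

lemma measure_lower:
  assumes \<rho>: "0 < \<rho>" "\<rho> \<le> r1"
  shows "\<exists>c>0. \<forall>\<epsilon>. 0 < \<epsilon> \<and> \<epsilon> < 1 \<longrightarrow>
    c * \<bar>ln \<epsilon>\<bar> ^ nat (int CARD('n) - aff_dim C - 1) * \<epsilon> powr (1 / d) \<le> measure lebesgue {x\<in>cube \<rho>. \<bar>S x\<bar> < \<epsilon>}"
proof -
  let ?e = "nat (int CARD('n) - aff_dim C - 1)"
  obtain M where M: "M \<ge> 1" "\<And>x y. x \<in> cube r1 \<Longrightarrow> \<forall>i. \<bar>x $ i\<bar> \<le> 2 powr (- (y $ i)) \<Longrightarrow> \<bar>S x\<bar> \<le> M * 2 powr (- mval y)"
    using abs_S_le by blast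
  obtain J :: nat where J0: "- log 2 \<rho> \<le> real J" using real_arch_simple by blast
  have J: "2 powr (- real J) \<le> \<rho>"
  proof -
    have "2 powr (- real J) \<le> 2 powr (log 2 \<rho>)" using J0 by (intro powr_mono) auto
    then show ?thesis using \<rho> by simp
  qed
  obtain c a where c: "c > 0" and many: "\<And>\<Lambda>. \<Lambda> > 0 \<Longrightarrow> \<exists>X. finite X \<and> (c * \<Lambda>) ^ ?e \<le> real (card X) \<and>
    (\<forall>j\<in>X. (\<forall>i. J \<le> j i) \<and> \<Lambda> \<le> mval (pt j) \<and> real (mdeg j) \<le> \<Lambda> / d + a)"
    using many_exponents[of J] by blast
  \<comment> \<open>The box of j has measure 2^(-|j| - n), where |j| <= \<Lambda> / d + a and
    2^(-\<Lambda>) = eps / (2 M).\<close>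
  define k where "k = 2 powr (- a - real CARD('n)) * (1 / (2 * M)) powr (1 / d)"
  have k: "k > 0" using M by (simp add: k_def)
  have "(k * (c / ln 2) ^ ?e) * \<bar>ln \<epsilon>\<bar> ^ ?e * \<epsilon> powr (1 / d) \<le> measure lebesgue {x\<in>cube \<rho>. \<bar>S x\<bar> < \<epsilon>}"
    if \<epsilon>: "0 < \<epsilon>" "\<epsilon> < 1" for \<epsilon>
  proof -
    \<comment> \<open>On the boxes of level \<Lambda> this gives |S| <= M 2^(-\<Lambda>) = eps / 2,
      strictly below eps.\<close>
    define \<Lambda> where "\<Lambda> = log 2 (2 * M / \<epsilon>)"
    have \<Lambda>: "2 powr \<Lambda> = 2 * M / \<epsilon>" using M(1) \<epsilon> by (simp add: \<Lambda>_def)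
    have "\<bar>ln \<epsilon>\<bar> / ln 2 = log 2 (1 / \<epsilon>)" using \<epsilon> by (simp add: log_def ln_div)
    also have "\<dots> \<le> \<Lambda>" unfolding \<Lambda>_def using M(1) \<epsilon> by (simp add: divide_right_mono)
    finally have \<Lambda>ge: "\<bar>ln \<epsilon>\<bar> / ln 2 \<le> \<Lambda>" .
    have "0 < \<bar>ln \<epsilon>\<bar> / ln 2" using \<epsilon> by (intro divide_pos_pos) auto
    then have \<Lambda>0: "\<Lambda> > 0" using \<Lambda>ge by linarith
    obtain X where X: "finite X" "(c * \<Lambda>) ^ ?e \<le> real (card X)" "\<And>j. j \<in> X \<Longrightarrow> \<forall>i. J \<le> j i"
        "\<And>j. j \<in> X \<Longrightarrow> \<Lambda> \<le> mval (pt j)" "\<And>j. j \<in> X \<Longrightarrow> real (mdeg j) \<le> \<Lambda> / d + a"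
      using many[OF \<Lambda>0] by blast
    have sub: "pos_box j \<subseteq> {x\<in>cube \<rho>. \<bar>S x\<bar> < \<epsilon>}" if j: "j \<in> X" for j
    proof
      fix x :: "real^'n" assume x: "x \<in> pos_box j"
      have xi: "\<bar>x $ i\<bar> \<le> 2 powr (- real (j i))" for i
      proof -
        have "0 \<le> (2::real) powr (- real (j i) - 1)" by simp
        then show ?thesis using x by (simp add: mem_pos_box less_imp_le) (smt (verit) powr_ge_zero)
      qed
      have x\<rho>: "\<bar>x $ i\<bar> \<le> \<rho>" for i
      proof -
        have "2 powr (- real (j i)) \<le> 2 powr (- real J)" using X(3)[OF j] by (intro powr_mono) auto
        then show ?thesis using xi[of i] J by linarith
      qed
      then have x1: "x \<in> cube r1" using \<rho> by (auto simp: cube_def intro: order_trans)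
      have "\<bar>S x\<bar> \<le> M * 2 powr (- mval (pt j))" using xi by (intro M(2)[OF x1]) (simp add: exponent_point_def)
      also have "\<dots> \<le> M * 2 powr (- \<Lambda>)" using X(4)[OF j] M(1) by (intro mult_left_mono powr_mono) auto
      also have "\<dots> = \<epsilon> / 2" using M(1) \<epsilon> \<Lambda> by (simp add: powr_minus field_simps)
      finally have "\<bar>S x\<bar> < \<epsilon>" using \<epsilon> by linarith
      then show "x \<in> {x\<in>cube \<rho>. \<bar>S x\<bar> < \<epsilon>}" using x\<rho> by (simp add: cube_def)
    qed
    have each: "k * \<epsilon> powr (1 / d) \<le> measure lebesgue (pos_box j :: (real^'n) set)" if j: "j \<in> X" for j
    proof -
      have "k * \<epsilon> powr (1 / d) = 2 powr (- a - real CARD('n)) * (2 powr (- \<Lambda>)) powr (1 / d)"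
        using M(1) \<epsilon> \<Lambda> by (simp add: k_def powr_minus powr_mult[symmetric] mult.assoc)
      also have "\<dots> = 2 powr (- (\<Lambda> / d + a) - real CARD('n))"
        by (simp add: powr_powr powr_add[symmetric] algebra_simps)
      also have "\<dots> \<le> 2 powr (- real (mdeg j) - real CARD('n))" using X(5)[OF j] by (intro powr_mono) auto
      finally show ?thesis by (simp add: measure_pos_box)
    qed
    have pm: "pos_box j \<in> lmeasurable" for j :: "'n \<Rightarrow> nat" by (simp add: pos_box_def)
    have "(k * (c / ln 2) ^ ?e) * \<bar>ln \<epsilon>\<bar> ^ ?e * \<epsilon> powr (1 / d) = (c * (\<bar>ln \<epsilon>\<bar> / ln 2)) ^ ?e * (k * \<epsilon> powr (1 / d))"
      by (simp add: power_mult_distrib power_divide mult_ac)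
    also have "\<dots> \<le> (c * \<Lambda>) ^ ?e * (k * \<epsilon> powr (1 / d))"
      using \<Lambda>ge c k by (intro mult_right_mono power_mono mult_left_mono) auto
    also have "\<dots> \<le> real (card X) * (k * \<epsilon> powr (1 / d))" using X(2) k by (intro mult_right_mono) auto
    also have "\<dots> = (\<Sum>j\<in>X. k * \<epsilon> powr (1 / d))" by simp
    also have "\<dots> \<le> (\<Sum>j\<in>X. measure lebesgue (pos_box j :: (real^'n) set))" by (intro sum_mono each)
    also have "\<dots> = measure lebesgue (\<Union>j\<in>X. pos_box j :: (real^'n) set)"
      by (rule measure_UNION'[symmetric, OF X(1) pm]) (auto simp: pairwise_def disjnt_pos_box)
    also have "\<dots> \<le> measure lebesgue {x\<in>cube \<rho>. \<bar>S x\<bar> < \<epsilon>}"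
      using sub by (intro measure_mono_fmeasurable sublevel_lmeasurable_cube[OF \<rho>(2)] fmeasurableD fmeasurable.finite_UN X(1) pm) blast
    finally show ?thesis .
  qed
  moreover have "k * (c / ln 2) ^ ?e > 0" using k c by simp
  ultimately show ?thesis by blast
qed

end

section \<open>Sublevel integrals\<close>

text \<open>If all coefficients were 0, S would vanish near the origin. The absolute convergence
  comes from the series at the single point with all coordinates \<open>r1\<close>, since unordered
  real sums converge absolutely.\<close>

lemma germ_of_power_series:
  fixes S :: "real^'n::finite \<Rightarrow> real"
  assumes "has_power_series S s 0" "\<not> (\<forall>\<^sub>F x in nhds 0. S x = 0)" "S 0 = 0"
  shows "\<exists>r1. germ s S r1"
proof -
  obtain r where r: "r > 0" and sum: "\<And>x. (\<forall>i. \<bar>x $ i\<bar> < r) \<Longrightarrow> ((\<lambda>\<alpha>. s \<alpha> * mpow x \<alpha>) has_sum S x) UNIV"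
    using assms(1) unfolding has_power_series_def by (auto simp: mpow_def)
  define r1 where "r1 = min (r / 2) (1 / 2)"
  have r1: "0 < r1" "r1 < 1" "r1 < r" using r by (auto simp: r1_def)
  have "germ s S r1"
  proof
    show "\<exists>\<alpha>. s \<alpha> \<noteq> 0"
    proof (rule ccontr)
      assume z: "\<nexists>\<alpha>. s \<alpha> \<noteq> 0"
      have "S x = 0" if "x \<in> ball 0 r" for x
      proof (rule has_sum_unique)
        have "\<bar>x $ i\<bar> < r" for i using component_le_norm_cart[of x i] that by simp
        then show "((\<lambda>\<alpha>. s \<alpha> * mpow x \<alpha>) has_sum S x) UNIV" by (intro sum) auto
        show "((\<lambda>\<alpha>. s \<alpha> * mpow x \<alpha>) has_sum 0) UNIV" using z by simp
      qed
      then have "\<forall>\<^sub>F x in nhds 0. S x = 0"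
        unfolding eventually_nhds using r by (intro exI[of _ "ball 0 r"]) auto
      then show False using assms(2) by blast
    qed
    show "s (\<lambda>_. 0) = 0"
    proof -
      have 1: "((\<lambda>\<alpha>. s \<alpha> * mpow 0 \<alpha>) has_sum S 0) UNIV" using r by (intro sum) auto
      have 2: "((\<lambda>\<alpha>. s \<alpha> * mpow (0::real^'n) \<alpha>) has_sum s (\<lambda>_. 0)) UNIV"
      proof (rule has_sum_finite_neutralI[of "{\<lambda>_. 0}"])
        fix \<alpha> :: "'n \<Rightarrow> nat" assume "\<alpha> \<in> UNIV - {\<lambda>_. 0}"
        then obtain i where "\<alpha> i \<noteq> 0" by auto
        then have "mpow (0::real^'n) \<alpha> = 0" unfolding mpow_def by (intro prod_zero) (auto intro!: exI[of _ i])
        then show "s \<alpha> * mpow (0::real^'n) \<alpha> = 0" by simp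
      qed (auto simp: mpow_def)
      show ?thesis using has_sum_unique[OF 1 2] assms(3) by simp
    qed
    show "0 < r1" "r1 < 1" using r1 by auto
    show "(\<lambda>\<alpha>. \<bar>s \<alpha>\<bar> * r1 ^ mdeg \<alpha>) summable_on UNIV"
    proof -
      have "((\<lambda>\<alpha>. s \<alpha> * mpow (\<chi> i. r1) \<alpha>) has_sum S (\<chi> i. r1)) UNIV" using r1 by (intro sum) auto
      then have "(\<lambda>\<alpha>. s \<alpha> * r1 ^ mdeg \<alpha>) summable_on UNIV" unfolding mpow_const by (rule has_sum_imp_summable)
      then have "(\<lambda>\<alpha>. norm (s \<alpha> * r1 ^ mdeg \<alpha>)) summable_on UNIV"
        by (rule iffD1[OF summable_on_iff_abs_summable_on_real])
      then show ?thesis using r1 by (simp add: abs_mult)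
    qed
    show "((\<lambda>\<alpha>. s \<alpha> * mpow x \<alpha>) has_sum S x) UNIV" if "x \<in> cube r1" for x
      using that r1 by (intro sum) (auto simp: cube_def intro: le_less_trans)
  qed
  then show ?thesis by blast
qed

context germ
begin

text \<open>The weight is at most its maximum on the cube that contains its support, and at least
  half of its value at 0 on a smaller cube.\<close>

lemma sublevel_integral_bounds:
  assumes r: "0 < r" "r \<le> r1" and cont: "continuous_on UNIV \<phi>" and nn: "\<And>x. \<phi> x \<ge> 0"
    and supp: "\<And>x. \<phi> x \<noteq> 0 \<Longrightarrow> x \<in> cube r" and pos: "\<phi> 0 > 0"
  shows "\<exists>B>0. \<forall>\<epsilon>. sublevel_integral S \<phi> \<epsilon> \<le> B * measure lebesgue {x\<in>cube r. \<bar>S x\<bar> < \<epsilon>}"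
    and "\<exists>\<rho>>0. \<rho> \<le> r1 \<and> (\<exists>\<delta>>0. \<forall>\<epsilon>. \<delta> * measure lebesgue {x\<in>cube \<rho>. \<bar>S x\<bar> < \<epsilon>} \<le> sublevel_integral S \<phi> \<epsilon>)"
proof -
  let ?A = "\<lambda>r \<epsilon>. {x\<in>cube r. \<bar>S x\<bar> < \<epsilon>}"
  have A: "?A t \<epsilon> \<in> sets borel" "emeasure lborel (?A t \<epsilon>) < \<infinity>" "measure lebesgue (?A t \<epsilon>) = measure lborel (?A t \<epsilon>)"
    if "t \<le> r1" for t \<epsilon>
  proof -
    have sub: "cube t \<subseteq> cube r1" using that by (auto simp: cube_def intro: order_trans)
    have "openin (top_of_set (cube r1)) (cube r1 \<inter> (\<lambda>x. \<bar>S x\<bar>) -` {..<\<epsilon>})"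
      by (rule continuous_openin_preimage_gen) (intro continuous_intros S_continuous, auto)
    then obtain T where T: "open T" "cube r1 \<inter> (\<lambda>x. \<bar>S x\<bar>) -` {..<\<epsilon>} = cube r1 \<inter> T"
      by (auto simp: openin_open)
    have "?A t \<epsilon> = cube t \<inter> T" using T(2) sub by auto
    moreover have "closed (cube t :: (real^'n) set)" by (rule compact_imp_closed[OF compact_cube])
    ultimately show b: "?A t \<epsilon> \<in> sets borel" using T(1) by auto
    have "bounded (?A t \<epsilon>)" by (rule bounded_subset[OF compact_imp_bounded[OF compact_cube]]) auto
    then show "emeasure lborel (?A t \<epsilon>) < \<infinity>" by (rule emeasure_bounded_finite)
    show "measure lebesgue (?A t \<epsilon>) = measure lborel (?A t \<epsilon>)" using b by (simp add: measure_completion)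
  qed
  have eq: "sublevel_integral S \<phi> \<epsilon> = (LINT x|lborel. indicator (?A r \<epsilon>) x * \<phi> x)" for \<epsilon>
    unfolding sublevel_integral_def set_lebesgue_integral_def
  proof (rule Bochner_Integration.integral_cong[OF refl])
    fix x show "indicator {x. \<bar>S x\<bar> < \<epsilon>} x *\<^sub>R \<phi> x = indicator (?A r \<epsilon>) x * \<phi> x"
      using supp[of x] by (cases "\<phi> x = 0") (auto simp: indicator_def)
  qed
  have "compact (\<phi> ` cube r)"
    by (rule compact_continuous_image[OF continuous_on_subset[OF cont] compact_cube]) simp
  then obtain B0 where B0: "\<And>x. x \<in> cube r \<Longrightarrow> norm (\<phi> x) \<le> B0"
    using compact_imp_bounded by (force simp: bounded_iff)
  define B where "B = max B0 1"
  have B: "B > 0" "\<And>x. x \<in> cube r \<Longrightarrow> \<phi> x \<le> B" using B0 nn by (auto simp: B_def le_max_iff_disj)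
  have \<phi>m: "\<phi> \<in> borel_measurable borel" using cont by (simp add: borel_measurable_continuous_onI)
  have intA: "integrable lborel (\<lambda>x. c * indicator (?A t \<epsilon>) x :: real)" if "t \<le> r1" for t c \<epsilon>
    using A[OF that] by simp
  have int\<phi>: "integrable lborel (\<lambda>x. indicator (?A r \<epsilon>) x * \<phi> x)" for \<epsilon>
  proof (rule Bochner_Integration.integrable_bound[OF intA[OF r(2), of B \<epsilon>]])
    have "indicat_real (?A r \<epsilon>) \<in> borel_measurable borel" using A(1)[OF r(2)] by (rule borel_measurable_indicator)
    then show "(\<lambda>x. indicator (?A r \<epsilon>) x * \<phi> x) \<in> borel_measurable lborel"
      using \<phi>m by (simp add: borel_measurable_times)
    show "AE x in lborel. norm (indicator (?A r \<epsilon>) x * \<phi> x) \<le> norm (B * indicator (?A r \<epsilon>) x)"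
      using B nn by (intro AE_I2) (auto simp: indicator_def)
  qed
  have LA: "(LINT x|lborel. c * indicator (?A t \<epsilon>) x) = c * measure lebesgue (?A t \<epsilon>)" if "t \<le> r1" for t c \<epsilon>
    using A[OF that] by simp
  have "sublevel_integral S \<phi> \<epsilon> \<le> B * measure lebesgue (?A r \<epsilon>)" for \<epsilon>
    unfolding eq LA[OF r(2), symmetric]
    by (rule integral_mono[OF int\<phi> intA[OF r(2)]]) (use B(2) in \<open>auto simp: indicator_def\<close>)
  then show "\<exists>B>0. \<forall>\<epsilon>. sublevel_integral S \<phi> \<epsilon> \<le> B * measure lebesgue (?A r \<epsilon>)" using B(1) by blast
  have "isCont \<phi> 0" using cont by (simp add: continuous_on_eq_continuous_at)
  then obtain t where t: "t > 0" "\<And>x. dist x 0 < t \<Longrightarrow> dist (\<phi> x) (\<phi> 0) < \<phi> 0 / 2"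
    using pos unfolding continuous_at_eps_delta by (metis half_gt_zero)
  \<comment> \<open>The norm is at most the sum of the n coordinates, hence at most t / 2 on this
    cube.\<close>
  define \<rho> where "\<rho> = min r (t / (2 * real CARD('n)))"
  have \<rho>: "\<rho> > 0" "\<rho> \<le> r" "\<rho> \<le> r1" using r t(1) by (auto simp: \<rho>_def)
  have low: "\<phi> 0 / 2 \<le> \<phi> x" if x: "x \<in> cube \<rho>" for x
  proof -
    have "norm x \<le> (\<Sum>i\<in>UNIV. \<bar>x $ i\<bar>)" by (rule norm_le_l1_cart)
    also have "\<dots> \<le> (\<Sum>i\<in>(UNIV::'n set). \<rho>)" using x by (intro sum_mono) (simp add: cube_def)
    also have "\<dots> \<le> real CARD('n) * (t / (2 * real CARD('n)))"
      unfolding sum_constant by (intro mult_left_mono) (auto simp: \<rho>_def)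
    also have "\<dots> < t" using t(1) by simp
    finally have "dist (\<phi> x) (\<phi> 0) < \<phi> 0 / 2" by (intro t(2)) simp
    then show ?thesis unfolding dist_real_def by linarith
  qed
  have sub: "cube \<rho> \<subseteq> (cube r :: (real^'n) set)" using \<rho>(2) by (auto simp: cube_def intro: order_trans)
  have "\<phi> 0 / 2 * measure lebesgue (?A \<rho> \<epsilon>) \<le> sublevel_integral S \<phi> \<epsilon>" for \<epsilon>
    unfolding eq LA[OF \<rho>(3), symmetric]
  proof (rule integral_mono[OF intA[OF \<rho>(3)] int\<phi>])
    fix x show "\<phi> 0 / 2 * indicator (?A \<rho> \<epsilon>) x \<le> indicator (?A r \<epsilon>) x * \<phi> x"
      using low[of x] sub nn[of x] by (auto simp: indicator_def)
  qed
  then show "\<exists>\<rho>>0. \<rho> \<le> r1 \<and> (\<exists>\<delta>>0. \<forall>\<epsilon>. \<delta> * measure lebesgue (?A \<rho> \<epsilon>) \<le> sublevel_integral S \<phi> \<epsilon>)"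
    using \<rho> pos by (intro exI[of _ \<rho>] conjI exI[of _ "\<phi> 0 / 2"]) auto
qed

definition upper_bounded :: "real \<Rightarrow> nat \<Rightarrow> real \<Rightarrow> bool" where
  "upper_bounded r e D \<longleftrightarrow> (\<exists>c. \<forall>\<epsilon>. 0 < \<epsilon> \<and> \<epsilon> < exp (- 1) \<longrightarrow>
    measure lebesgue {x\<in>cube r. \<bar>S x\<bar> < \<epsilon>} \<le> c * \<bar>ln \<epsilon>\<bar> ^ e * \<epsilon> powr (1 / D))"

lemma upper_bounded_mono:
  assumes "upper_bounded r e D" "r' \<le> r" "r \<le> r1"
  shows "upper_bounded r' e D"
proof -
  have "measure lebesgue {x\<in>cube r'. \<bar>S x\<bar> < \<epsilon>} \<le> measure lebesgue {x\<in>cube r. \<bar>S x\<bar> < \<epsilon>}" for \<epsilon>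
    using assms(2,3)
    by (intro measure_mono_fmeasurable fmeasurableD sublevel_lmeasurable_cube) (auto simp: cube_def intro: order_trans)
  then show ?thesis using assms(1) unfolding upper_bounded_def by (meson order_trans)
qed

lemma eventually_upper:
  assumes ub: "upper_bounded r e D" and B: "B > 0"
    and I: "\<And>\<epsilon>. I \<epsilon> \<le> B * measure lebesgue {x\<in>cube r. \<bar>S x\<bar> < \<epsilon>}"
  shows "\<exists>C'>0. \<forall>\<^sub>F \<epsilon> in at_right 0. I \<epsilon> < C' * \<bar>ln \<epsilon>\<bar> ^ e * \<epsilon> powr (1 / D)"
proof -
  obtain c where c: "\<And>\<epsilon>. 0 < \<epsilon> \<Longrightarrow> \<epsilon> < exp (- 1) \<Longrightarrow>
      measure lebesgue {x\<in>cube r. \<bar>S x\<bar> < \<epsilon>} \<le> c * \<bar>ln \<epsilon>\<bar> ^ e * \<epsilon> powr (1 / D)"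
    using ub unfolding upper_bounded_def by blast
  have "I \<epsilon> < (B * \<bar>c\<bar> + 1) * \<bar>ln \<epsilon>\<bar> ^ e * \<epsilon> powr (1 / D)" if \<epsilon>: "0 < \<epsilon>" "\<epsilon> < exp (- 1)" for \<epsilon>
  proof -
    have "exp (- 1 :: real) < 1" by simp
    then have "\<epsilon> < 1" using \<epsilon> by linarith
    then have pos: "0 < \<bar>ln \<epsilon>\<bar> ^ e * \<epsilon> powr (1 / D)" using \<epsilon> by simp
    have "I \<epsilon> \<le> B * (c * (\<bar>ln \<epsilon>\<bar> ^ e * \<epsilon> powr (1 / D)))"
      using order_trans[OF I mult_left_mono[OF c[OF \<epsilon>]]] B by (simp add: mult.assoc)
    also have "\<dots> \<le> B * (\<bar>c\<bar> * (\<bar>ln \<epsilon>\<bar> ^ e * \<epsilon> powr (1 / D)))"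
      using B pos by (intro mult_left_mono mult_right_mono) auto
    also have "\<dots> < B * (\<bar>c\<bar> * (\<bar>ln \<epsilon>\<bar> ^ e * \<epsilon> powr (1 / D))) + \<bar>ln \<epsilon>\<bar> ^ e * \<epsilon> powr (1 / D)" using pos by simp
    finally show ?thesis by (simp add: algebra_simps)
  qed
  then have "\<forall>\<^sub>F \<epsilon> in at_right 0. I \<epsilon> < (B * \<bar>c\<bar> + 1) * \<bar>ln \<epsilon>\<bar> ^ e * \<epsilon> powr (1 / D)"
    unfolding eventually_at_right_field by (intro exI[of _ "exp (- 1)"]) auto
  moreover have "0 < B * \<bar>c\<bar> + 1" using B by (simp add: add_nonneg_pos)
  ultimately show ?thesis by blast
qed

text \<open>The neighbourhood is chosen before the test function and before d', so one radius must
  serve every case. Each hypothesis concerns S alone and can be decided beforehand, and at most one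
  d' qualifies, being a maximum.\<close>

lemma ex_common_radius:
  "\<exists>r>0. r \<le> r1 \<and>
    ((\<forall>F\<in>compact_faces s. \<forall>p\<in>torus_zeros (face_polynomial s F). real (order_at (face_polynomial s F) p) \<le> d) \<longrightarrow>
      upper_bounded r (nat (int CARD('n) - aff_dim C)) d \<and>
      (\<not> (\<exists>F\<in>compact_faces s. F \<subseteq> C \<and> (\<exists>p\<in>torus_zeros (face_polynomial s F). real (order_at (face_polynomial s F) p) = d)) \<longrightarrow>
        upper_bounded r (nat (int CARD('n) - aff_dim C - 1)) d)) \<and>
    (\<forall>d' :: nat. (\<exists>F\<in>compact_faces s. \<exists>p\<in>torus_zeros (face_polynomial s F). order_at (face_polynomial s F) p = d') \<and>
      (\<forall>F\<in>compact_faces s. \<forall>p\<in>torus_zeros (face_polynomial s F). order_at (face_polynomial s F) p \<le> d') \<and> real d' > d \<longrightarrow>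
      upper_bounded r 0 (real d'))"
proof -
  let ?H1 = "\<forall>F\<in>compact_faces s. \<forall>p\<in>torus_zeros (face_polynomial s F). real (order_at (face_polynomial s F) p) \<le> d"
  let ?H2 = "\<not> (\<exists>F\<in>compact_faces s. F \<subseteq> C \<and> (\<exists>p\<in>torus_zeros (face_polynomial s F). real (order_at (face_polynomial s F) p) = d))"
  let ?H3 = "\<lambda>d'. (\<exists>F\<in>compact_faces s. \<exists>p\<in>torus_zeros (face_polynomial s F). order_at (face_polynomial s F) p = d') \<and>
      (\<forall>F\<in>compact_faces s. \<forall>p\<in>torus_zeros (face_polynomial s F). order_at (face_polynomial s F) p \<le> d') \<and> real d' > d"
  have "\<exists>r>0. r \<le> r1 \<and> (?H1 \<longrightarrow> upper_bounded r (nat (int CARD('n) - aff_dim C)) d)"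
  proof (cases ?H1)
    case True
    then show ?thesis using measure_upper_log unfolding upper_bounded_def by simp
  qed (use r1 in blast)
  then obtain ra where ra: "ra > 0" "ra \<le> r1" "?H1 \<Longrightarrow> upper_bounded ra (nat (int CARD('n) - aff_dim C)) d" by blast
  have "\<exists>r>0. r \<le> r1 \<and> (?H1 \<and> ?H2 \<longrightarrow> upper_bounded r (nat (int CARD('n) - aff_dim C - 1)) d)"
  proof (cases "?H1 \<and> ?H2")
    case True
    then show ?thesis using measure_upper_log_sharp unfolding upper_bounded_def by simp
  qed (use r1 in blast)
  then obtain rb where rb: "rb > 0" "rb \<le> r1" "?H1 \<Longrightarrow> ?H2 \<Longrightarrow> upper_bounded rb (nat (int CARD('n) - aff_dim C - 1)) d" by blast
  have "\<exists>r>0. r \<le> r1 \<and> (\<forall>d'. ?H3 d' \<longrightarrow> upper_bounded r 0 (real d'))"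
  proof (cases "\<exists>d'. ?H3 d'")
    case True
    then obtain d' where d': "?H3 d'" by blast
    have le: "a \<le> b" if a: "?H3 a" and b: "?H3 b" for a b
    proof -
      obtain F p where F: "F \<in> compact_faces s" "p \<in> torus_zeros (face_polynomial s F)"
        "order_at (face_polynomial s F) p = a" using a by blast
      have "order_at (face_polynomial s F) p \<le> b" using b F(1,2) by blast
      then show ?thesis using F(3) by simp
    qed
    have uniq: "d'' = d'" if "?H3 d''" for d'' using le[OF that d'] le[OF d' that] by simp
    have "\<exists>r>0. r \<le> r1 \<and> upper_bounded r 0 (real d')"
      using measure_upper_power[of "real d'"] d' unfolding upper_bounded_def by simp
    then show ?thesis using uniq by blast
  qed (use r1 in blast)
  then obtain rc where rc: "rc > 0" "rc \<le> r1" "\<And>d'. ?H3 d' \<Longrightarrow> upper_bounded rc 0 (real d')" by blast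
  define r where "r = min ra (min rb rc)"
  have r: "r > 0" "r \<le> r1" "r \<le> ra" "r \<le> rb" "r \<le> rc" using ra rb rc by (auto simp: r_def)
  show ?thesis
    by (rule exI[of _ r], intro conjI r impI allI)
      (blast intro: upper_bounded_mono[OF ra(3) r(3) ra(2)] upper_bounded_mono[OF rb(3) r(4) rb(2)]
        upper_bounded_mono[OF rc(3) r(5) rc(2)])+
qed

end

theorem theorem1p2:
  fixes S :: "real^'n::finite \<Rightarrow> real"
    and W :: "(real^'n) set"
    and s :: "('n \<Rightarrow> nat) \<Rightarrow> real"
    and d :: real
    and k n :: int
  assumes "open W" and "0 \<in> W" and "real_analytic_on S W"
    and "\<not> (\<forall>\<^sub>F x in nhds 0. S x = 0)"
    and "S 0 = 0" and "\<forall>i. partial_deriv i S 0 = 0"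
    and "has_power_series S s 0"
    and "n = int CARD('n)"
    and "d = newton_distance s"
    and "k = aff_dim (central_face s)"
  shows
    "\<exists>U. open U \<and> 0 \<in> U \<and> U \<subseteq> W \<and>
      (\<forall>\<phi> :: real^'n \<Rightarrow> real.
        smooth \<phi> \<and> (\<forall>x. \<phi> x \<ge> 0) \<and> closure {x. \<phi> x \<noteq> 0} \<subseteq> U \<and> \<phi> 0 > 0 \<longrightarrow>
        \<comment> \<open>(a)\<close>
        (\<exists>C>0. \<forall>\<^sub>F \<epsilon> in at_right 0.
           sublevel_integral S \<phi> \<epsilon> > C * \<bar>ln \<epsilon>\<bar> powi (n - k - 1) * \<epsilon> powr (1 / d))
        \<and>
        \<comment> \<open>(b)\<close>
        ((\<forall>F\<in>compact_faces s. \<forall>p\<in>torus_zeros (face_polynomial s F).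
            real (order_at (face_polynomial s F) p) \<le> d) \<longrightarrow>
          (\<exists>C'>0. \<forall>\<^sub>F \<epsilon> in at_right 0.
             sublevel_integral S \<phi> \<epsilon> < C' * \<bar>ln \<epsilon>\<bar> powi (n - k) * \<epsilon> powr (1 / d))
          \<and>
          (\<not> (\<exists>F\<in>compact_faces s. F \<subseteq> central_face s \<and>
                (\<exists>p\<in>torus_zeros (face_polynomial s F).
                   real (order_at (face_polynomial s F) p) = d)) \<longrightarrow>
            (\<exists>C'>0. \<forall>\<^sub>F \<epsilon> in at_right 0.
               sublevel_integral S \<phi> \<epsilon> < C' * \<bar>ln \<epsilon>\<bar> powi (n - k - 1) * \<epsilon> powr (1 / d))))
        \<and>
        \<comment> \<open>(c)\<close>
        (\<forall>d' :: nat.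
          (\<exists>F\<in>compact_faces s. \<exists>p\<in>torus_zeros (face_polynomial s F).
             order_at (face_polynomial s F) p = d') \<and>
          (\<forall>F\<in>compact_faces s. \<forall>p\<in>torus_zeros (face_polynomial s F).
             order_at (face_polynomial s F) p \<le> d') \<and>
          real d' > d \<longrightarrow>
          (\<exists>C'>0. \<forall>\<^sub>F \<epsilon> in at_right 0.
             sublevel_integral S \<phi> \<epsilon> < C' * \<epsilon> powr (1 / real d'))))"
proof -
  obtain r1 where "germ s S r1" using germ_of_power_series[OF assms(7,4,5)] by blast
  then interpret germ s S r1 .
  have dd: "d = newton.d s" using assms(9) by (simp add: newton.d_def[OF newton_axioms])
  \<comment> \<open>The integer exponents of the statement become natural numbers; since k < n the
    conversion truncates nothing, for n - k - 1 either.\<close>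
  define e1 where "e1 = nat (int CARD('n) - aff_dim (central_face s))"
  define e2 where "e2 = nat (int CARD('n) - aff_dim (central_face s) - 1)"
  have e: "n - k = int e1" "n - k - 1 = int e2"
    using aff_dim_C_less(1) assms(8,10) by (auto simp: e1_def e2_def)
  let ?H1 = "\<forall>F\<in>compact_faces s. \<forall>p\<in>torus_zeros (face_polynomial s F).
    real (order_at (face_polynomial s F) p) \<le> d"
  let ?H2 = "\<not> (\<exists>F\<in>compact_faces s. F \<subseteq> central_face s \<and>
    (\<exists>p\<in>torus_zeros (face_polynomial s F). real (order_at (face_polynomial s F) p) = d))"
  let ?H3 = "\<lambda>d'. (\<exists>F\<in>compact_faces s. \<exists>p\<in>torus_zeros (face_polynomial s F).
      order_at (face_polynomial s F) p = d') \<and>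
    (\<forall>F\<in>compact_faces s. \<forall>p\<in>torus_zeros (face_polynomial s F).
      order_at (face_polynomial s F) p \<le> d') \<and> real d' > d"
  obtain r where r: "r > 0" "r \<le> r1"
    and ub: "?H1 \<longrightarrow> upper_bounded r e1 d \<and> (?H2 \<longrightarrow> upper_bounded r e2 d)"
    and ub3: "\<forall>d'. ?H3 d' \<longrightarrow> upper_bounded r 0 (real d')"
    using ex_common_radius unfolding dd[symmetric] e1_def[symmetric] e2_def[symmetric]
    by (elim exE conjE)
  let ?U = "{x. \<forall>i. \<bar>x $ i\<bar> < r} \<inter> W"
  have "open {x::real^'n. \<forall>i. \<bar>x $ i\<bar> < r}"
  proof -
    have "{x::real^'n. \<forall>i. \<bar>x $ i\<bar> < r} = (\<Inter>i. {x. \<bar>x $ i\<bar> < r})" by auto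
    moreover have "open {x::real^'n. \<bar>x $ i\<bar> < r}" for i by (intro open_Collect_less continuous_intros)
    ultimately show ?thesis by (simp add: open_INT)
  qed
  then have U: "open ?U" "0 \<in> ?U" "?U \<subseteq> W" using assms(1,2) r(1) by auto
  show ?thesis
  proof (intro exI[of _ ?U] conjI U allI impI)
    fix \<phi> :: "real^'n \<Rightarrow> real"
    assume \<phi>: "smooth \<phi> \<and> (\<forall>x. 0 \<le> \<phi> x) \<and> closure {x. \<phi> x \<noteq> 0} \<subseteq> ?U \<and> 0 < \<phi> 0"
    have cont: "continuous_on UNIV \<phi>"
    proof (rule differentiable_imp_continuous_on)
      show "\<phi> differentiable_on UNIV" using \<phi> unfolding smooth_def by (metis partial_derivs.simps(1))
    qed
    have supp: "x \<in> cube r" if "\<phi> x \<noteq> 0" for x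
    proof -
      have "x \<in> ?U" using that \<phi> closure_subset[of "{x. \<phi> x \<noteq> 0}"] by blast
      then show ?thesis by (simp add: cube_def less_imp_le)
    qed
    note bounds = sublevel_integral_bounds[OF r cont _ supp]
    obtain B where B: "B > 0"
        "\<And>\<epsilon>. sublevel_integral S \<phi> \<epsilon> \<le> B * measure lebesgue {x\<in>cube r. \<bar>S x\<bar> < \<epsilon>}"
      using bounds(1) \<phi> by blast
    obtain \<rho> \<delta> where \<rho>: "0 < \<rho>" "\<rho> \<le> r1" and \<delta>: "\<delta> > 0"
        "\<And>\<epsilon>. \<delta> * measure lebesgue {x\<in>cube \<rho>. \<bar>S x\<bar> < \<epsilon>} \<le> sublevel_integral S \<phi> \<epsilon>"
      using bounds(2) \<phi> by blast
    note upper = eventually_upper[OF _ B]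
    show "\<exists>C>0. \<forall>\<^sub>F \<epsilon> in at_right 0.
        sublevel_integral S \<phi> \<epsilon> > C * \<bar>ln \<epsilon>\<bar> powi (n - k - 1) * \<epsilon> powr (1 / d)"
    proof -
      obtain c where c: "c > 0" "\<And>\<epsilon>. 0 < \<epsilon> \<Longrightarrow> \<epsilon> < 1 \<Longrightarrow>
          c * \<bar>ln \<epsilon>\<bar> ^ e2 * \<epsilon> powr (1 / d) \<le> measure lebesgue {x\<in>cube \<rho>. \<bar>S x\<bar> < \<epsilon>}"
        using measure_lower[OF \<rho>] unfolding dd[symmetric] e2_def[symmetric] by blast
      have "\<delta> * c / 2 * \<bar>ln \<epsilon>\<bar> ^ e2 * \<epsilon> powr (1 / d) < sublevel_integral S \<phi> \<epsilon>"
        if \<epsilon>: "0 < \<epsilon>" "\<epsilon> < 1" for \<epsilon>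
      proof -
        have "0 < \<delta> * (c * \<bar>ln \<epsilon>\<bar> ^ e2 * \<epsilon> powr (1 / d))" using \<epsilon> \<delta>(1) c(1) by simp
        then have "\<delta> * c / 2 * \<bar>ln \<epsilon>\<bar> ^ e2 * \<epsilon> powr (1 / d) < \<delta> * (c * \<bar>ln \<epsilon>\<bar> ^ e2 * \<epsilon> powr (1 / d))"
          by (simp add: mult.assoc)
        also have "\<dots> \<le> \<delta> * measure lebesgue {x\<in>cube \<rho>. \<bar>S x\<bar> < \<epsilon>}"
          using c(2)[OF \<epsilon>] \<delta>(1) by (intro mult_left_mono) auto
        also have "\<dots> \<le> sublevel_integral S \<phi> \<epsilon>" by (rule \<delta>(2))
        finally show ?thesis .
      qed
      then have "\<forall>\<^sub>F \<epsilon> in at_right 0. \<delta> * c / 2 * \<bar>ln \<epsilon>\<bar> ^ e2 * \<epsilon> powr (1 / d) < sublevel_integral S \<phi> \<epsilon>"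
        unfolding eventually_at_right_field by (intro exI[of _ 1]) auto
      then show ?thesis using \<delta>(1) c(1) unfolding e(2) power_int_of_nat
        by (intro exI[of _ "\<delta> * c / 2"]) auto
    qed
    show "\<exists>C'>0. \<forall>\<^sub>F \<epsilon> in at_right 0.
        sublevel_integral S \<phi> \<epsilon> < C' * \<bar>ln \<epsilon>\<bar> powi (n - k) * \<epsilon> powr (1 / d)" if ?H1
      using upper[OF conjunct1[OF mp[OF ub that]]] unfolding e(1) power_int_of_nat .
    show "\<exists>C'>0. \<forall>\<^sub>F \<epsilon> in at_right 0.
        sublevel_integral S \<phi> \<epsilon> < C' * \<bar>ln \<epsilon>\<bar> powi (n - k - 1) * \<epsilon> powr (1 / d)" if ?H1 ?H2
      using upper[OF mp[OF conjunct2[OF mp[OF ub that(1)]] that(2)]] unfolding e(2) power_int_of_nat .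
    show "\<exists>C'>0. \<forall>\<^sub>F \<epsilon> in at_right 0. sublevel_integral S \<phi> \<epsilon> < C' * \<epsilon> powr (1 / real d')" if "?H3 d'" for d'
      using upper[OF ub3[rule_format, OF that]] by simp
  qed
qed

end
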